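(* Let $g \colon \mathbb{R}^{+} \to \mathbb{R}^{+}$ be a continuous function such that $g(0)=0$, $g(s)>0$ for all $s>0$, $\lim_{s\to0^{+}} g(s)/s = 0$ and $\lim_{s\to+\infty} g(s)/s = 0$. Let $a \colon \mathbb{R} \to \mathbb{R}$ be a locally integrable periodic function of minimal period $T>0$ for which there exist $2m+1$ points (with $m\geq 1$) $\sigma_{1}<\tau_{1}<\ldots<\sigma_{m}<\tau_{m}<\sigma_{m+1}$, with $\sigma_{m+1}-\sigma_{1}=T$, such that, for $i=1,\ldots,m$, $a\succ0$ on $I^{+}_{i}:=[\sigma_{i},\tau_{i}]$ and $a\prec0$ on $I^{-}_{i}:=[\tau_{i},\sigma_{i+1}]$. For $\ell\in\mathbb{Z}$ set $I^{+}_{i,\ell}:=I^{+}_{i}+\ell T$. Then there exists $\lambda^{*}>0$ such that for each $\lambda>\lambda^{*}$ there exists $\mu^{*}(\lambda)>0$ such that, for each $\mu>\mu^{*}(\lambda)$ and each integer $k\geq2$, the equation $$u''+\bigl(\lambda a^{+}(t)-\mu a^{-}(t)\bigr)g(u)=0$$ has at least $3^{km}-1$ positive $kT$-periodic solutions. More precisely, for every constant $\rho>0$ there exists $\lambda^{*}=\lambda^{*}(\rho)>0$ such that for each $\lambda>\lambda^{*}$ there exist two constants $r,R$ with $0<r<\rho<R$ and $\mu^{*}(\lambda)=\mu^{*}(\lambda,r,R)>0$ such that, for any $\mu>\mu^{*}(\lambda)$ and for any integer $k\geq2$, the following holds: given any finite string $\mathcal{S}=(\mathcal{S}_{1},\ldots,\mathcal{S}_{km})\in\{0,1,2\}^{km}$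 with $\mathcal{S}\neq(0,\ldots,0)$, there exists a positive $kT$-periodic solution $u(t)$ of the equation such that, for all $i=1,\ldots,m$ and $\ell=0,\ldots,k-1$: \begin{itemize} \item $\max_{t\in I^{+}_{i,\ell}}u(t)<r$, if $\mathcal{S}_{j}=0$ for $j=i+\ell m$; \item $r<\max_{t\in I^{+}_{i,\ell}}u(t)<\rho$, if $\mathcal{S}_{j}=1$ for $j=i+\ell m$; \item $\rho<\max_{t\in I^{+}_{i,\ell}}u(t)<R$, if $\mathcal{S}_{j}=2$ for $j=i+\ell m$. \end{itemize}
   Context: $\mathbb{R}^{+}:=[0,+\infty)$; $a^{+}=\max\{a,0\}$ and $a^{-}=\max\{-a,0\}$. On a given interval, $w\succ0$ means that $w(t)\geq0$ for almost every $t$ and $w$ is not almost everywhere zero on that interval; $w\prec0$ means $-w\succ0$. Solutions are meant in the Carathéodory sense ($u$ is $C^{1}$ with $u'$ locally absolutely continuous and the equation holds almost everywhere). A positive $kT$-periodic solution is a solution defined on $\mathbb{R}$ with $u(t)=u(t+kT)>0$ for all $t\in\mathbb{R}$. *)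

theory Defs
  imports "HOL-Analysis.Analysis"
begin

definition pos_part :: "real \<Rightarrow> real" where
  "pos_part x = max x 0"

definition neg_part :: "real \<Rightarrow> real" where
  "neg_part x = max (- x) 0"

definition locally_integrable :: "(real \<Rightarrow> real) \<Rightarrow> bool" where
  "locally_integrable f \<longleftrightarrow> (\<forall>x y. f absolutely_integrable_on {x..y})"

definition periodic :: "real \<Rightarrow> (real \<Rightarrow> real) \<Rightarrow> bool" where
  "periodic T f \<longleftrightarrow> (\<forall>t. f (t + T) = f t)"

definition minimal_period :: "real \<Rightarrow> (real \<Rightarrow> real) \<Rightarrow> bool" where
  "minimal_period T f \<longleftrightarrow>
     0 < T \<and> periodic T f \<and> (\<forall>S. 0 < S \<and> S < T \<longrightarrow> \<not> periodic S f)"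

definition succ_zero_on :: "real set \<Rightarrow> (real \<Rightarrow> real) \<Rightarrow> bool" where
  "succ_zero_on I w \<longleftrightarrow>
     (AE t in lebesgue. t \<in> I \<longrightarrow> 0 \<le> w t) \<and>
     \<not> (AE t in lebesgue. t \<in> I \<longrightarrow> w t = 0)"

definition prec_zero_on :: "real set \<Rightarrow> (real \<Rightarrow> real) \<Rightarrow> bool" where
  "prec_zero_on I w \<longleftrightarrow> succ_zero_on I (\<lambda>t. - w t)"

text \<open>
  Absolute continuity in the usual epsilon-delta sense. A finite family of non-overlapping
  subintervals of \<open>I\<close> is encoded as a finite set of pairs of endpoints.
\<close>

definition abs_continuous_on :: "real set \<Rightarrow> (real \<Rightarrow> real) \<Rightarrow> bool" where
  "abs_continuous_on I f \<longleftrightarrow>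
     (\<forall>\<epsilon>>0. \<exists>\<delta>>0. \<forall>D :: (real \<times> real) set.
        finite D \<longrightarrow>
        (\<forall>(s, t)\<in>D. s \<le> t \<and> {s..t} \<subseteq> I) \<longrightarrow>
        pairwise (\<lambda>p q. {fst p<..<snd p} \<inter> {fst q<..<snd q} = {}) D \<longrightarrow>
        (\<Sum>(s, t)\<in>D. t - s) < \<delta> \<longrightarrow>
        (\<Sum>(s, t)\<in>D. \<bar>f t - f s\<bar>) < \<epsilon>)"

definition locally_abs_continuous :: "(real \<Rightarrow> real) \<Rightarrow> bool" where
  "locally_abs_continuous f \<longleftrightarrow> (\<forall>x y. abs_continuous_on {x..y} f)"

text \<open>
  Caratheodory solutions, defined on the whole real line, of \<open>u'' + q(t) g(u) = 0\<close>.
  Differentiability of \<open>deriv u\<close> at \<open>t\<close> is stated explicitly because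
  \<open>deriv\<close> is an arbitrary value where no derivative exists.
\<close>

definition caratheodory_solution ::
    "(real \<Rightarrow> real) \<Rightarrow> (real \<Rightarrow> real) \<Rightarrow> (real \<Rightarrow> real) \<Rightarrow> bool" where
  "caratheodory_solution q g u \<longleftrightarrow>
     (\<forall>t. u differentiable (at t)) \<and>
     continuous_on UNIV (deriv u) \<and>
     locally_abs_continuous (deriv u) \<and>
     (AE t in lebesgue. deriv u differentiable (at t) \<and> deriv (deriv u) t + q t * g (u t) = 0)"

definition weight :: "(real \<Rightarrow> real) \<Rightarrow> real \<Rightarrow> real \<Rightarrow> real \<Rightarrow> real" where
  "weight a lam mu t = lam * pos_part (a t) - mu * neg_part (a t)"

definition positive_periodic_solution ::
    "(real \<Rightarrow> real) \<Rightarrow> (real \<Rightarrow> real) \<Rightarrow> real \<Rightarrow> (real \<Rightarrow> real) \<Rightarrow> bool" where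
  "positive_periodic_solution q g P u \<longleftrightarrow>
     caratheodory_solution q g u \<and> periodic P u \<and> (\<forall>t. 0 < u t)"

definition shifted_interval :: "real \<Rightarrow> real \<Rightarrow> real \<Rightarrow> int \<Rightarrow> real set" where
  "shifted_interval T s t l = {s + of_int l * T .. t + of_int l * T}"

text \<open>
  The maximum of \<open>u\<close> over \<open>I\<close>; it is only used for continuous \<open>u\<close> and
  compact nonempty \<open>I\<close>, where it is attained (\<open>Max\<close> is meant for finite sets).
\<close>

definition max_on :: "real set \<Rightarrow> (real \<Rightarrow> real) \<Rightarrow> real" where
  "max_on I u = (GREATEST y. y \<in> u ` I)"

end

theory Submission
  imports Defs "HOL-Complex_Analysis.Great_Picard"
begin

text \<open>
  Degree theory is replaced by a fixed point argument with Lagrange multipliers. For each of the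
  \<open>km\<close> intervals where the weight is positive, introduce a target height \<open>s\<close> and a multiplier
  \<open>\<theta>\<close> of the positive part of the weight on that interval. The multiplier increases as long as
  the maximum of \<open>u\<close> there stays below \<open>s\<close>, and decreases when it exceeds \<open>s\<close>; the height moves
  in \<open>{r}\<close>, \<open>[r, \<rho>]\<close> or \<open>[\<rho>, R]\<close>, according to the symbol \<open>0\<close>, \<open>1\<close>, \<open>2\<close>, in the direction of
  \<open>0\<close>, \<open>\<theta> - 1\<close> or \<open>1 - \<theta>\<close>. A Schauder fixed point of the coupled system exists without any
  largeness assumption.

  At a fixed point the maximum is at most \<open>s\<close>, with equality for the symbols \<open>1\<close> and
  \<open>2\<close>, and \<open>\<theta> \<le> 1\<close> for the symbol \<open>0\<close>. For \<open>\<mu>\<close> large, \<open>u\<close> drops below \<open>r / 2\<close> somewhere on each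
  interval where the weight is negative. From there \<open>u\<close> can climb to height \<open>r\<close> or \<open>R\<close> only if
  \<open>\<theta> > 1\<close>, because \<open>g(s)/s\<close> is small at both heights, whereas for \<open>\<lambda>\<close> large a maximum equal to
  \<open>\<rho>\<close> forces \<open>\<theta> < 1\<close>. Hence no height is stuck at an end of its range with a multiplier
  pointing outwards, and all multipliers are \<open>1\<close>. The constants do not see \<open>k\<close>.
\<close>

section \<open>Brouwer's theorem on boxes and a Schauder-type consequence\<close>

text \<open>A bare fixed point of the integral operator could be \<open>u = 0\<close>: nothing in it
  selects a pattern. Prescribing heights and letting multipliers pay for them localises the
  solution. On one block, the multiplier that goes with height \<open>r\<close>,
  \<open>\<rho>\<close>, \<open>R\<close> is above, below, above 1, so it has to pass 1 between
  \<open>r\<close> and \<open>\<rho>\<close> and again between \<open>\<rho>\<close> and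
  \<open>R\<close>. The coupled system carries out these intermediate value arguments for all blocks
  at once, without the multiplier being a function of the height. The obstacle is the upper end of
  the range of the multipliers, which compactness requires to be bounded. A block whose maximum
  stays below its target drives its multiplier to that end, and this must be contradictory; but
  \<open>g\<close> vanishes at 0, so a large multiplier lifts nothing while \<open>u\<close> is
  tiny. Hence an artificial lower bound under \<open>u\<close> in the source, scaled so that
  concavity makes it invisible at the fixed point. The order of choice is: \<open>\<rho>\<close>
  bounds \<open>\<lambda>\<close>, then \<open>\<lambda>\<close> determines \<open>r\<close> and
  \<open>R\<close>, and all of them bound \<open>\<mu>\<close>. Each estimate looks at one block and
  the two gaps beside it.\<close>

lemma bounded_coordinates_convergent_subsequence:
  fixes X :: "nat \<Rightarrow> nat \<Rightarrow> real"
  assumes "\<And>k j. j < n \<Longrightarrow> \<bar>X k j\<bar> \<le> C j"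
  obtains r x where "strict_mono (r :: nat \<Rightarrow> nat)"
    "\<And>j. j < n \<Longrightarrow> (\<lambda>k. X (r k) j) \<longlonglongrightarrow> x j"
proof -
  have "\<exists>r x. strict_mono (r :: nat \<Rightarrow> nat) \<and> (\<forall>j<n. (\<lambda>k. X (r k) j) \<longlonglongrightarrow> x j)"
    using assms
  proof (induction n)
    case 0
    show ?case by (intro exI[of _ id]) (auto simp: strict_mono_def)
  next
    case (Suc n)
    then obtain r x where r: "strict_mono (r :: nat \<Rightarrow> nat)"
      and x: "\<And>j. j < n \<Longrightarrow> (\<lambda>k. X (r k) j) \<longlonglongrightarrow> x j"
      by (metis less_SucI)
    have "bounded (range (\<lambda>k. X (r k) n))"
      unfolding bounded_iff using Suc.prems[of n] by (auto intro!: exI[of _ "C n"])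
    then obtain l s where s: "strict_mono (s :: nat \<Rightarrow> nat)" "(\<lambda>k. X (r (s k)) n) \<longlonglongrightarrow> l"
      using bounded_imp_convergent_subsequence[of "\<lambda>k. X (r k) n"] by (auto simp: o_def)
    have "(\<lambda>k. X (r (s k)) j) \<longlonglongrightarrow> (if j = n then l else x j)" if "j < Suc n" for j
      using that s x[of j] LIMSEQ_subseq_LIMSEQ[OF x s(1), of j]
      by (cases "j = n") (auto simp: o_def)
    moreover have "strict_mono (\<lambda>k. r (s k))"
      using r s(1) by (auto simp: strict_mono_def)
    ultimately show ?case
      by (intro exI[of _ "\<lambda>k. r (s k)"] exI[of _ "\<lambda>j. if j = n then l else x j"]) auto
  qed
  then show ?thesis using that by blast
qed

text \<open>The dimension is a number and not a type, because the discretisation below uses boxes of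
  growing dimension; points are therefore functions of which only the first \<open>n\<close> values
  matter. On ever finer grids, Kuhn's combinatorial lemma yields a small cube with, for each
  \<open>i\<close>, two vertices whose \<open>i\<close>-th coordinates \<open>f\<close> moves in
  opposite directions. All these vertices converge to the fixed point.\<close>

lemma brouwer_box_sequential:
  fixes f :: "(nat \<Rightarrow> real) \<Rightarrow> nat \<Rightarrow> real"
  assumes lh: "\<And>i. i < n \<Longrightarrow> lo i \<le> hi i"
    and maps: "\<And>x i. \<forall>j<n. lo j \<le> x j \<and> x j \<le> hi j \<Longrightarrow> i < n \<Longrightarrow> lo i \<le> f x i \<and> f x i \<le> hi i"
    and cont: "\<And>X x i. \<forall>k. \<forall>j<n. lo j \<le> X k j \<and> X k j \<le> hi j \<Longrightarrow>
        \<forall>j<n. lo j \<le> x j \<and> x j \<le> hi j \<Longrightarrow>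
        \<forall>j<n. (\<lambda>k. X k j) \<longlonglongrightarrow> x j \<Longrightarrow> i < n \<Longrightarrow> (\<lambda>k. f (X k) i) \<longlonglongrightarrow> f x i"
  obtains x where "\<forall>j<n. lo j \<le> x j \<and> x j \<le> hi j" "\<And>i. i < n \<Longrightarrow> f x i = x i"
proof -
  define pt :: "nat \<Rightarrow> (nat \<Rightarrow> nat) \<Rightarrow> nat \<Rightarrow> real"
    where "pt p y j = lo j + (hi j - lo j) * (real (y j) / real p)" for p y j
  \<comment> \<open>Label 0 marks grid points whose \<open>i\<close>-th coordinate is not decreased
    by \<open>f\<close>. The top face gets label 1 in any case, as Kuhn's lemma demands; this is
    consistent because \<open>f\<close> does not exceed \<open>hi\<close> there.\<close>
  define lab :: "nat \<Rightarrow> (nat \<Rightarrow> nat) \<Rightarrow> nat \<Rightarrow> nat"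
    where "lab p y i = (if y i = p then 1 else if pt p y i \<le> f (pt p y) i then 0 else 1)" for p y i
  have pt_box: "\<forall>j<n. lo j \<le> pt p y j \<and> pt p y j \<le> hi j"
    if "p > 0" "\<forall>j<n. y j \<le> p" for p y
  proof (intro allI impI)
    fix j assume j: "j < n"
    have "real (y j) / real p \<le> 1" "0 \<le> real (y j) / real p" using that j by auto
    then show "lo j \<le> pt p y j \<and> pt p y j \<le> hi j"
      using lh[OF j] mult_left_mono[of "real (y j) / real p" 1 "hi j - lo j"]
      unfolding pt_def by auto
  qed
  have lab0: "pt p y i \<le> f (pt p y) i" if "lab p y i = 0" for p y i
    using that by (auto simp: lab_def split: if_splits)
  have lab1: "f (pt p y) i \<le> pt p y i"
    if "lab p y i \<noteq> 0" "p > 0" "\<forall>j<n. y j \<le> p" "i < n" for p y i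
  proof (cases "y i = p")
    case True
    then have "pt p y i = hi i" using that(2) by (simp add: pt_def)
    then show ?thesis using maps[OF pt_box[OF that(2,3)] that(4)] by simp
  qed (use that(1) in \<open>auto simp: lab_def split: if_splits\<close>)
  have "\<exists>q a b. (\<forall>i<n. q i < Suc p) \<and> (\<forall>i<n. (\<forall>j<n. q j \<le> a i j \<and> a i j \<le> q j + 1)
      \<and> (\<forall>j<n. q j \<le> b i j \<and> b i j \<le> q j + 1)
      \<and> pt (Suc p) (a i) i \<le> f (pt (Suc p) (a i)) i \<and> f (pt (Suc p) (b i)) i \<le> pt (Suc p) (b i) i)" for p
  proof -
    obtain q where q: "\<forall>i<n. q i < Suc p"
      "\<forall>i<n. \<exists>r s. (\<forall>j<n. q j \<le> r j \<and> r j \<le> q j + 1) \<and> (\<forall>j<n. q j \<le> s j \<and> s j \<le> q j + 1)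
          \<and> lab (Suc p) r i \<noteq> lab (Suc p) s i"
    proof (rule kuhn_lemma[of "Suc p" n "lab (Suc p)"])
      show "\<forall>x. (\<forall>i<n. x i \<le> Suc p) \<longrightarrow> (\<forall>i<n. x i = 0 \<longrightarrow> lab (Suc p) x i = 0)"
      proof (intro allI impI)
        fix x i assume *: "\<forall>i<n. x i \<le> Suc p" "i < n" "x i = (0 :: nat)"
        then have "pt (Suc p) x i = lo i" by (simp add: pt_def)
        then show "lab (Suc p) x i = 0"
          using maps[OF pt_box[of "Suc p" x] \<open>i < n\<close>] * by (simp add: lab_def)
      qed
    qed (auto simp: lab_def)
    have "\<exists>a b. (\<forall>j<n. q j \<le> a j \<and> a j \<le> q j + 1) \<and> (\<forall>j<n. q j \<le> b j \<and> b j \<le> q j + 1)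
        \<and> pt (Suc p) a i \<le> f (pt (Suc p) a) i \<and> f (pt (Suc p) b) i \<le> pt (Suc p) b i"
      if "i < n" for i
    proof -
      have le: "\<forall>j<n. c j \<le> Suc p" if "\<forall>j<n. q j \<le> c j \<and> c j \<le> q j + 1" for c
        using that q(1) by fastforce
      obtain r s where rs: "\<forall>j<n. q j \<le> r j \<and> r j \<le> q j + 1" "\<forall>j<n. q j \<le> s j \<and> s j \<le> q j + 1"
          "lab (Suc p) r i \<noteq> lab (Suc p) s i"
        using q(2) \<open>i < n\<close> by blast
      show ?thesis
      proof (cases "lab (Suc p) r i = 0")
        case True
        then have "lab (Suc p) s i \<noteq> 0" using rs(3) by simp
        then show ?thesis
          using lab0[OF True] lab1[of "Suc p" s i] rs le[OF rs(2)] \<open>i < n\<close> by blast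
      next
        case False
        then have "lab (Suc p) s i = 0" using rs(3) by (auto simp: lab_def split: if_splits)
        then show ?thesis
          using lab0[of "Suc p" s i] lab1[OF False _ le[OF rs(1)]] rs \<open>i < n\<close> by blast
      qed
    qed
    then show ?thesis using q(1) by metis
  qed
  then obtain q a b where qab: "\<And>p. (\<forall>i<n. q p i < Suc p)
      \<and> (\<forall>i<n. (\<forall>j<n. q p j \<le> a p i j \<and> a p i j \<le> q p j + 1)
      \<and> (\<forall>j<n. q p j \<le> b p i j \<and> b p i j \<le> q p j + 1)
      \<and> pt (Suc p) (a p i) i \<le> f (pt (Suc p) (a p i)) i \<and> f (pt (Suc p) (b p i)) i \<le> pt (Suc p) (b p i) i)"
    by metis
  then have q: "\<And>p i. i < n \<Longrightarrow> q p i < Suc p"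
    and a: "\<And>p i j. i < n \<Longrightarrow> j < n \<Longrightarrow> q p j \<le> a p i j \<and> a p i j \<le> q p j + 1"
    and b: "\<And>p i j. i < n \<Longrightarrow> j < n \<Longrightarrow> q p j \<le> b p i j \<and> b p i j \<le> q p j + 1"
    and fa: "\<And>p i. i < n \<Longrightarrow> pt (Suc p) (a p i) i \<le> f (pt (Suc p) (a p i)) i"
    and fb: "\<And>p i. i < n \<Longrightarrow> f (pt (Suc p) (b p i)) i \<le> pt (Suc p) (b p i) i"
    by blast+
  define Y where "Y p = pt (Suc p) (q p)" for p
  have Ybox: "\<forall>j<n. lo j \<le> Y p j \<and> Y p j \<le> hi j" for p
    unfolding Y_def by (rule pt_box) (use q less_imp_le in auto)
  have "\<bar>Y p j\<bar> \<le> max \<bar>lo j\<bar> \<bar>hi j\<bar>" if "j < n" for p j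
    using Ybox that by (smt (verit))
  then obtain r x where r: "strict_mono (r :: nat \<Rightarrow> nat)"
    and x: "\<And>j. j < n \<Longrightarrow> (\<lambda>k. Y (r k) j) \<longlonglongrightarrow> x j"
    using bounded_coordinates_convergent_subsequence[of n Y "\<lambda>j. max \<bar>lo j\<bar> \<bar>hi j\<bar>"] by metis
  have xbox: "\<forall>j<n. lo j \<le> x j \<and> x j \<le> hi j"
    using Ybox LIMSEQ_le_const[OF x] LIMSEQ_le_const2[OF x] by (meson)
  have near: "(\<lambda>k. pt (Suc (r k)) (c (r k)) j) \<longlonglongrightarrow> x j"
    if "\<And>p. q p j \<le> c p j \<and> c p j \<le> q p j + 1" "j < n" for c j
  proof -
    have "(\<lambda>k. (hi j - lo j) * (1 / real (Suc (r k)))) \<longlonglongrightarrow> (hi j - lo j) * 0"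
      using LIMSEQ_subseq_LIMSEQ[OF LIMSEQ_Suc[OF lim_1_over_n] r]
      by (intro tendsto_mult_left) (auto simp: o_def)
    then have lim: "(\<lambda>k. (hi j - lo j) * (1 / real (Suc (r k)))) \<longlonglongrightarrow> 0" by simp
    have "\<bar>pt (Suc p) (c p) j - Y p j\<bar> \<le> (hi j - lo j) * (1 / real (Suc p))" for p
    proof -
      have "pt (Suc p) (c p) j - Y p j = (hi j - lo j) * ((real (c p j) - real (q p j)) / real (Suc p))"
        by (simp add: pt_def Y_def diff_divide_distrib algebra_simps del: of_nat_Suc)
      also have "\<bar>\<dots>\<bar> = (hi j - lo j) * (\<bar>real (c p j) - real (q p j)\<bar> / real (Suc p))"
        using lh[OF \<open>j < n\<close>] by (simp add: abs_mult)
      also have "\<dots> \<le> (hi j - lo j) * (1 / real (Suc p))"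
        using lh[OF \<open>j < n\<close>] that(1)[of p]
        by (intro mult_left_mono divide_right_mono) auto
      finally show ?thesis .
    qed
    then have "(\<lambda>k. pt (Suc (r k)) (c (r k)) j - Y (r k) j) \<longlonglongrightarrow> 0"
      by (intro Lim_null_comparison[OF _ lim]) auto
    from tendsto_add[OF this x[OF \<open>j < n\<close>]] show ?thesis by simp
  qed
  have "f x i = x i" if i: "i < n" for i
  proof (rule antisym)
    have box: "\<forall>k. \<forall>j<n. lo j \<le> pt (Suc (r k)) (c (r k)) j \<and> pt (Suc (r k)) (c (r k)) j \<le> hi j"
      if "\<And>p j. j < n \<Longrightarrow> q p j \<le> c p j \<and> c p j \<le> q p j + 1" for c
    proof
      fix k
      have "c (r k) j \<le> Suc (r k)" if "j < n" for j
        using q[OF that, of "r k"] \<open>\<And>p j. j < n \<Longrightarrow> q p j \<le> c p j \<and> c p j \<le> q p j + 1\<close>[OF that, of "r k"]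
        by linarith
      then show "\<forall>j<n. lo j \<le> pt (Suc (r k)) (c (r k)) j \<and> pt (Suc (r k)) (c (r k)) j \<le> hi j"
        by (intro pt_box) auto
    qed
    have "(\<lambda>k. f (pt (Suc (r k)) (b (r k) i)) i) \<longlonglongrightarrow> f x i"
      using i by (intro cont[OF box[of "\<lambda>p. b p i"] xbox]) (auto intro!: near[of _ "\<lambda>p. b p i"] dest: b)
    then show "f x i \<le> x i"
      using near[of i "\<lambda>p. b p i"] b i fb by (intro LIMSEQ_le) auto
    have "(\<lambda>k. f (pt (Suc (r k)) (a (r k) i)) i) \<longlonglongrightarrow> f x i"
      using i by (intro cont[OF box[of "\<lambda>p. a p i"] xbox]) (auto intro!: near[of _ "\<lambda>p. a p i"] dest: a)
    then show "x i \<le> f x i"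
      using near[of i "\<lambda>p. a p i"] a i fa by (intro LIMSEQ_le[OF _ \<open>(\<lambda>k. f (pt (Suc (r k)) (a (r k) i)) i) \<longlonglongrightarrow> f x i\<close>]) auto
  qed
  then show ?thesis using that xbox by blast
qed

text \<open>
  The function component is discretised by step functions, so that Brouwer's theorem
  applies; the Lipschitz bound makes the resulting approximate fixed points compact.
\<close>

lemma schauder_box_lipschitz:
  fixes X :: "(nat \<Rightarrow> real) \<Rightarrow> (real \<Rightarrow> real) \<Rightarrow> nat \<Rightarrow> real"
    and V :: "(nat \<Rightarrow> real) \<Rightarrow> (real \<Rightarrow> real) \<Rightarrow> real \<Rightarrow> real"
  defines "bx \<equiv> \<lambda>x d lo hi. \<forall>i<d. lo i \<le> x i \<and> x i \<le> (hi i :: real)"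
    and "adm \<equiv> \<lambda>v M. v \<in> borel_measurable borel \<and> (\<forall>t. 0 \<le> v t \<and> v t \<le> (M :: real))"
  assumes AB: "A < B" and M: "0 \<le> M" and L: "0 \<le> L"
    and lh: "\<And>i. i < d \<Longrightarrow> lo i \<le> hi i"
    and X_maps: "\<And>x v i. bx x d lo hi \<Longrightarrow> adm v M \<Longrightarrow> i < d \<Longrightarrow> lo i \<le> X x v i \<and> X x v i \<le> hi i"
    and V_maps: "\<And>x v t. bx x d lo hi \<Longrightarrow> adm v M \<Longrightarrow> t \<in> {A..B} \<Longrightarrow> 0 \<le> V x v t \<and> V x v t \<le> M"
    and V_lip: "\<And>x v t t'. bx x d lo hi \<Longrightarrow> adm v M \<Longrightarrow> t \<in> {A..B} \<Longrightarrow> t' \<in> {A..B} \<Longrightarrow>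
        \<bar>V x v t - V x v t'\<bar> \<le> L * \<bar>t - t'\<bar>"
    and X_cont: "\<And>xs vs x v i. (\<And>k. bx (xs k) d lo hi) \<Longrightarrow> (\<And>k. adm (vs k) M) \<Longrightarrow>
        bx x d lo hi \<Longrightarrow> adm v M \<Longrightarrow> (\<And>i. i < d \<Longrightarrow> (\<lambda>k. xs k i) \<longlonglongrightarrow> x i) \<Longrightarrow>
        uniform_limit {A..B} vs v sequentially \<Longrightarrow> i < d \<Longrightarrow>
        (\<lambda>k. X (xs k) (vs k) i) \<longlonglongrightarrow> X x v i"
    and V_cont: "\<And>xs vs x v t. (\<And>k. bx (xs k) d lo hi) \<Longrightarrow> (\<And>k. adm (vs k) M) \<Longrightarrow>
        bx x d lo hi \<Longrightarrow> adm v M \<Longrightarrow> (\<And>i. i < d \<Longrightarrow> (\<lambda>k. xs k i) \<longlonglongrightarrow> x i) \<Longrightarrow>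
        uniform_limit {A..B} vs v sequentially \<Longrightarrow> t \<in> {A..B} \<Longrightarrow>
        (\<lambda>k. V (xs k) (vs k) t) \<longlonglongrightarrow> V x v t"
  obtains x v where "bx x d lo hi" "adm v M" "continuous_on UNIV v"
    "\<And>i. i < d \<Longrightarrow> X x v i = x i" "\<And>t. t \<in> {A..B} \<Longrightarrow> V x v t = v t"
proof -
  \<comment> \<open>Index of the cell containing \<open>t\<close> in the uniform partition into
    \<open>n\<close> cells. \<open>min\<close> puts \<open>B\<close> into the last cell and
    \<open>nat\<close> sends points left of \<open>A\<close> to cell 0, so that step functions live
    on all reals.\<close>
  define ix :: "nat \<Rightarrow> real \<Rightarrow> nat"
    where "ix n t = min (n - 1) (nat \<lfloor>n * (t - A) / (B - A)\<rfloor>)" for n t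
  define node :: "nat \<Rightarrow> nat \<Rightarrow> real" where "node n i = A + i * (B - A) / n" for n i
  define stp :: "nat \<Rightarrow> (nat \<Rightarrow> real) \<Rightarrow> real \<Rightarrow> real" where "stp n y t = y (d + ix n t)" for n y t
  have ix_less: "ix n t < n" if "n > 0" for n t using that by (auto simp: ix_def)
  have node_in: "node n i \<in> {A..B}" if "i < n" for n i
  proof -
    have "i * (B - A) / n \<le> B - A" using that AB by (simp add: divide_simps mult_right_mono)
    moreover have "0 \<le> i * (B - A) / n" using AB by simp
    ultimately show ?thesis unfolding node_def by (auto simp del: times_divide_eq_left)
  qed
  have node_near: "\<bar>t - node n (ix n t)\<bar> \<le> (B - A) / n" if n: "n > 0" and t: "t \<in> {A..B}" for n t
  proof -
    define w where "w = n * (t - A) / (B - A)"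
    have w: "0 \<le> w" "w \<le> n" using t AB by (auto simp: w_def divide_simps mult_left_mono)
    have "\<bar>w - ix n t\<bar> \<le> 1"
    proof (cases "w < n")
      case True
      then have "nat \<lfloor>w\<rfloor> \<le> n - 1" using w n by linarith
      then have "ix n t = nat \<lfloor>w\<rfloor>" unfolding ix_def w_def by simp
      then show ?thesis using w by linarith
    next
      case False
      then have "w = n" using w by simp
      then have "ix n t = n - 1" unfolding ix_def w_def[symmetric] by simp
      then show ?thesis using \<open>w = n\<close> n by simp
    qed
    moreover have "t - node n (ix n t) = (w - ix n t) * ((B - A) / n)"
      using n AB by (simp add: node_def w_def field_simps)
    moreover have "0 \<le> (B - A) / n" using AB by simp
    ultimately show ?thesis
      using mult_right_mono[of "\<bar>w - ix n t\<bar>" 1 "(B - A) / n"] by (simp only: abs_mult abs_of_nonneg mult_1)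
  qed
  have stp_adm: "adm (stp n y) M" if n: "n > 0" and y: "\<forall>j<n. 0 \<le> y (d + j) \<and> y (d + j) \<le> M" for n y
  proof -
    have "stp n y \<in> borel_measurable borel"
      unfolding stp_def ix_def by measurable
    then show ?thesis using y ix_less[OF n] unfolding adm_def stp_def by simp
  qed
  have "\<exists>y. bx y d lo hi \<and> (\<forall>j<n. 0 \<le> y (d + j) \<and> y (d + j) \<le> M)
      \<and> (\<forall>i<d. X y (stp n y) i = y i) \<and> (\<forall>j<n. V y (stp n y) (node n j) = y (d + j))"
    if n: "n > 0" for n
  proof -
    \<comment> \<open>Brouwer's theorem is applied to \<open>d + n\<close> numbers: the parameters,
      followed by the values of a step function on the \<open>n\<close> cells, each updated by
      sampling \<open>V\<close> at the left end of its cell.\<close>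
    define f where "f y i = (if i < d then X y (stp n y) i else V y (stp n y) (node n (i - d)))" for y i
    define lo' where "lo' i = (if i < d then lo i else 0)" for i
    define hi' where "hi' i = (if i < d then hi i else M)" for i
    have split: "bx y d lo hi \<and> (\<forall>j<n. 0 \<le> y (d + j) \<and> y (d + j) \<le> M)"
      if yb: "\<forall>j<d + n. lo' j \<le> y j \<and> y j \<le> hi' j" for y
    proof -
      have "lo i \<le> y i \<and> y i \<le> hi i" if "i < d" for i
        using yb[rule_format, of i] that by (simp add: lo'_def hi'_def)
      moreover have "0 \<le> y (d + j) \<and> y (d + j) \<le> M" if "j < n" for j
        using yb[rule_format, of "d + j"] that by (simp add: lo'_def hi'_def)
      ultimately show ?thesis by (simp add: bx_def)
    qed
    obtain y where y: "\<forall>j<d + n. lo' j \<le> y j \<and> y j \<le> hi' j" "\<And>i. i < d + n \<Longrightarrow> f y i = y i"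
    proof (rule brouwer_box_sequential[of "d + n" lo' hi' f])
      show "lo' i \<le> hi' i" for i using lh M by (auto simp: lo'_def hi'_def)
      show "lo' i \<le> f y i \<and> f y i \<le> hi' i" if "\<forall>j<d + n. lo' j \<le> y j \<and> y j \<le> hi' j" "i < d + n" for y i
        using split[OF that(1)] that(2) X_maps[of y "stp n y" i] V_maps[of y "stp n y" "node n (i - d)"]
          stp_adm[OF n] node_in[of "i - d" n]
        unfolding f_def lo'_def hi'_def by auto
      show "(\<lambda>k. f (Y k) i) \<longlonglongrightarrow> f y i"
        if Y: "\<forall>k. \<forall>j<d + n. lo' j \<le> Y k j \<and> Y k j \<le> hi' j" and y: "\<forall>j<d + n. lo' j \<le> y j \<and> y j \<le> hi' j"
          and lim: "\<forall>j<d + n. (\<lambda>k. Y k j) \<longlonglongrightarrow> y j" and i: "i < d + n" for Y y i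
      proof -
        have ul: "uniform_limit {A..B} (\<lambda>k. stp n (Y k)) (stp n y) sequentially"
        proof (rule uniform_limitI)
          fix e :: real assume "e > 0"
          have "\<forall>\<^sub>F k in sequentially. \<forall>j\<in>{..<n}. dist (Y k (d + j)) (y (d + j)) < e"
            using lim \<open>e > 0\<close> by (intro eventually_ball_finite) (auto intro: tendstoD)
          then show "\<forall>\<^sub>F k in sequentially. \<forall>t\<in>{A..B}. dist (stp n (Y k) t) (stp n y t) < e"
            by eventually_elim (use ix_less[OF n] in \<open>auto simp: stp_def\<close>)
        qed
        show ?thesis
        proof (cases "i < d")
          case True
          have "(\<lambda>k. X (Y k) (stp n (Y k)) i) \<longlonglongrightarrow> X y (stp n y) i"
            using split Y y lim True ul stp_adm[OF n] by (intro X_cont) auto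
          then show ?thesis using True by (simp add: f_def)
        next
          case False
          have "(\<lambda>k. V (Y k) (stp n (Y k)) (node n (i - d))) \<longlonglongrightarrow> V y (stp n y) (node n (i - d))"
            using split Y y lim False i ul stp_adm[OF n] node_in[of "i - d" n] by (intro V_cont) auto
          then show ?thesis using False by (simp add: f_def)
        qed
      qed
    qed blast
    have "X y (stp n y) i = y i" if "i < d" for i using y(2)[of i] that by (simp add: f_def)
    moreover have "V y (stp n y) (node n j) = y (d + j)" if "j < n" for j
      using y(2)[of "d + j"] that by (simp add: f_def)
    ultimately show ?thesis using split[OF y(1)] by blast
  qed
  then have "\<exists>y. bx y d lo hi \<and> (\<forall>j<Suc n. 0 \<le> y (d + j) \<and> y (d + j) \<le> M)
      \<and> (\<forall>i<d. X y (stp (Suc n) y) i = y i) \<and> (\<forall>j<Suc n. V y (stp (Suc n) y) (node (Suc n) j) = y (d + j))" for n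
    by simp
  then obtain y where y: "\<And>n. bx (y n) d lo hi" "\<And>n. \<forall>j<Suc n. 0 \<le> y n (d + j) \<and> y n (d + j) \<le> M"
    "\<And>n i. i < d \<Longrightarrow> X (y n) (stp (Suc n) (y n)) i = y n i"
    "\<And>n j. j < Suc n \<Longrightarrow> V (y n) (stp (Suc n) (y n)) (node (Suc n) j) = y n (d + j)"
    by metis
  define v where "v n = stp (Suc n) (y n)" for n
  define u where "u n = V (y n) (v n)" for n
  have v_adm: "adm (v n) M" for n unfolding v_def by (rule stp_adm) (use y(2) in auto)
  \<comment> \<open>\<open>v n\<close> takes on each cell the value of \<open>u n\<close> at its
    left end, so the two differ by at most the Lipschitz constant times the mesh. Ascoli's theorem
    can then be applied to \<open>u n\<close>, which is equicontinuous although \<open>v n\<close>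
    has jumps.\<close>
  have vu: "\<bar>v n t - u n t\<bar> \<le> L * (B - A) * (1 / Suc n)" if t: "t \<in> {A..B}" for n t
  proof -
    let ?t = "node (Suc n) (ix (Suc n) t)"
    have i: "ix (Suc n) t < Suc n" by (rule ix_less) simp
    have "v n t = u n ?t" using y(4)[OF i] by (simp add: v_def u_def stp_def)
    then have "\<bar>v n t - u n t\<bar> \<le> L * \<bar>?t - t\<bar>"
      using V_lip[OF y(1) v_adm node_in[OF i] t] by (simp add: u_def)
    also have "\<dots> \<le> L * ((B - A) / Suc n)"
      using node_near[OF _ t, of "Suc n"] L by (intro mult_left_mono) (auto simp: abs_minus_commute)
    finally show ?thesis by simp
  qed
  obtain w k where w: "continuous_on {A..B} w" "strict_mono (k :: nat \<Rightarrow> nat)"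
    "\<And>e. 0 < e \<Longrightarrow> \<exists>N. \<forall>n t. n \<ge> N \<and> t \<in> {A..B} \<longrightarrow> norm (u (k n) t - w t) < e"
  proof (rule Arzela_Ascoli[of "{A..B}" u M])
    show "norm (u n t) \<le> M" if "t \<in> {A..B}" for n t
      using V_maps[OF y(1) v_adm that] by (simp add: u_def)
    show "\<exists>c>0. \<forall>n y. y \<in> {A..B} \<and> norm (t - y) < c \<longrightarrow> norm (u n t - u n y) < e"
      if t: "t \<in> {A..B}" and e: "0 < e" for t e
    proof (intro exI[of _ "e / (L + 1)"] conjI allI impI)
      show "0 < e / (L + 1)" using e L by simp
      fix n z assume z: "z \<in> {A..B} \<and> norm (t - z) < e / (L + 1)"
      have "norm (u n t - u n z) \<le> L * \<bar>t - z\<bar>" unfolding u_def using V_lip[OF y(1) v_adm t] z by simp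
      also have "\<dots> \<le> (L + 1) * \<bar>t - z\<bar>" by (intro mult_right_mono) auto
      also have "\<dots> < e" using z L by (simp add: field_simps)
      finally show "norm (u n t - u n z) < e" .
    qed
  qed auto
  have "\<bar>y (k n) i\<bar> \<le> max \<bar>lo i\<bar> \<bar>hi i\<bar>" if "i < d" for n i
    using y(1)[of "k n"] that unfolding bx_def by (smt (verit))
  then obtain r x where r: "strict_mono (r :: nat \<Rightarrow> nat)"
    and x: "\<And>i. i < d \<Longrightarrow> (\<lambda>n. y (k (r n)) i) \<longlonglongrightarrow> x i"
    using bounded_coordinates_convergent_subsequence[of d "\<lambda>n. y (k n)" "\<lambda>i. max \<bar>lo i\<bar> \<bar>hi i\<bar>"] by metis
  have xbox: "bx x d lo hi"
    unfolding bx_def using y(1)[unfolded bx_def] LIMSEQ_le_const[OF x] LIMSEQ_le_const2[OF x] by meson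
  \<comment> \<open>The constant extension beyond the interval, since admissibility and continuity
    are demanded on the whole line.\<close>
  define z where "z t = w (max A (min B t))" for t
  have z_eq: "z t = w t" if "t \<in> {A..B}" for t using that by (simp add: z_def)
  have z_cont: "continuous_on UNIV z"
    unfolding z_def by (rule continuous_on_compose2[OF w(1)]) (use AB in \<open>auto intro!: continuous_intros\<close>)
  have ulim_u: "uniform_limit {A..B} (\<lambda>n. u (k (r n))) z sequentially"
  proof (rule uniform_limitI)
    fix e :: real assume "e > 0"
    then obtain N where "\<forall>n t. n \<ge> N \<and> t \<in> {A..B} \<longrightarrow> norm (u (k n) t - w t) < e" using w(3) by blast
    then have "\<forall>t\<in>{A..B}. dist (u (k (r n)) t) (z t) < e" if "n \<ge> N" for n
      using that seq_suble[OF r, of n] by (auto simp: dist_norm z_eq)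
    then show "\<forall>\<^sub>F n in sequentially. \<forall>t\<in>{A..B}. dist (u (k (r n)) t) (z t) < e"
      unfolding eventually_sequentially by blast
  qed
  have lim0: "(\<lambda>n. L * (B - A) * (1 / Suc (k (r n)))) \<longlonglongrightarrow> 0"
  proof -
    have "strict_mono (\<lambda>n. k (r n))" using w(2) r by (auto simp: strict_mono_def)
    from LIMSEQ_subseq_LIMSEQ[OF LIMSEQ_Suc[OF lim_1_over_n] this]
    have "(\<lambda>n. L * (B - A) * (1 / Suc (k (r n)))) \<longlonglongrightarrow> L * (B - A) * 0"
      by (intro tendsto_mult_left) (auto simp: o_def)
    then show ?thesis by simp
  qed
  have ulim_v: "uniform_limit {A..B} (\<lambda>n. v (k (r n))) z sequentially"
  proof (rule uniform_limitI)
    fix e :: real assume "e > 0"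
    then have "\<forall>\<^sub>F n in sequentially. \<forall>t\<in>{A..B}. dist (u (k (r n)) t) (z t) < e / 2"
      using uniform_limitD[OF ulim_u, of "e / 2"] by simp
    moreover have "\<forall>\<^sub>F n in sequentially. L * (B - A) * (1 / Suc (k (r n))) < e / 2"
      using order_tendstoD(2)[OF lim0, of "e / 2"] \<open>e > 0\<close> by simp
    ultimately show "\<forall>\<^sub>F n in sequentially. \<forall>t\<in>{A..B}. dist (v (k (r n)) t) (z t) < e"
    proof eventually_elim
      case (elim n)
      show ?case
      proof
        fix t assume t: "t \<in> {A..B}"
        then show "dist (v (k (r n)) t) (z t) < e"
          using elim(1)[rule_format, OF t] elim(2) vu[OF t, of "k (r n)"] unfolding dist_real_def by linarith
      qed
    qed
  qed
  have z_adm: "adm z M"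
    unfolding adm_def
  proof (intro conjI allI)
    show "z \<in> borel_measurable borel" using z_cont by (rule borel_measurable_continuous_onI)
    fix t
    define t' where "t' = max A (min B t)"
    have t': "t' \<in> {A..B}" using AB by (auto simp: t'_def)
    have "(\<lambda>n. u (k (r n)) t') \<longlonglongrightarrow> z t'" using tendsto_uniform_limitI[OF ulim_u t'] .
    moreover have "0 \<le> u n t' \<and> u n t' \<le> M" for n using V_maps[OF y(1) v_adm t'] by (simp add: u_def)
    ultimately have "0 \<le> z t' \<and> z t' \<le> M" by (meson LIMSEQ_le_const LIMSEQ_le_const2)
    moreover have "z t' = z t" using z_eq[OF t'] by (simp add: z_def t'_def)
    ultimately show "0 \<le> z t" "z t \<le> M" by auto
  qed
  show ?thesis
  proof (rule that[OF xbox z_adm z_cont])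
    fix i assume i: "i < d"
    have "(\<lambda>n. X (y (k (r n))) (v (k (r n))) i) \<longlonglongrightarrow> X x z i"
      by (rule X_cont[OF y(1) v_adm xbox z_adm x ulim_v i])
    moreover have "X (y n) (v n) i = y n i" for n using y(3)[OF i] by (simp add: v_def)
    ultimately show "X x z i = x i" using LIMSEQ_unique[OF _ x[OF i]] by simp
  next
    fix t assume t: "t \<in> {A..B}"
    have "(\<lambda>n. V (y (k (r n))) (v (k (r n))) t) \<longlonglongrightarrow> V x z t"
      by (rule V_cont[OF y(1) v_adm xbox z_adm x ulim_v t])
    then show "V x z t = z t"
      using LIMSEQ_unique[OF _ tendsto_uniform_limitI[OF ulim_u t]] by (simp add: u_def)
  qed
qed

section \<open>Indefinite integrals\<close>

text \<open>A relation rather than a function of the upper limit: no base point is singled out, and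
  the free additive constant lets \<open>u\<close> and its derivative themselves be such
  primitives.\<close>

definition indefinite_integral :: "(real \<Rightarrow> real) \<Rightarrow> (real \<Rightarrow> real) \<Rightarrow> bool" where
  "indefinite_integral h F \<longleftrightarrow> (\<forall>x y. x \<le> y \<longrightarrow> (h has_integral (F y - F x)) {x..y})"

lemma indefinite_integral_exists:
  assumes "\<And>x y. h integrable_on {x..y}"
  obtains F where "indefinite_integral h F" "F c = 0"
proof -
  define F where "F t = (if c \<le> t then integral {c..t} h else - integral {t..c} h)" for t
  have "F y - F x = integral {x..y} h" if "x \<le> y" for x y
  proof -
    consider "c \<le> x" | "x < c" "c \<le> y" | "y < c" using that by linarith
    then show ?thesis
    proof cases
      case 1
      then show ?thesis using Henstock_Kurzweil_Integration.integral_combine[of c x y h] assms that by (simp add: F_def)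
    next
      case 2
      then show ?thesis using Henstock_Kurzweil_Integration.integral_combine[of x c y h] assms that by (simp add: F_def)
    next
      case 3
      then show ?thesis using Henstock_Kurzweil_Integration.integral_combine[of x y c h] assms that by (simp add: F_def)
    qed
  qed
  then have "indefinite_integral h F"
    unfolding indefinite_integral_def using assms by (metis integrable_integral)
  moreover have "F c = 0" by (simp add: F_def)
  ultimately show ?thesis using that by blast
qed

lemma indefinite_integral_integrable: "indefinite_integral h F \<Longrightarrow> h integrable_on {x..y}"
  unfolding indefinite_integral_def by (cases "x \<le> y") (auto simp: integrable_on_def intro: has_integral_empty)

lemma indefinite_integral_diff: "indefinite_integral h F \<Longrightarrow> x \<le> y \<Longrightarrow> F y - F x = integral {x..y} h"
  unfolding indefinite_integral_def by (metis integral_unique)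

lemma continuous_indefinite_integral:
  assumes "indefinite_integral h F"
  shows "continuous_on UNIV F"
proof -
  have "isCont F x" for x
  proof -
    have eq: "F t = F (x - 1) + integral {x - 1..t} h" if "t \<in> {x - 1..x + 1}" for t
      using indefinite_integral_diff[OF assms, of "x - 1" t] that by simp
    have "continuous_on {x - 1..x + 1} (\<lambda>t. F (x - 1) + integral {x - 1..t} h)"
      using indefinite_integral_continuous_1[OF indefinite_integral_integrable[OF assms]]
      by (intro continuous_intros) auto
    then have "continuous_on {x - 1..x + 1} F" using eq continuous_on_cong by (metis (no_types, lifting))
    then show ?thesis
      by (rule continuous_on_interior) (simp add: interior_atLeastAtMost_real)
  qed
  then show ?thesis by (simp add: continuous_at_imp_continuous_on)
qed

lemma indefinite_integral_has_derivative:
  assumes "indefinite_integral h F" "continuous_on UNIV h"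
  shows "(F has_real_derivative h x) (at x)"
proof -
  have "((\<lambda>t. F (x - 1) + integral {x - 1..t} h) has_real_derivative 0 + h x) (at x within {x - 1..x + 1})"
    by (intro DERIV_add DERIV_const integral_has_real_derivative)
      (auto intro: continuous_on_subset[OF assms(2)])
  then have "(F has_real_derivative 0 + h x) (at x within {x - 1..x + 1})"
  proof (rule has_field_derivative_transform_within[where d = 1])
    fix t assume "t \<in> {x - 1..x + 1}"
    then show "F (x - 1) + integral {x - 1..t} h = F t"
      using indefinite_integral_diff[OF assms(1), of "x - 1" t] by simp
  qed auto
  then show ?thesis
    using at_within_interior[of x "{x - 1..x + 1}"] by (simp add: interior_atLeastAtMost_real)
qed

text \<open>The averages in the differentiation theorem are over intervals to the right of
  \<open>x\<close>, which controls the right difference quotient. The left one comes from the same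
  theorem for the reflected function \<open>h (- t)\<close>; the exceptional set of the latter has
  to be reflected back.\<close>

lemma indefinite_integral_AE_derivative:
  assumes "indefinite_integral h F"
  shows "AE x in lebesgue. (F has_real_derivative h x) (at x)"
proof -
  have int: "h integrable_on {x..y}" for x y by (rule indefinite_integral_integrable[OF assms])
  then have "h integrable_on cbox x y" for x y by simp
  then obtain N1 where N1: "negligible N1"
    "\<And>x e. x \<notin> N1 \<Longrightarrow> 0 < e \<Longrightarrow> \<exists>d>0. \<forall>s. 0 < s \<and> s < d \<longrightarrow>
       norm (integral (cbox x (x + s *\<^sub>R One)) h /\<^sub>R s ^ DIM(real) - h x) < e"
    using integrable_ccontinuous_explicit[of h] by metis
  have "(\<lambda>t. h (- t)) integrable_on cbox x y" for x y
    using int[of "- y" "- x"] Henstock_Kurzweil_Integration.integrable_reflect_real[where f = h and a = "- y" and b = "- x"] by simp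
  then obtain N2 where N2: "negligible N2"
    "\<And>x e. x \<notin> N2 \<Longrightarrow> 0 < e \<Longrightarrow> \<exists>d>0. \<forall>s. 0 < s \<and> s < d \<longrightarrow>
       norm (integral (cbox x (x + s *\<^sub>R One)) (\<lambda>t. h (- t)) /\<^sub>R s ^ DIM(real) - h (- x)) < e"
    using integrable_ccontinuous_explicit[of "\<lambda>t. h (- t)"] by metis
  have "(F has_real_derivative h x) (at x)" if x: "x \<notin> N1 \<union> uminus ` N2" for x
  proof -
    have "(\<lambda>s. (F (x + s) - F x) / s) \<midarrow>0\<rightarrow> h x"
      unfolding LIM_def
    proof (intro allI impI)
      fix e :: real assume "0 < e"
      obtain d1 where d1: "d1 > 0" "\<And>s. 0 < s \<and> s < d1 \<Longrightarrow> \<bar>integral {x..x + s} h / s - h x\<bar> < e"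
        using N1(2)[of x e] x \<open>0 < e\<close> by (auto simp: divide_inverse mult.commute)
      have "- x \<notin> N2" using x by (metis UnI2 image_eqI minus_minus)
      then obtain d2 where d2: "d2 > 0"
        "\<And>s. 0 < s \<and> s < d2 \<Longrightarrow> \<bar>integral {- x..- x + s} (\<lambda>t. h (- t)) / s - h x\<bar> < e"
        using N2(2)[of "- x" e] \<open>0 < e\<close> by (auto simp: divide_inverse mult.commute)
      show "\<exists>s>0. \<forall>xa. xa \<noteq> 0 \<and> dist xa 0 < s \<longrightarrow> dist ((F (x + xa) - F x) / xa) (h x) < e"
      proof (intro exI[of _ "min d1 d2"] conjI allI impI)
        fix s :: real assume s: "s \<noteq> 0 \<and> dist s 0 < min d1 d2"
        show "dist ((F (x + s) - F x) / s) (h x) < e"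
        proof (cases "s > 0")
          case True
          then show ?thesis
            using d1(2)[of s] s indefinite_integral_diff[OF assms, of x "x + s"] by (simp add: dist_real_def)
        next
          case False
          then have "s < 0" using s by simp
          have "integral {- x..- x + (- s)} (\<lambda>t. h (- t)) = integral {x + s..x} h"
            using Henstock_Kurzweil_Integration.integral_reflect_real[where a = "x + s" and b = x and f = h] by (simp add: algebra_simps)
          also have "\<dots> = F x - F (x + s)"
            using indefinite_integral_diff[OF assms, of "x + s" x] \<open>s < 0\<close> by simp
          finally have "integral {- x..- x + (- s)} (\<lambda>t. h (- t)) / (- s) = (F (x + s) - F x) / s"
            by (simp add: minus_divide_left)
          then show ?thesis
            using d2(2)[of "- s"] s \<open>s < 0\<close> by (simp add: dist_real_def)
        qed
      qed (use d1(1) d2(1) in auto)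
    qed
    then show ?thesis by (simp add: DERIV_def)
  qed
  moreover have "negligible (N1 \<union> uminus ` N2)"
    using N1(1) N2(1)
    by (intro negligible_Un negligible_differentiable_image_negligible)
      (auto simp: differentiable_on_def intro!: derivative_intros)
  ultimately show ?thesis
    unfolding negligible_iff_null_sets by (intro AE_I'[of "N1 \<union> uminus ` N2"]) auto
qed

text \<open>Truncation: the part of \<open>\<bar>h\<bar>\<close> above level \<open>n\<close> has
  integral below \<open>\<epsilon> / 2\<close> once \<open>n\<close> is large, and the rest
  contributes at most \<open>n\<close> times the total length of the intervals.\<close>

lemma locally_abs_continuous_indefinite_integral:
  assumes F: "indefinite_integral h F" and h: "\<And>x y. h absolutely_integrable_on {x..y}"
  shows "locally_abs_continuous F"
  unfolding locally_abs_continuous_def abs_continuous_on_def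
proof (intro allI impI)
  fix x y \<epsilon> :: real assume "0 < \<epsilon>"
  define tail where "tail n t = max (\<bar>h t\<bar> - real n) 0" for n t
  have abs_int: "(\<lambda>t. \<bar>h t\<bar>) integrable_on {s..t}" for s t
    using h[of s t] by (auto simp: absolutely_integrable_on_def)
  have tail_int: "tail n integrable_on {s..t}" for n s t
  proof -
    have "(\<lambda>t. \<bar>h t\<bar> - real n) absolutely_integrable_on {s..t}"
      using abs_int by (intro set_integral_diff nonnegative_absolutely_integrable_1) auto
    then have "(\<lambda>t. max (\<bar>h t\<bar> - real n) 0) absolutely_integrable_on {s..t}"
      by (intro absolutely_integrable_max_1) auto
    then show ?thesis unfolding tail_def[abs_def] by (rule set_lebesgue_integral_eq_integral(1))
  qed
  have "(\<lambda>n. integral {x..y} (tail n)) \<longlonglongrightarrow> integral {x..y} (\<lambda>_. 0)"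
  proof (rule dominated_convergence(2)[OF tail_int abs_int])
    fix t assume "t \<in> {x..y}"
    show "norm (tail n t) \<le> \<bar>h t\<bar>" for n by (simp add: tail_def)
    have "\<forall>\<^sub>F n in sequentially. tail n t = 0"
      using eventually_ge_at_top[of "nat \<lceil>\<bar>h t\<bar>\<rceil>"] by eventually_elim (simp add: tail_def nat_ceiling_le_eq)
    then show "(\<lambda>n. tail n t) \<longlonglongrightarrow> 0" by (rule tendsto_eventually)
  qed
  then have "\<forall>\<^sub>F n in sequentially. integral {x..y} (tail n) < \<epsilon> / 2"
    using \<open>0 < \<epsilon>\<close> by (intro order_tendstoD(2)) auto
  then obtain n where n: "integral {x..y} (tail n) < \<epsilon> / 2" by (auto simp: eventually_sequentially)
  show "\<exists>\<delta>>0. \<forall>D. finite D \<longrightarrow> (\<forall>(s, t)\<in>D. s \<le> t \<and> {s..t} \<subseteq> {x..y}) \<longrightarrow>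
      pairwise (\<lambda>p q. {fst p<..<snd p} \<inter> {fst q<..<snd q} = {}) D \<longrightarrow>
      (\<Sum>(s, t)\<in>D. t - s) < \<delta> \<longrightarrow> (\<Sum>(s, t)\<in>D. \<bar>F t - F s\<bar>) < \<epsilon>"
  proof (intro exI[of _ "\<epsilon> / (2 * (n + 1))"] conjI allI impI)
    fix D :: "(real \<times> real) set"
    assume D: "finite D" "\<forall>(s, t)\<in>D. s \<le> t \<and> {s..t} \<subseteq> {x..y}"
      "pairwise (\<lambda>p q. {fst p<..<snd p} \<inter> {fst q<..<snd q} = {}) D"
      "(\<Sum>(s, t)\<in>D. t - s) < \<epsilon> / (2 * (n + 1))"
    have one: "\<bar>F t - F s\<bar> \<le> n * (t - s) + integral {s..t} (tail n)" if "(s, t) \<in> D" for s t :: real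
    proof -
      have "s \<le> t" using D(2) that by auto
      have "F t - F s = integral {s..t} h" using indefinite_integral_diff[OF F, of s t] \<open>s \<le> t\<close> by simp
      also have "\<bar>\<dots>\<bar> \<le> integral {s..t} (\<lambda>t. n + tail n t)"
        unfolding real_norm_def[symmetric]
        by (rule integral_norm_bound_integral)
          (auto simp: tail_def[abs_def] intro!: indefinite_integral_integrable[OF F] integrable_add tail_int[unfolded tail_def[abs_def]])
      also have "\<dots> = n * (t - s) + integral {s..t} (tail n)"
        using \<open>s \<le> t\<close> by (subst Henstock_Kurzweil_Integration.integral_add) (auto intro: tail_int)
      finally show ?thesis .
    qed
    have inj: "inj_on (\<lambda>p. {fst p..snd p}) D"
      using D(2) by (auto simp: inj_on_def)
    have "(tail n has_integral (\<Sum>S\<in>(\<lambda>p. {fst p..snd p}) ` D. integral S (tail n))) (\<Union>((\<lambda>p. {fst p..snd p}) ` D))"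
    proof (rule has_integral_Union)
      show "pairwise (\<lambda>S S'. negligible (S \<inter> S')) ((\<lambda>p. {fst p..snd p}) ` D)"
      proof (rule pairwise_imageI)
        fix p q assume "p \<in> D" "q \<in> D" "p \<noteq> q"
        moreover obtain a b c d where "p = (a, b)" "q = (c, d)" by (cases p, cases q)
        ultimately have *: "(a, b) \<in> D" "(c, d) \<in> D" "(a, b) \<noteq> (c, d)" by auto
        then have disj: "{a<..<b} \<inter> {c<..<d} = {}" using D(3) by (force simp: pairwise_def)
        have "{a..b} \<inter> {c..d} \<subseteq> {a, b, c, d}"
        proof (rule subsetI, rule ccontr)
          fix z assume "z \<in> {a..b} \<inter> {c..d}" "z \<notin> {a, b, c, d}"
          then have "z \<in> {a<..<b} \<inter> {c<..<d}" by auto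
          then show False using disj by blast
        qed
        then have "finite ({a..b} \<inter> {c..d})" by (rule finite_subset) simp
        then show "negligible ({fst p..snd p} \<inter> {fst q..snd q})"
          by (simp add: \<open>p = (a, b)\<close> \<open>q = (c, d)\<close> negligible_finite del: Int_atLeastAtMost)
      qed
    qed (use D(1) tail_int in \<open>auto simp: integrable_integral\<close>)
    then have "(\<Sum>S\<in>(\<lambda>p. {fst p..snd p}) ` D. integral S (tail n)) \<le> integral {x..y} (tail n)"
      by (rule has_integral_subset_le[rotated 1])
        (use D(2) tail_int in \<open>auto simp: tail_def integrable_integral\<close>)
    then have sum_tail: "(\<Sum>(s, t)\<in>D. integral {s..t} (tail n)) \<le> integral {x..y} (tail n)"
      by (simp add: sum.reindex[OF inj] case_prod_beta o_def)
    have "(\<Sum>(s, t)\<in>D. \<bar>F t - F s\<bar>) \<le> (\<Sum>(s, t)\<in>D. n * (t - s) + integral {s..t} (tail n))"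
      by (rule sum_mono) (use one in auto)
    also have "\<dots> = n * (\<Sum>(s, t)\<in>D. t - s) + (\<Sum>(s, t)\<in>D. integral {s..t} (tail n))"
      by (simp add: case_prod_beta sum.distrib sum_distrib_left)
    also have "\<dots> \<le> n * (\<epsilon> / (2 * (n + 1))) + integral {x..y} (tail n)"
      using D(4) sum_tail by (intro add_mono mult_left_mono) auto
    also have "n * (\<epsilon> / (2 * (n + 1))) \<le> \<epsilon> / 2" using \<open>0 < \<epsilon>\<close> by (simp add: field_simps)
    finally show "(\<Sum>(s, t)\<in>D. \<bar>F t - F s\<bar>) < \<epsilon>" using n by linarith
  qed (use \<open>0 < \<epsilon>\<close> in auto)
qed

section \<open>Concavity and maximum principles\<close>

text \<open>If the slope drops by \<open>w\<close> between \<open>x + d\<close> and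
  \<open>y - d\<close>, it is at least \<open>w / 2\<close> at the first point or at most
  \<open>- w / 2\<close> at the second. By concavity this persists over the adjacent collar of
  length \<open>d\<close>, at whose outer end \<open>z\<close> is nonnegative. The lemma converts
  the mass of the weight into height, for \<open>u\<close> on blocks and for a constant minus
  \<open>u\<close> on gaps.\<close>

lemma concave_max_lower_bound:
  fixes z D :: "real \<Rightarrow> real"
  assumes deriv: "\<And>t. t \<in> {x..y} \<Longrightarrow> (z has_real_derivative D t) (at t)"
    and anti: "\<And>s t. x \<le> s \<Longrightarrow> s \<le> t \<Longrightarrow> t \<le> y \<Longrightarrow> D t \<le> D s"
    and ends: "0 \<le> z x" "0 \<le> z y" and d: "0 < d" "x + d \<le> y - d"
    and w: "w \<le> D (x + d) - D (y - d)"
  shows "\<exists>t\<in>{x..y}. d * w / 2 \<le> z t"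
proof (cases "w / 2 \<le> D (x + d)")
  case True
  obtain \<xi> where \<xi>: "x < \<xi>" "\<xi> < x + d" "z (x + d) - z x = (x + d - x) * D \<xi>"
    using MVT2[of x "x + d" z D] deriv d by force
  have "w / 2 \<le> D \<xi>" using anti[of \<xi> "x + d"] \<xi> d True by simp
  then have "d * w / 2 \<le> d * D \<xi>"
    unfolding times_divide_eq_right[symmetric] using d by (intro mult_left_mono) auto
  moreover have "z (x + d) - z x = d * D \<xi>" using \<xi>(3) by simp
  ultimately have "d * w / 2 \<le> z (x + d)" using ends by linarith
  then show ?thesis using d by (intro bexI[of _ "x + d"]) auto
next
  case False
  obtain \<xi> where \<xi>: "y - d < \<xi>" "\<xi> < y" "z y - z (y - d) = (y - (y - d)) * D \<xi>"
    using MVT2[of "y - d" y z D] deriv d by force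
  have "w / 2 \<le> - D \<xi>" using anti[of "y - d" \<xi>] \<xi> d False w by simp
  then have "d * w / 2 \<le> d * (- D \<xi>)"
    unfolding times_divide_eq_right[symmetric] using d by (intro mult_left_mono) auto
  moreover have "z y - z (y - d) = d * D \<xi>" using \<xi>(3) by simp
  ultimately have "d * w / 2 \<le> z (y - d)" using ends by simp
  then show ?thesis using d by (intro bexI[of _ "y - d"]) auto
qed

lemma concave_chord_lower_bound:
  fixes z D :: "real \<Rightarrow> real"
  assumes deriv: "\<And>t. t \<in> {x..y} \<Longrightarrow> (z has_real_derivative D t) (at t)"
    and anti: "\<And>s t. x \<le> s \<Longrightarrow> s \<le> t \<Longrightarrow> t \<le> y \<Longrightarrow> D t \<le> D s"
    and t: "x < t" "t < y"
  shows "z x * (y - t) + z y * (t - x) \<le> z t * (y - x)"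
proof -
  obtain \<xi> where \<xi>: "x < \<xi>" "\<xi> < t" "z t - z x = (t - x) * D \<xi>"
    using MVT2[of x t z D] deriv t by force
  obtain \<eta> where \<eta>: "t < \<eta>" "\<eta> < y" "z y - z t = (y - t) * D \<eta>"
    using MVT2[of t y z D] deriv t by force
  have "D \<eta> \<le> D \<xi>" using anti[of \<xi> \<eta>] \<xi> \<eta> by simp
  then have "(y - t) * (t - x) * D \<eta> \<le> (y - t) * (t - x) * D \<xi>"
    using t by (intro mult_left_mono) auto
  then have "(z y - z t) * (t - x) \<le> (z t - z x) * (y - t)"
    unfolding \<xi>(3) \<eta>(3) by (simp add: mult_ac)
  then show ?thesis by (simp add: algebra_simps)
qed

text \<open>The chord from \<open>tm\<close> to the endpoint on the side of \<open>t\<close>, with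
  the value at that endpoint lowered to 0, is already this high at \<open>t\<close>. The ratio
  \<open>d / L\<close> is the origin of the factor in the floor.\<close>

lemma concave_lower_bound_inside:
  fixes z D :: "real \<Rightarrow> real"
  assumes deriv: "\<And>t. t \<in> {x..y} \<Longrightarrow> (z has_real_derivative D t) (at t)"
    and anti: "\<And>s t. x \<le> s \<Longrightarrow> s \<le> t \<Longrightarrow> t \<le> y \<Longrightarrow> D t \<le> D s"
    and nonneg: "\<And>t. t \<in> {x..y} \<Longrightarrow> 0 \<le> z t"
    and tm: "tm \<in> {x..y}" and d: "0 < d" and t: "t \<in> {x + d..y - d}" and L: "y - x \<le> L"
  shows "z tm * (d / L) \<le> z t"
proof -
  have "0 < L" "d \<le> L" using d t L by auto
  have t': "t \<in> {x..y}" using t d by auto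
  have "z tm * d \<le> z t * L"
  proof -
    consider "t = tm" | "t < tm" | "tm < t" by linarith
    then show ?thesis
    proof cases
      case 1
      then show ?thesis using nonneg[OF tm] \<open>d \<le> L\<close> by (simp add: mult_left_mono)
    next
      case 2
      have "z x * (tm - t) + z tm * (t - x) \<le> z t * (tm - x)"
        by (rule concave_chord_lower_bound[of x tm z D]) (use deriv anti tm t d 2 in auto)
      moreover have "0 \<le> z x * (tm - t)" using 2 nonneg[of x] tm by simp
      moreover have "z tm * d \<le> z tm * (t - x)" using t nonneg[OF tm] by (intro mult_left_mono) auto
      moreover have "z t * (tm - x) \<le> z t * L" using tm L nonneg[OF t'] by (intro mult_left_mono) auto
      ultimately show ?thesis by linarith
    next
      case 3
      have "z tm * (y - t) + z y * (t - tm) \<le> z t * (y - tm)"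
        by (rule concave_chord_lower_bound[of tm y z D]) (use deriv anti tm t d 3 in auto)
      moreover have "0 \<le> z y * (t - tm)" using 3 nonneg[of y] tm by simp
      moreover have "z tm * d \<le> z tm * (y - t)" using t nonneg[OF tm] by (intro mult_left_mono) auto
      moreover have "z t * (y - tm) \<le> z t * L" using tm L nonneg[OF t'] by (intro mult_left_mono) auto
      ultimately show ?thesis by linarith
    qed
  qed
  then show ?thesis using \<open>0 < L\<close> by (simp add: field_simps)
qed

lemma convex_le_endpoints:
  fixes u D :: "real \<Rightarrow> real"
  assumes deriv: "\<And>t. t \<in> {x..y} \<Longrightarrow> (u has_real_derivative D t) (at t)"
    and mono: "\<And>s t. x \<le> s \<Longrightarrow> s \<le> t \<Longrightarrow> t \<le> y \<Longrightarrow> D s \<le> D t"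
    and ends: "u x \<le> c" "u y \<le> c" and t: "t \<in> {x..y}"
  shows "u t \<le> c"
proof (cases "t = x \<or> t = y")
  case False
  then have t': "x < t" "t < y" using t by auto
  have "(c - u x) * (y - t) + (c - u y) * (t - x) \<le> (c - u t) * (y - x)"
    using t' deriv mono
    by (intro concave_chord_lower_bound[of x y "\<lambda>t. c - u t" "\<lambda>t. - D t"]) (auto intro!: derivative_eq_intros)
  moreover have "0 \<le> (c - u x) * (y - t) + (c - u y) * (t - x)" using ends t' by simp
  ultimately have "0 \<le> (c - u t) * (y - x)" by linarith
  then show ?thesis using t' by (simp add: zero_le_mult_iff)
qed (use ends in auto)

text \<open>
  If the periodicity of the derivative fails, it fails with the sign that excludes a
  maximum above the threshold at the base point.
\<close>

lemma periodic_maximum_principle: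
  fixes u D :: "real \<Rightarrow> real"
  assumes AB: "A < B" and deriv: "\<And>t. t \<in> {A..B} \<Longrightarrow> (u has_real_derivative D t) (at t)"
    and per: "u A = u B" and jump: "M < u A \<Longrightarrow> D B < D A"
    and convex: "\<And>s t. A \<le> s \<Longrightarrow> s \<le> t \<Longrightarrow> t \<le> B \<Longrightarrow> (\<And>x. x \<in> {s..t} \<Longrightarrow> M < u x) \<Longrightarrow> D s \<le> D t"
    and t: "t \<in> {A..B}"
  shows "u t \<le> M"
proof (rule ccontr)
  assume "\<not> u t \<le> M"
  have cont: "continuous_on {A..B} u"
    by (meson DERIV_isCont continuous_at_imp_continuous_on deriv)
  obtain m where m: "m \<in> {A..B}" "\<And>x. x \<in> {A..B} \<Longrightarrow> u x \<le> u m"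
    using continuous_attains_sup[OF compact_Icc _ cont] AB by force
  have um: "M < u m" using m(2)[OF t] \<open>\<not> u t \<le> M\<close> by simp
  \<comment> \<open>To the right of an interior maximum the slope starts at 0 and cannot decrease
    while \<open>u\<close> exceeds \<open>M\<close>. So \<open>u\<close> never comes back to
    \<open>M\<close> and the maximum is reached at \<open>B\<close> as well.\<close>
  have "u m \<le> u B"
  proof (cases "m = A \<or> m = B")
    case False
    then have mAB: "A < m" "m < B" using m(1) by auto
    have D0: "D m = 0"
    proof (rule DERIV_local_max)
      show "(u has_real_derivative D m) (at m)" using deriv m by blast
      show "0 < min (m - A) (B - m)" using mAB by simp
      show "\<forall>y. \<bar>m - y\<bar> < min (m - A) (B - m) \<longrightarrow> u y \<le> u m" using m(2) by (auto simp: abs_le_iff abs_less_iff)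
    qed
    have above: "M < u x" if x: "x \<in> {m..B}" for x
    proof (rule ccontr)
      assume "\<not> M < u x"
      define S where "S = {x \<in> {m..B}. u x \<le> M}"
      have "closed S" unfolding S_def
        by (intro continuous_on_closed_Collect_le continuous_on_const closed_atLeastAtMost
            continuous_on_subset[OF cont]) (use mAB in auto)
      moreover have "S \<noteq> {}" using x \<open>\<not> M < u x\<close> by (auto simp: S_def)
      moreover have "bdd_below S" by (auto simp: S_def bdd_below_def)
      ultimately have inf: "Inf S \<in> S" by (intro closed_contains_Inf)
      define i where "i = Inf S"
      have i: "i \<in> {m..B}" "u i \<le> M" using inf by (auto simp: S_def i_def)
      have below: "M < u y" if "m \<le> y" "y < i" for y
      proof (rule ccontr)
        assume "\<not> M < u y"
        then have "y \<in> S" using that i by (auto simp: S_def)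
        then show False using cInf_lower[OF _ \<open>bdd_below S\<close>] that by (force simp: i_def)
      qed
      have "m < i" using i um by (cases "m = i") auto
      obtain \<xi> where \<xi>: "m < \<xi>" "\<xi> < i" "u i - u m = (i - m) * D \<xi>"
        using MVT2[of m i u D] deriv \<open>m < i\<close> i mAB by force
      have "D m \<le> D \<xi>" using convex[of m \<xi>] \<xi> i mAB below by auto
      then have "0 \<le> (i - m) * D \<xi>" using D0 \<xi> by simp
      then show False using \<xi>(3) i um by simp
    qed
    obtain \<xi> where \<xi>: "m < \<xi>" "\<xi> < B" "u B - u m = (B - m) * D \<xi>"
      using MVT2[of m B u D] deriv mAB by force
    have "D m \<le> D \<xi>" using convex[of m \<xi>] \<xi> mAB above by auto
    then show ?thesis using D0 \<xi> by (metis diff_ge_0_iff_ge le_less_trans less_eq_real_def less_trans mult_nonneg_nonneg)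
  qed (use per in auto)
  then have max: "u x \<le> u A" if "x \<in> {A..B}" for x using m(2)[OF that] per by simp
  \<comment> \<open>Now \<open>A\<close> and \<open>B\<close> both carry the maximum of the
    interval, which forces \<open>D A \<le> 0 \<le> D B\<close>, against
    \<open>jump\<close>.\<close>
  have "D A \<le> 0"
  proof (rule ccontr)
    assume "\<not> D A \<le> 0"
    then obtain e where e: "e > 0" "\<And>h. 0 < h \<Longrightarrow> h < e \<Longrightarrow> u A < u (A + h)"
      using DERIV_pos_inc_right[of u "D A" A] deriv[of A] AB by auto
    define h where "h = min (e / 2) (B - A)"
    have h: "0 < h" "h < e" "h \<le> B - A" using e AB by (auto simp: h_def)
    then have "u A < u (A + h)" by (intro e(2))
    then show False using max[of "A + h"] h by simp
  qed
  moreover have "0 \<le> D B"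
  proof (rule ccontr)
    assume "\<not> 0 \<le> D B"
    then obtain e where e: "e > 0" "\<And>h. 0 < h \<Longrightarrow> h < e \<Longrightarrow> u B < u (B - h)"
      using DERIV_neg_dec_left[of u "D B" B] deriv[of B] AB by auto
    define h where "h = min (e / 2) (B - A)"
    have h: "0 < h" "h < e" "h \<le> B - A" using e AB by (auto simp: h_def)
    then have "u B < u (B - h)" by (intro e(2))
    then show False using max[of "B - h"] per h by simp
  qed
  moreover have "D B < D A" using jump max[OF m(1)] um by simp
  ultimately show False by simp
qed

lemma abs_SUP_diff_le:
  fixes f g :: "'a \<Rightarrow> real"
  assumes "S \<noteq> {}" "bdd_above (f ` S)" "bdd_above (g ` S)" "\<And>x. x \<in> S \<Longrightarrow> \<bar>f x - g x\<bar> \<le> e"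
  shows "\<bar>(SUP x\<in>S. f x) - (SUP x\<in>S. g x)\<bar> \<le> e"
proof -
  have "(SUP x\<in>S. f x) \<le> (SUP x\<in>S. g x) + e"
    by (intro cSUP_least[OF assms(1)]) (smt (verit) assms(3,4) cSUP_upper)
  moreover have "(SUP x\<in>S. g x) \<le> (SUP x\<in>S. f x) + e"
    by (intro cSUP_least[OF assms(1)]) (smt (verit) assms(2,4) cSUP_upper)
  ultimately show ?thesis by linarith
qed

section \<open>A fixed point problem with multipliers\<close>

text \<open>The intended instance is one full period \<open>P = k T\<close>, with \<open>b\<close>
  the positive part of the weight times \<open>\<lambda>\<close>, \<open>c\<close> the negative part
  times \<open>\<mu>\<close>, and \<open>N = k m\<close>. Blocks \<open>{p j..q j}\<close> and gaps
  \<open>{q j..p (Suc j)}\<close> alternate and fill the period from \<open>A\<close> on.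
  \<open>g\<close> is the nonlinearity extended by 0 to the negative axis.\<close>

locale block_problem =
  fixes g b c :: "real \<Rightarrow> real" and A P :: real and N :: nat and p q :: "nat \<Rightarrow> real"
  assumes g_cont: "continuous_on UNIV g" and g_nonneg: "0 \<le> g x" and g_zero: "x \<le> 0 \<Longrightarrow> g x = 0"
    and P_pos: "0 < P"
    and b_nonneg: "0 \<le> b t" and c_nonneg: "0 \<le> c t"
    and b_per: "b (t + P) = b t" and c_per: "c (t + P) = c t"
    and b_int: "b integrable_on {x..y}" and c_int: "c integrable_on {x..y}"
    and p_first: "p 0 = A" and p_last: "p N = A + P"
    and p_less_q: "j < N \<Longrightarrow> p j < q j" and q_less_p: "j < N \<Longrightarrow> q j < p (Suc j)"
    and b_gap: "j < N \<Longrightarrow> AE t in lebesgue. t \<in> {q j..p (Suc j)} \<longrightarrow> b t = 0"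
    and c_block: "j < N \<Longrightarrow> AE t in lebesgue. t \<in> {p j..q j} \<longrightarrow> c t = 0"
begin

text \<open>The representative of \<open>t\<close> modulo \<open>P\<close> in
  \<open>{A..<A + P}\<close>. Reading \<open>v\<close> only there makes the right-hand side periodic
  for every \<open>v\<close>, periodic or not.\<close>

definition wrap :: "real \<Rightarrow> real" where "wrap t = t - P * of_int \<lfloor>(t - A) / P\<rfloor>"

text \<open>The multiplier is spread over the block and the gap that follows it: half-open cells
  partition the period, and on the gap \<open>b\<close> vanishes almost everywhere, so the product
  with \<open>b\<close> is that of a multiplier living on the block alone.\<close>

definition cell_coeff :: "(nat \<Rightarrow> real) \<Rightarrow> real \<Rightarrow> real" where
  "cell_coeff \<theta> t = (\<Sum>j<N. \<theta> j * indicat_real {p j..<p (Suc j)} (wrap t))"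

text \<open>
  The floor keeps the source away from zero as long as \<open>v\<close> is below its target height. By
  concavity it is inactive once the maximum over the block equals \<open>s j\<close>.
\<close>

definition inner_floor :: "real \<Rightarrow> (nat \<Rightarrow> real) \<Rightarrow> (nat \<Rightarrow> real) \<Rightarrow> real \<Rightarrow> real" where
  "inner_floor \<delta> \<kappa> s t = (\<Sum>j<N. \<kappa> j * s j * indicat_real {p j + \<delta>..q j - \<delta>} (wrap t))"

definition rhs where
  "rhs \<delta> \<kappa> s \<theta> v t =
     b t * cell_coeff \<theta> t * g (max (v (wrap t)) (inner_floor \<delta> \<kappa> s t)) - c t * g (v (wrap t))"

text \<open>A supremum and not a maximum, because it is applied to all bounded measurable
  \<open>v\<close>. It is continuous under uniform convergence, the convergence that the fixed point
  lemma supplies.\<close>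

definition block_sup :: "nat \<Rightarrow> (real \<Rightarrow> real) \<Rightarrow> real" where
  "block_sup j v = (SUP t\<in>{p j..q j}. v t)"

lemma wrap_in: "wrap t \<in> {A..<A + P}"
proof -
  have "of_int \<lfloor>(t - A) / P\<rfloor> * P \<le> t - A"
    using P_pos by (subst pos_le_divide_eq[symmetric]) linarith+
  moreover have "t - A < (of_int \<lfloor>(t - A) / P\<rfloor> + 1) * P"
    using P_pos by (subst pos_divide_less_eq[symmetric]) linarith+
  ultimately show ?thesis by (simp add: wrap_def algebra_simps)
qed

lemma wrap_id: "t \<in> {A..<A + P} \<Longrightarrow> wrap t = t"
proof -
  assume "t \<in> {A..<A + P}"
  then have "\<lfloor>(t - A) / P\<rfloor> = 0" using P_pos by (simp add: floor_eq_iff field_simps)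
  then show ?thesis by (simp add: wrap_def)
qed

lemma wrap_add: "wrap (t + P) = wrap t"
proof -
  have "(t + P - A) / P = (t - A) / P + 1" using P_pos by (simp add: field_simps)
  then show ?thesis by (simp add: wrap_def algebra_simps)
qed

lemma p_mono: "i \<le> j \<Longrightarrow> j \<le> N \<Longrightarrow> p i \<le> p j"
proof (induction j)
  case (Suc j)
  then show ?case using p_less_q[of j] q_less_p[of j] by (cases "i = Suc j") (auto intro: order.trans)
qed auto

lemma block_in: "j < N \<Longrightarrow> A \<le> p j \<and> p (Suc j) \<le> A + P"
  using p_mono[of 0 j] p_mono[of "Suc j" N] p_first p_last by auto

lemma cell_exists:
  assumes "t \<in> {A..<A + P}"
  obtains j where "j < N" "t \<in> {p j..<p (Suc j)}"
proof -
  have "\<exists>j<n. t \<in> {p j..<p (Suc j)}" if "n \<le> N" "t < p n" for n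
    using that
  proof (induction n)
    case 0
    then show ?case using assms p_first by simp
  next
    case (Suc n)
    then show ?case by (cases "t < p n") (auto simp: less_Suc_eq)
  qed
  from this[of N] show ?thesis using that assms p_last by auto
qed

lemma cell_coeff_eq: "j < N \<Longrightarrow> wrap t \<in> {p j..<p (Suc j)} \<Longrightarrow> cell_coeff \<theta> t = \<theta> j"
proof -
  assume j: "j < N" and t: "wrap t \<in> {p j..<p (Suc j)}"
  have "\<theta> i * indicat_real {p i..<p (Suc i)} (wrap t) = 0" if "i \<in> {..<N} - {j}" for i
  proof -
    consider "Suc i \<le> j" | "Suc j \<le> i" using \<open>i \<in> {..<N} - {j}\<close> by fastforce
    then have "wrap t \<notin> {p i..<p (Suc i)}"
      using p_mono[of "Suc i" j] p_mono[of "Suc j" i] that j t by cases auto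
    then show ?thesis by simp
  qed
  then have "(\<Sum>i\<in>{..<N} - {j}. \<theta> i * indicat_real {p i..<p (Suc i)} (wrap t)) = 0"
    by (rule sum.neutral[OF ballI])
  moreover have "j \<in> {..<N}" "indicat_real {p j..<p (Suc j)} (wrap t) = 1" using j t by simp_all
  ultimately show ?thesis
    unfolding cell_coeff_def by (simp only: sum.remove[of "{..<N}" j] finite_lessThan)
qed

lemma inner_floor_eq:
  assumes "j < N" "wrap t \<in> {p j..<p (Suc j)}" "0 < \<delta>"
  shows "inner_floor \<delta> \<kappa> s t = (if wrap t \<in> {p j + \<delta>..q j - \<delta>} then \<kappa> j * s j else 0)"
proof -
  have "\<kappa> i * s i * indicat_real {p i + \<delta>..q i - \<delta>} (wrap t) = 0" if "i \<in> {..<N} - {j}" for i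
  proof -
    consider "Suc i \<le> j" | "Suc j \<le> i" using \<open>i \<in> {..<N} - {j}\<close> by fastforce
    then have "wrap t \<notin> {p i + \<delta>..q i - \<delta>}"
      using p_mono[of "Suc i" j] p_mono[of "Suc j" i] that assms p_less_q[of i] q_less_p[of i] by cases auto
    then show ?thesis by simp
  qed
  then have "(\<Sum>i\<in>{..<N} - {j}. \<kappa> i * s i * indicat_real {p i + \<delta>..q i - \<delta>} (wrap t)) = 0"
    by (rule sum.neutral[OF ballI])
  moreover have "j \<in> {..<N}" using assms by simp
  ultimately have "inner_floor \<delta> \<kappa> s t = \<kappa> j * s j * indicat_real {p j + \<delta>..q j - \<delta>} (wrap t)"
    unfolding inner_floor_def by (simp only: sum.remove[of "{..<N}" j] finite_lessThan)
  then show ?thesis by (simp add: indicator_def)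
qed

lemma cell_coeff_bounds:
  assumes "\<forall>j<N. 0 \<le> \<theta> j \<and> \<theta> j \<le> Th j"
  shows "0 \<le> cell_coeff \<theta> t" "cell_coeff \<theta> t \<le> (\<Sum>j<N. Th j)"
proof -
  have "0 \<le> \<theta> j * indicat_real {p j..<p (Suc j)} (wrap t) \<and> \<theta> j * indicat_real {p j..<p (Suc j)} (wrap t) \<le> Th j"
    if "j < N" for j
    using assms[rule_format, OF that] by (cases "wrap t \<in> {p j..<p (Suc j)}") simp_all
  then show "0 \<le> cell_coeff \<theta> t" "cell_coeff \<theta> t \<le> (\<Sum>j<N. Th j)"
    unfolding cell_coeff_def by (meson sum_nonneg sum_mono lessThan_iff)+
qed

lemma inner_floor_bounds:
  assumes "\<forall>j<N. 0 \<le> \<kappa> j \<and> 0 \<le> s j \<and> s j \<le> be j"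
  shows "0 \<le> inner_floor \<delta> \<kappa> s t" "inner_floor \<delta> \<kappa> s t \<le> (\<Sum>j<N. \<kappa> j * be j)"
proof -
  have "0 \<le> \<kappa> j * s j * indicat_real {p j + \<delta>..q j - \<delta>} (wrap t)
      \<and> \<kappa> j * s j * indicat_real {p j + \<delta>..q j - \<delta>} (wrap t) \<le> \<kappa> j * be j" if "j < N" for j
  proof -
    have "0 \<le> \<kappa> j * s j" "\<kappa> j * s j \<le> \<kappa> j * be j"
      using assms[rule_format, OF that] by (simp_all add: mult_left_mono)
    then show ?thesis by (cases "wrap t \<in> {p j + \<delta>..q j - \<delta>}") simp_all
  qed
  then show "0 \<le> inner_floor \<delta> \<kappa> s t" "inner_floor \<delta> \<kappa> s t \<le> (\<Sum>j<N. \<kappa> j * be j)"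
    unfolding inner_floor_def by (meson sum_nonneg sum_mono lessThan_iff)+
qed

lemma rhs_per: "rhs \<delta> \<kappa> s \<theta> v (t + P) = rhs \<delta> \<kappa> s \<theta> v t"
  by (simp add: rhs_def cell_coeff_def inner_floor_def wrap_add b_per c_per)

lemma wrap_measurable [measurable]: "wrap \<in> borel_measurable borel"
  unfolding wrap_def[abs_def] by measurable

lemma g_measurable [measurable]: "g \<in> borel_measurable borel"
  using g_cont by (rule borel_measurable_continuous_onI)

text \<open>The dominating function in the second claim depends only on the bounds for
  \<open>v\<close>, \<open>\<theta>\<close> and \<open>s\<close>. It yields both the common
  Lipschitz constant of the integral operator and its continuity by dominated convergence.\<close>

lemma rhs_integrable:
  assumes v: "v \<in> borel_measurable borel" "\<And>t. 0 \<le> v t \<and> v t \<le> M"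
    and \<theta>: "\<forall>j<N. 0 \<le> \<theta> j \<and> \<theta> j \<le> Th j" and s: "\<forall>j<N. 0 \<le> \<kappa> j \<and> 0 \<le> s j \<and> s j \<le> be j"
    and G: "\<And>x. x \<in> {0..M + (\<Sum>j<N. \<kappa> j * be j)} \<Longrightarrow> g x \<le> G"
  shows "rhs \<delta> \<kappa> s \<theta> v absolutely_integrable_on {x..y}"
    and "\<bar>rhs \<delta> \<kappa> s \<theta> v t\<bar> \<le> b t * ((\<Sum>j<N. Th j) * G) + c t * G"
proof -
  note [measurable] = v(1)
  define f1 where "f1 t = cell_coeff \<theta> t * g (max (v (wrap t)) (inner_floor \<delta> \<kappa> s t))" for t
  define f2 where "f2 t = g (v (wrap t))" for t
  have "0 \<le> M" using v(2)[of 0] by linarith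
  have s_sum: "0 \<le> (\<Sum>j<N. \<kappa> j * be j)" using s by (intro sum_nonneg) (auto intro: order_trans)
  have "0 \<le> G" using G[of 0] g_nonneg[of 0] \<open>0 \<le> M\<close> s_sum by force
  have Th_sum: "0 \<le> (\<Sum>j<N. Th j)" using cell_coeff_bounds[OF \<theta>, of 0] by linarith
  have gb: "g (max (v (wrap t)) (inner_floor \<delta> \<kappa> s t)) \<le> G" "g (v (wrap t)) \<le> G" for t
    using inner_floor_bounds[OF s, of \<delta> t] v(2)[of "wrap t"] s_sum \<open>0 \<le> M\<close> by (auto intro!: G)
  have f1: "0 \<le> f1 t \<and> f1 t \<le> (\<Sum>j<N. Th j) * G" for t
    unfolding f1_def using cell_coeff_bounds[OF \<theta>, of t] gb g_nonneg Th_sum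
    by (auto intro!: mult_mono)
  have f2: "0 \<le> f2 t \<and> f2 t \<le> G" for t unfolding f2_def using gb g_nonneg by auto
  have m1: "f1 \<in> borel_measurable borel"
    unfolding f1_def[abs_def] cell_coeff_def inner_floor_def by measurable
  have m2: "f2 \<in> borel_measurable borel" unfolding f2_def[abs_def] by measurable
  have prod: "(\<lambda>t. f t * w t) absolutely_integrable_on {x..y}"
    if "f \<in> borel_measurable borel" "\<And>t. 0 \<le> f t \<and> f t \<le> K" "w integrable_on {x..y}" "\<And>t. 0 \<le> w t"
    for f w :: "real \<Rightarrow> real" and K
  proof (rule absolutely_integrable_bounded_measurable_product_real)
    have "f \<in> borel_measurable lebesgue" using that(1) by (simp add: measurable_completion)
    then show "f \<in> borel_measurable (lebesgue_on {x..y})" by (rule measurable_restrict_space1)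
    show "bounded (f ` {x..y})" using that(2) by (auto simp: bounded_iff intro!: exI[of _ K])
    show "w absolutely_integrable_on {x..y}"
      using that by (intro nonnegative_absolutely_integrable_1) auto
  qed auto
  have "(\<lambda>t. f1 t * b t - f2 t * c t) absolutely_integrable_on {x..y}"
    by (intro set_integral_diff prod[OF m1 f1 b_int b_nonneg] prod[OF m2 f2 c_int c_nonneg])
  moreover have eq: "rhs \<delta> \<kappa> s \<theta> v t = f1 t * b t - f2 t * c t" for t
    by (simp add: rhs_def f1_def f2_def)
  ultimately show "rhs \<delta> \<kappa> s \<theta> v absolutely_integrable_on {x..y}" by (simp add: eq[abs_def])
  have "0 \<le> f1 t * b t" "f1 t * b t \<le> b t * ((\<Sum>j<N. Th j) * G)"
    using f1[of t] b_nonneg[of t] mult_left_mono[of "f1 t" "(\<Sum>j<N. Th j) * G" "b t"]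
    by (simp_all add: mult.commute[of "f1 t"])
  moreover have "0 \<le> f2 t * c t" "f2 t * c t \<le> c t * G"
    using f2[of t] c_nonneg[of t] mult_left_mono[of "f2 t" G "c t"]
    by (simp_all add: mult.commute[of "f2 t"])
  ultimately show "\<bar>rhs \<delta> \<kappa> s \<theta> v t\<bar> \<le> b t * ((\<Sum>j<N. Th j) * G) + c t * G"
    unfolding eq by linarith
qed

lemma rhs_tendsto:
  assumes s: "\<And>j. j < N \<Longrightarrow> (\<lambda>k. s k j) \<longlonglongrightarrow> s' j" and \<theta>: "\<And>j. j < N \<Longrightarrow> (\<lambda>k. \<theta> k j) \<longlonglongrightarrow> \<theta>' j"
    and v: "uniform_limit {A..A + P} v v' sequentially"
  shows "(\<lambda>k. rhs \<delta> \<kappa> (s k) (\<theta> k) (v k) t) \<longlonglongrightarrow> rhs \<delta> \<kappa> s' \<theta>' v' t"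
proof -
  have v: "(\<lambda>k. v k (wrap t)) \<longlonglongrightarrow> v' (wrap t)"
    using wrap_in[of t] by (intro tendsto_uniform_limitI[OF v]) auto
  have cc: "(\<lambda>k. cell_coeff (\<theta> k) t) \<longlonglongrightarrow> cell_coeff \<theta>' t"
    unfolding cell_coeff_def using \<theta> by (intro tendsto_intros) auto
  have fl: "(\<lambda>k. inner_floor \<delta> \<kappa> (s k) t) \<longlonglongrightarrow> inner_floor \<delta> \<kappa> s' t"
    unfolding inner_floor_def using s by (intro tendsto_intros) auto
  have gl: "(\<lambda>k. g (w k)) \<longlonglongrightarrow> g l" if "w \<longlonglongrightarrow> l" for w l
    using continuous_on_tendsto_compose[OF g_cont that] by simp
  show ?thesis
    unfolding rhs_def by (intro tendsto_intros gl v cc fl)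
qed

lemma block_sup_upper:
  assumes "t \<in> {p j..q j}" "\<And>t. v t \<le> M"
  shows "v t \<le> block_sup j v"
  unfolding block_sup_def by (rule cSUP_upper[OF assms(1)]) (auto intro: bdd_aboveI2 assms(2))

lemma block_sup_tendsto:
  assumes j: "j < N" and b: "\<And>k t. v k t \<le> M" "\<And>t. v' t \<le> M"
    and v: "uniform_limit {A..A + P} v v' sequentially"
  shows "(\<lambda>k. block_sup j (v k)) \<longlonglongrightarrow> block_sup j v'"
proof (rule tendstoI)
  fix e :: real assume "e > 0"
  then have "\<forall>\<^sub>F k in sequentially. \<forall>t\<in>{A..A + P}. dist (v k t) (v' t) < e / 2"
    using uniform_limitD[OF v, of "e / 2"] by simp
  then show "\<forall>\<^sub>F k in sequentially. dist (block_sup j (v k)) (block_sup j v') < e"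
  proof eventually_elim
    case (elim k)
    have "\<bar>block_sup j (v k) - block_sup j v'\<bar> \<le> e / 2"
      unfolding block_sup_def
    proof (rule abs_SUP_diff_le)
      show "{p j..q j} \<noteq> {}" using p_less_q[OF j] by simp
      show "bdd_above (v k ` {p j..q j})" "bdd_above (v' ` {p j..q j})" using b by (auto intro!: bdd_aboveI2[where M = M])
      fix t assume "t \<in> {p j..q j}"
      then have "t \<in> {A..A + P}" using block_in[OF j] q_less_p[OF j] by auto
      then show "\<bar>v k t - v' t\<bar> \<le> e / 2" using elim by (force simp: dist_real_def)
    qed
    then show ?case using \<open>e > 0\<close> by (simp add: dist_real_def)
  qed
qed

end

section \<open>Comparison of integrals, periodic primitives and projections onto intervals\<close>

lemma integral_mono_AE:
  fixes f h :: "real \<Rightarrow> real"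
  assumes "f integrable_on S" "h integrable_on S" and ae: "AE x in lebesgue. x \<in> S \<longrightarrow> f x \<le> h x"
  shows "integral S f \<le> integral S h"
proof -
  obtain E where E: "E \<in> null_sets lebesgue" "{x. \<not> (x \<in> S \<longrightarrow> f x \<le> h x)} \<subseteq> E"
    using ae by (auto simp: eventually_ae_filter)
  then have neg: "negligible E" by (simp add: negligible_iff_null_sets)
  have "integral S f = integral S (\<lambda>x. if x \<in> E then 0 else f x)"
    "integral S h = integral S (\<lambda>x. if x \<in> E then 0 else h x)"
    by (rule integral_spike[OF neg]; simp)+
  moreover have "integral S (\<lambda>x. if x \<in> E then 0 else f x) \<le> integral S (\<lambda>x. if x \<in> E then 0 else h x)"
    using E(2) by (intro integral_le integrable_spike[OF assms(1) neg] integrable_spike[OF assms(2) neg]) auto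
  ultimately show ?thesis by simp
qed

lemma indefinite_integral_periodic:
  assumes F: "indefinite_integral h F" and h: "\<And>t. h (t + P) = h t" and c: "F (c + P) = F c"
  shows "F (t + P) = F t"
proof -
  have shift: "F (y + P) - F (x + P) = F y - F x" if "x \<le> y" for x y
  proof -
    have "h \<circ> (+) P = h" using h by (auto simp: add.commute)
    then have "integral {x + P..y + P} h = integral {x..y} h"
      using integral_shift_Icc_real[of x y h P] by simp
    then show ?thesis using indefinite_integral_diff[OF F] that by simp
  qed
  show ?thesis using shift[of c t] shift[of t c] c by (cases "c \<le> t") auto
qed

text \<open>The projection onto \<open>{l..u}\<close>. For \<open>l < u\<close>, an equation
  \<open>x = real_clamp l u (x + y)\<close> is a complementarity condition: \<open>y = 0\<close> if
  \<open>x\<close> is interior, \<open>y \<le> 0\<close> if \<open>x = l\<close>, and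
  \<open>0 \<le> y\<close> if \<open>x = u\<close>. The equations for heights and multipliers are
  all read this way.\<close>

definition real_clamp :: "real \<Rightarrow> real \<Rightarrow> real \<Rightarrow> real" where "real_clamp l u x = max l (min u x)"

lemma real_clamp_bounds: "l \<le> u \<Longrightarrow> l \<le> real_clamp l u x \<and> real_clamp l u x \<le> u"
  by (auto simp: real_clamp_def)

lemma real_clamp_lipschitz: "\<bar>real_clamp l u x - real_clamp l u y\<bar> \<le> \<bar>x - y\<bar>"
  by (auto simp: real_clamp_def max_def min_def)

lemma tendsto_real_clamp [tendsto_intros]: "(f \<longlongrightarrow> x) F \<Longrightarrow> ((\<lambda>k. real_clamp l u (f k)) \<longlongrightarrow> real_clamp l u x) F"
  unfolding real_clamp_def by (intro tendsto_intros)

context block_problem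
begin

lemma b_gap_all: "AE t in lebesgue. \<forall>j<N. t \<in> {q j..p (Suc j)} \<longrightarrow> b t = 0"
proof -
  have "AE t in lebesgue. \<forall>j\<in>{..<N}. t \<in> {q j..p (Suc j)} \<longrightarrow> b t = 0"
    by (rule AE_finite_allI) (use b_gap in auto)
  then show ?thesis by (rule eventually_mono) auto
qed

text \<open>Truncating \<open>u\<close> to \<open>{0..M}\<close> bounds everything, so a fixed point
  costs no estimate; the work is to remove the truncation. Where \<open>u\<close> exceeds
  \<open>M\<close>, any block concerned has its supremum above the target (here
  \<open>be j < M\<close> enters), so its multiplier is 0 and no source is left. Where
  \<open>u\<close> is negative, the absorbing term vanishes. In both regions the second derivative
  has the sign that the maximum principle asks for.\<close>

lemma fixed_point_exists:
  assumes M: "0 < M" and \<delta>: "0 < \<delta>"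
    and al: "\<And>j. j < N \<Longrightarrow> 0 \<le> al j \<and> al j \<le> be j \<and> be j < M"
    and Th: "\<And>j. j < N \<Longrightarrow> 0 \<le> Th j" and \<kappa>: "\<And>j. j < N \<Longrightarrow> 0 \<le> \<kappa> j"
  obtains s \<theta> u D where
    "\<And>j. j < N \<Longrightarrow> al j \<le> s j \<and> s j \<le> be j \<and> 0 \<le> \<theta> j \<and> \<theta> j \<le> Th j"
    "\<And>j. j < N \<Longrightarrow> s j = real_clamp (al j) (be j) (s j + ep j * (\<theta> j - 1))"
    "\<And>j. j < N \<Longrightarrow> \<theta> j = real_clamp 0 (Th j) (\<theta> j + s j - block_sup j u)"
    "\<And>t. (u has_real_derivative D t) (at t)"
    "indefinite_integral (\<lambda>t. - rhs \<delta> \<kappa> s \<theta> u t) D"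
    "\<And>x y. rhs \<delta> \<kappa> s \<theta> u absolutely_integrable_on {x..y}"
    "\<And>t. u (t + P) = u t" "\<And>t. D (t + P) = D t" "\<And>t. u (wrap t) = u t"
    "\<And>t. 0 \<le> u t \<and> u t \<le> M"
proof -
  define f where "f x v = rhs \<delta> \<kappa> x (\<lambda>j. x (N + j)) v" for x v
  define I where "I x v s = integral {A..s} (f x v)" for x v s
  \<comment> \<open>The mean of \<open>I x v\<close> over the period; as the slope in
    \<open>U\<close> it makes the two end values equal.\<close>
  define Bc where "Bc x v = integral {A..A + P} (I x v) / P" for x v
  \<comment> \<open>\<open>U'' = - f\<close> and \<open>U A = U (A + P)\<close>; the term \<open>I x v (A + P)\<close> makes \<open>U A = v A\<close> equivalent
    to \<open>U' A = U' (A + P)\<close>\<close>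
  define U where "U x v t = v A + I x v (A + P) + Bc x v * (t - A) - integral {A..t} (I x v)" for x v t
  \<comment> \<open>The vector \<open>x\<close> stacks the heights, at indices below
    \<open>N\<close>, and the multipliers, at indices \<open>N + j\<close>.\<close>
  define X where "X x v i = (if i < N then real_clamp (al i) (be i) (x i + ep i * (x (N + i) - 1))
     else real_clamp 0 (Th (i - N)) (x i + x (i - N) - block_sup (i - N) v))" for x v i
  define lo where "lo i = (if i < N then al i else 0)" for i
  define hi where "hi i = (if i < N then be i else Th (i - N))" for i
  define OK where "OK x v \<longleftrightarrow> (\<forall>i<N + N. lo i \<le> x i \<and> x i \<le> hi i) \<and>
      v \<in> borel_measurable borel \<and> (\<forall>t. 0 \<le> v t \<and> v t \<le> M)" for x and v :: "real \<Rightarrow> real"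
  have OK_s: "al j \<le> x j \<and> x j \<le> be j \<and> 0 \<le> x (N + j) \<and> x (N + j) \<le> Th j" if "OK x v" "j < N" for x v j
  proof -
    have "lo i \<le> x i \<and> x i \<le> hi i" if "i < N + N" for i using \<open>OK x v\<close> that by (simp add: OK_def)
    from this[of j] this[of "N + j"] show ?thesis using that(2) by (simp add: lo_def hi_def)
  qed
  obtain G where G: "\<And>x. x \<in> {0..M + (\<Sum>j<N. \<kappa> j * be j)} \<Longrightarrow> g x \<le> G"
  proof -
    have "compact (g ` {0..M + (\<Sum>j<N. \<kappa> j * be j)})"
      by (intro compact_continuous_image continuous_on_subset[OF g_cont]) auto
    then have "bounded (g ` {0..M + (\<Sum>j<N. \<kappa> j * be j)})" by (rule compact_imp_bounded)
    then obtain K where "\<And>x. x \<in> {0..M + (\<Sum>j<N. \<kappa> j * be j)} \<Longrightarrow> norm (g x) \<le> K"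
      unfolding bounded_iff by blast
    then show ?thesis using that[of K] by (auto simp: abs_le_iff)
  qed
  define H where "H t = b t * ((\<Sum>j<N. Th j) * G) + c t * G" for t
  have H_int: "H integrable_on {x..y}" for x y
    unfolding H_def by (intro integrable_add integrable_on_mult_left b_int c_int)
  have f_int: "f x v absolutely_integrable_on {y..z}" and f_bd: "\<bar>f x v t\<bar> \<le> H t"
    if ok: "OK x v" for x v y z t
  proof -
    have v: "v \<in> borel_measurable borel" "\<And>t. 0 \<le> v t \<and> v t \<le> M" using ok by (auto simp: OK_def)
    have th: "\<forall>j<N. 0 \<le> x (N + j) \<and> x (N + j) \<le> Th j" using OK_s[OF ok] by auto
    have s: "\<forall>j<N. 0 \<le> \<kappa> j \<and> 0 \<le> x j \<and> x j \<le> be j" using OK_s[OF ok] al \<kappa> by force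
    show "f x v absolutely_integrable_on {y..z}" "\<bar>f x v t\<bar> \<le> H t"
      unfolding f_def H_def using rhs_integrable[OF v th s G] by auto
  qed
  have f_int': "f x v integrable_on {y..z}" if "OK x v" for x v y z
    using f_int[OF that] set_lebesgue_integral_eq_integral(1) by blast
  define K where "K = integral {A..A + P} H"
  have H_nonneg: "0 \<le> H t" if "OK x v" for x v t using f_bd[OF that, of t] by linarith
  have I_bd: "\<bar>I x v t\<bar> \<le> K" if ok: "OK x v" and t: "t \<in> {A..A + P}" for x v t
  proof -
    have "norm (I x v t) \<le> integral {A..t} H"
      unfolding I_def using f_bd[OF ok] by (intro integral_norm_bound_integral f_int'[OF ok] H_int) auto
    also have "\<dots> \<le> K" unfolding K_def
      by (rule integral_subset_le) (use t H_int H_nonneg[OF ok] in auto)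
    finally show ?thesis by simp
  qed
  have I_cont: "continuous_on {A..A + P} (I x v)" if "OK x v" for x v
    unfolding I_def[abs_def] by (rule indefinite_integral_continuous_1[OF f_int'[OF that]])
  have I_int: "I x v integrable_on {y..z}" if "OK x v" "A \<le> y" "z \<le> A + P" for x v y z
    using that by (intro integrable_continuous_interval continuous_on_subset[OF I_cont]) auto
  have Bc_bd: "\<bar>Bc x v\<bar> \<le> K" if ok: "OK x v" for x v
  proof -
    have "norm (integral {A..A + P} (I x v)) \<le> integral {A..A + P} (\<lambda>_. K)"
      by (rule integral_norm_bound_integral) (use I_bd[OF ok] I_int[OF ok] in auto)
    then show ?thesis using P_pos by (simp add: Bc_def field_simps)
  qed
  have K_nonneg: "0 \<le> K" if ok: "OK x v" for x v using Bc_bd[OF ok] by linarith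
  have U_lip: "\<bar>U x v t - U x v t'\<bar> \<le> 2 * K * \<bar>t - t'\<bar>"
    if ok: "OK x v" and t: "t \<in> {A..A + P}" "t' \<in> {A..A + P}" for x v t t'
  proof -
    have *: "\<bar>U x v t - U x v t'\<bar> \<le> 2 * K * \<bar>t - t'\<bar>"
      if "t' \<le> t" "t \<in> {A..A + P}" "t' \<in> {A..A + P}" for t t'
    proof -
      have "integral {A..t} (I x v) = integral {A..t'} (I x v) + integral {t'..t} (I x v)"
        using Henstock_Kurzweil_Integration.integral_combine[of A t' t "I x v"] that I_int[OF ok] by auto
      then have "U x v t - U x v t' = Bc x v * (t - t') - integral {t'..t} (I x v)"
        by (simp add: U_def algebra_simps)
      moreover have "\<bar>Bc x v * (t - t')\<bar> \<le> K * (t - t')"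
        using Bc_bd[OF ok] that by (simp add: abs_mult mult_right_mono)
      moreover have "norm (integral {t'..t} (I x v)) \<le> integral {t'..t} (\<lambda>_. K)"
        by (rule integral_norm_bound_integral) (use I_bd[OF ok] I_int[OF ok] that in auto)
      ultimately show ?thesis using that by (simp add: algebra_simps)
    qed
    show ?thesis using *[of t' t] *[of t t'] t by (cases "t' \<le> t") (auto simp: abs_minus_commute)
  qed
  have f_lim: "(\<lambda>k. f (xs k) (vs k) t) \<longlonglongrightarrow> f x v t"
    if "\<And>i. i < N + N \<Longrightarrow> (\<lambda>k. xs k i) \<longlonglongrightarrow> x i" "uniform_limit {A..A + P} vs v sequentially"
    for xs vs x v t
    unfolding f_def using that by (intro rhs_tendsto) auto
  have U_lim: "(\<lambda>k. U (xs k) (vs k) t) \<longlonglongrightarrow> U x v t"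
    if ok: "\<And>k. OK (xs k) (vs k)" "OK x v" and x: "\<And>i. i < N + N \<Longrightarrow> (\<lambda>k. xs k i) \<longlonglongrightarrow> x i"
      and v: "uniform_limit {A..A + P} vs v sequentially" and t: "t \<in> {A..A + P}"
    for xs vs x v t
  proof -
    have I_lim: "(\<lambda>k. I (xs k) (vs k) s) \<longlonglongrightarrow> I x v s" for s
      unfolding I_def
      by (rule dominated_convergence(2)[where h = H])
        (use f_int'[OF ok(1)] H_int f_bd[OF ok(1)] f_lim[OF x v] in auto)
    have II_lim: "(\<lambda>k. integral {A..s} (I (xs k) (vs k))) \<longlonglongrightarrow> integral {A..s} (I x v)" if "s \<in> {A..A + P}" for s
      by (rule dominated_convergence(2)[where h = "\<lambda>_. K"])
        (use that I_int[OF ok(1)] I_bd[OF ok(1)] I_lim in auto)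
    have "A \<in> {A..A + P}" "A + P \<in> {A..A + P}" using P_pos by auto
    then show ?thesis
      unfolding U_def Bc_def using P_pos
      by (intro tendsto_intros I_lim II_lim t tendsto_uniform_limitI[OF v]) auto
  qed
  obtain x v where xv: "\<forall>i<N + N. lo i \<le> x i \<and> x i \<le> hi i"
    "v \<in> borel_measurable borel \<and> (\<forall>t. 0 \<le> v t \<and> v t \<le> M)" "continuous_on UNIV v"
    "\<And>i. i < N + N \<Longrightarrow> X x v i = x i" "\<And>t. t \<in> {A..A + P} \<Longrightarrow> real_clamp 0 M (U x v t) = v t"
  \<comment> \<open>The absolute value makes the Lipschitz constant nonnegative unconditionally;
    \<open>0 \<le> K\<close> itself is only derived from an admissible pair.\<close>
  proof (rule schauder_box_lipschitz[of A "A + P" M "2 * \<bar>K\<bar>" "N + N" lo hi X "\<lambda>x v t. real_clamp 0 M (U x v t)"])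
    show "lo i \<le> hi i" if "i < N + N" for i using that al[of i] Th[of "i - N"] by (auto simp: lo_def hi_def)
    show "lo i \<le> X x v i \<and> X x v i \<le> hi i" if "i < N + N" for x v i
      using that al[of i] Th[of "i - N"] real_clamp_bounds by (auto simp: lo_def hi_def X_def)
    show "0 \<le> real_clamp 0 M (U x v t) \<and> real_clamp 0 M (U x v t) \<le> M" for x v t
      using M real_clamp_bounds[of 0 M] by simp
    show "\<bar>real_clamp 0 M (U x v t) - real_clamp 0 M (U x v t')\<bar> \<le> 2 * \<bar>K\<bar> * \<bar>t - t'\<bar>"
      if "\<forall>i<N + N. lo i \<le> x i \<and> x i \<le> hi i" "v \<in> borel_measurable borel \<and> (\<forall>t. 0 \<le> v t \<and> v t \<le> M)"
        "t \<in> {A..A + P}" "t' \<in> {A..A + P}" for x v t t'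
    proof -
      have ok: "OK x v" using that by (simp add: OK_def)
      have "\<bar>real_clamp 0 M (U x v t) - real_clamp 0 M (U x v t')\<bar> \<le> \<bar>U x v t - U x v t'\<bar>" by (rule real_clamp_lipschitz)
      also have "\<dots> \<le> 2 * \<bar>K\<bar> * \<bar>t - t'\<bar>" using U_lip[OF ok that(3,4)] K_nonneg[OF ok] by simp
      finally show ?thesis .
    qed
    show "(\<lambda>k. X (xs k) (vs k) i) \<longlonglongrightarrow> X x v i"
      if "\<And>k. vs k \<in> borel_measurable borel \<and> (\<forall>t. 0 \<le> vs k t \<and> vs k t \<le> M)"
        "v \<in> borel_measurable borel \<and> (\<forall>t. 0 \<le> v t \<and> v t \<le> M)"
        "\<And>i. i < N + N \<Longrightarrow> (\<lambda>k. xs k i) \<longlonglongrightarrow> x i" "uniform_limit {A..A + P} vs v sequentially" "i < N + N"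
      for xs vs x v i
    proof (cases "i < N")
      case True
      then show ?thesis unfolding X_def using that(3) by (auto intro!: tendsto_intros)
    next
      case False
      have "(\<lambda>k. block_sup (i - N) (vs k)) \<longlonglongrightarrow> block_sup (i - N) v"
        using that False by (intro block_sup_tendsto[where M = M]) auto
      then show ?thesis unfolding X_def using that(3)[of i] that(3)[of "i - N"] that(5) False
        by (auto intro!: tendsto_intros)
    qed
    show "(\<lambda>k. real_clamp 0 M (U (xs k) (vs k) t)) \<longlonglongrightarrow> real_clamp 0 M (U x v t)"
      if "\<And>k. \<forall>i<N + N. lo i \<le> xs k i \<and> xs k i \<le> hi i"
        "\<And>k. vs k \<in> borel_measurable borel \<and> (\<forall>t. 0 \<le> vs k t \<and> vs k t \<le> M)"
        "\<forall>i<N + N. lo i \<le> x i \<and> x i \<le> hi i"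
        "v \<in> borel_measurable borel \<and> (\<forall>t. 0 \<le> v t \<and> v t \<le> M)"
        "\<And>i. i < N + N \<Longrightarrow> (\<lambda>k. xs k i) \<longlonglongrightarrow> x i" "uniform_limit {A..A + P} vs v sequentially" "t \<in> {A..A + P}"
      for xs vs x v t
      using that by (intro tendsto_intros U_lim) (auto simp: OK_def)
  qed (use P_pos M in auto)
  have ok: "OK x v" using xv by (simp add: OK_def)
  define s where "s j = x j" for j
  define \<theta> where "\<theta> j = x (N + j)" for j
  have f_eq: "f x v = rhs \<delta> \<kappa> s \<theta> v" by (simp add: f_def s_def[abs_def] \<theta>_def[abs_def])
  have box: "al j \<le> s j \<and> s j \<le> be j \<and> 0 \<le> \<theta> j \<and> \<theta> j \<le> Th j" if "j < N" for j
    using OK_s[OF ok that] by (simp add: s_def \<theta>_def)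
  have s_fix: "s j = real_clamp (al j) (be j) (s j + ep j * (\<theta> j - 1))" if "j < N" for j
    using xv(4)[of j] that by (simp add: X_def s_def \<theta>_def)
  have \<theta>_fix: "\<theta> j = real_clamp 0 (Th j) (\<theta> j + s j - block_sup j v)" if "j < N" for j
    using xv(4)[of "N + j"] that by (simp add: X_def s_def \<theta>_def)
  have f_per: "f x v (t + P) = f x v t" for t unfolding f_eq by (rule rhs_per)
  have "(\<lambda>t. - f x v t) integrable_on {y..z}" for y z
    using f_int'[OF ok] by (intro integrable_neg)
  then obtain F where F: "indefinite_integral (\<lambda>t. - f x v t) F" "F A = 0"
    using indefinite_integral_exists[of "\<lambda>t. - f x v t" A] by metis
  have F_eq: "F t = - I x v t" if "A \<le> t" for t
    using indefinite_integral_diff[OF F(1) that] F(2) by (simp add: I_def)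
  define D where "D t = Bc x v + F t" for t
  have D_ind: "indefinite_integral (\<lambda>t. - f x v t) D"
    using F(1) by (simp add: indefinite_integral_def D_def)
  have D_cont: "continuous_on UNIV D" by (rule continuous_indefinite_integral[OF D_ind])
  then have "D integrable_on {y..z}" for y z
    by (intro integrable_continuous_interval continuous_on_subset[OF D_cont]) auto
  then obtain Q where Q: "indefinite_integral D Q" "Q A = 0"
    using indefinite_integral_exists[of D A] by metis
  define u where "u t = v A + I x v (A + P) + Q t" for t
  have u_ind: "indefinite_integral D u" using Q(1) by (simp add: indefinite_integral_def u_def)
  have u_deriv: "(u has_real_derivative D t) (at t)" for t
    by (rule indefinite_integral_has_derivative[OF u_ind D_cont])
  have u_eq: "u t = U x v t" if t: "t \<in> {A..A + P}" for t
  proof -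
    have "Q t = integral {A..t} D" using indefinite_integral_diff[OF Q(1)] Q(2) t by fastforce
    also have "\<dots> = integral {A..t} (\<lambda>s. Bc x v - I x v s)"
      by (rule integral_cong) (simp add: D_def F_eq)
    also have "\<dots> = Bc x v * (t - A) - integral {A..t} (I x v)"
      using t by (subst Henstock_Kurzweil_Integration.integral_diff) (auto intro: I_int[OF ok])
    finally show ?thesis by (simp add: u_def U_def)
  qed
  have v_eq: "v t = real_clamp 0 M (u t)" if "t \<in> {A..A + P}" for t using xv(5)[OF that] u_eq[OF that] by simp
  have A_in: "A \<in> {A..A + P}" "A + P \<in> {A..A + P}" using P_pos by auto
  have u_A: "u A = v A + I x v (A + P)" by (simp add: u_def Q)
  have u_AP: "u A = u (A + P)"
    using u_eq A_in P_pos by (simp add: U_def Bc_def)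
  have D_jump: "D (A + P) = D A - I x v (A + P)" using P_pos by (simp add: D_def F_eq I_def)
  have u_wrap: "u (wrap t) = u t \<and> wrap t \<in> {A..A + P}" if "t \<in> {A..A + P}" for t
    using wrap_id[of t] wrap_add[of A] wrap_id[of A] that P_pos u_AP
    by (cases "t = A + P") auto
  have D_diff: "D z - D y = integral {y..z} (\<lambda>t. - f x v t)" if "y \<le> z" for y z
    by (rule indefinite_integral_diff[OF D_ind that])
  have upper: "u t \<le> M" if "t \<in> {A..A + P}" for t
  proof (rule periodic_maximum_principle[of A "A + P" u D M t])
    \<comment> \<open>If \<open>u A\<close> exceeds \<open>M\<close> then \<open>v A = M\<close>, so
      \<open>I x v (A + P) = u A - v A\<close> is positive, and this is exactly the drop of
      \<open>D\<close> over the period.\<close>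
    show "D (A + P) < D A" if "M < u A"
    proof -
      have "real_clamp 0 M (u A) = M" using that M by (simp add: real_clamp_def)
      then show ?thesis using that v_eq[OF A_in(1)] u_A D_jump by linarith
    qed
    show "D y \<le> D z" if yz: "A \<le> y" "y \<le> z" "z \<le> A + P" "\<And>t. t \<in> {y..z} \<Longrightarrow> M < u t" for y z
    proof -
      \<comment> \<open>The right end is discarded because \<open>wrap\<close> sends it to
        \<open>A\<close>, which belongs to another cell when \<open>N > 1\<close>.\<close>
      have "AE t in lebesgue. t \<noteq> A + P"
        by (intro AE_I'[of "{A + P}"]) (auto simp: negligible_iff_null_sets[symmetric])
      then have "AE t in lebesgue. t \<in> {y..z} \<longrightarrow> 0 \<le> - f x v t"
        using b_gap_all
      proof eventually_elim
        case (elim t)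
        show ?case
        proof
          assume t: "t \<in> {y..z}"
          then have tA: "t \<in> {A..<A + P}" using yz elim by auto
          then have wt: "wrap t = t" by (rule wrap_id)
          have vt: "v t = M" using yz(4)[OF t] v_eq[of t] tA M by (auto simp: real_clamp_def)
          obtain j where j: "j < N" "t \<in> {p j..<p (Suc j)}" using cell_exists[OF tA] .
          have "b t * cell_coeff \<theta> t = 0"
          proof (cases "t \<le> q j")
            case True
            \<comment> \<open>A supremum of at least \<open>M\<close> lies above every admissible
              target, so the equation for \<open>\<theta> j\<close> pushes it strictly downwards; it
              can only rest at 0.\<close>
            then have "M \<le> block_sup j v"
              using block_sup_upper[of t j v M] xv(2) j vt by auto
            then have "\<theta> j + s j - block_sup j v < \<theta> j" using box[OF j(1)] al[OF j(1)] by linarith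
            then have "\<theta> j = 0" using \<theta>_fix[OF j(1)] box[OF j(1)] by (auto simp: real_clamp_def)
            then show ?thesis using cell_coeff_eq[of j t \<theta>] j wt by simp
          next
            case False
            then show ?thesis using elim(2) j by auto
          qed
          then show "0 \<le> - f x v t"
            using mult_nonneg_nonneg[OF c_nonneg g_nonneg] by (simp only: f_eq rhs_def mult_zero_left) simp
        qed
      qed
      then have "integral {y..z} (\<lambda>_. 0) \<le> integral {y..z} (\<lambda>t. - f x v t)"
        by (intro integral_mono_AE integrable_neg f_int'[OF ok]) auto
      then show ?thesis using D_diff yz(2) by fastforce
    qed
  qed (use P_pos u_deriv u_AP that in auto)
  have lower: "0 \<le> u t" if "t \<in> {A..A + P}" for t
  proof -
    have "- u t \<le> 0"
    proof (rule periodic_maximum_principle[of A "A + P" "\<lambda>t. - u t" "\<lambda>t. - D t" 0 t])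
      show "- D (A + P) < - D A" if "0 < - u A"
      proof -
        have "real_clamp 0 M (u A) = 0" using that M by (simp add: real_clamp_def)
        then show ?thesis using that v_eq[OF A_in(1)] u_A D_jump by linarith
      qed
      show "- D y \<le> - D z" if yz: "A \<le> y" "y \<le> z" "z \<le> A + P" "\<And>t. t \<in> {y..z} \<Longrightarrow> 0 < - u t" for y z
      proof -
        \<comment> \<open>The truncated function is 0 where \<open>u\<close> is negative, and
          \<open>g 0 = 0\<close> removes the absorbing term; only the nonnegative source is
          left.\<close>
        have "0 \<le> f x v t" if t: "t \<in> {y..z}" for t
        proof -
          have "u (wrap t) < 0" "wrap t \<in> {A..A + P}" using yz t u_wrap[of t] by auto
          then have "v (wrap t) = 0" using v_eq[of "wrap t"] M by (simp add: real_clamp_def)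
          moreover have "0 \<le> cell_coeff \<theta> t" using cell_coeff_bounds(1)[of \<theta> Th] box by blast
          ultimately show ?thesis using b_nonneg g_nonneg g_zero by (simp add: f_eq rhs_def)
        qed
        then have "integral {y..z} (\<lambda>t. - f x v t) \<le> integral {y..z} (\<lambda>_. 0)"
          by (intro integral_le integrable_neg f_int'[OF ok]) auto
        then show ?thesis using D_diff[OF yz(2)] by simp
      qed
    qed (use P_pos u_deriv u_AP that in \<open>auto intro!: derivative_eq_intros\<close>)
    then show ?thesis by simp
  qed
  have vu: "v t = u t" if "t \<in> {A..A + P}" for t
    using v_eq[OF that] upper[OF that] lower[OF that] by (simp add: real_clamp_def)
  have "I x v (A + P) = 0" using u_A vu[OF A_in(1)] by simp
  then have D_AP: "D (A + P) = D A" using D_jump by simp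
  have D_per: "D (t + P) = D t" for t
    by (rule indefinite_integral_periodic[OF D_ind _ D_AP]) (simp add: f_per)
  have u_per: "u (t + P) = u t" for t
    by (rule indefinite_integral_periodic[OF u_ind D_per u_AP[symmetric]])
  have u_wrap': "u (wrap t) = u t" for t
  proof -
    have shift: "u (t + real n * P) = u t" for t n
      by (induction n) (use u_per in \<open>auto simp: algebra_simps\<close>, metis add.assoc add.commute u_per)
    define n where "n = \<lfloor>(t - A) / P\<rfloor>"
    show ?thesis
    proof (cases "0 \<le> n")
      case True
      then show ?thesis using shift[of "wrap t" "nat n"] by (simp add: wrap_def n_def[symmetric] mult.commute)
    next
      case False
      then show ?thesis using shift[of t "nat (- n)"] by (simp add: wrap_def n_def[symmetric] mult.commute)
    qed
  qed
  have "rhs \<delta> \<kappa> s \<theta> u t = f x v t" for t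
    using vu[of "wrap t"] wrap_in[of t] by (simp add: f_eq rhs_def)
  then have rhs_u: "rhs \<delta> \<kappa> s \<theta> u = f x v" by auto
  have sup_eq: "block_sup j u = block_sup j v" if "j < N" for j
  proof -
    have "{p j..q j} \<subseteq> {A..A + P}" using block_in[OF that] q_less_p[OF that] by auto
    then show ?thesis unfolding block_sup_def using vu by (intro SUP_cong) auto
  qed
  show ?thesis
  proof (rule that[of s \<theta> u D])
    show "0 \<le> u t \<and> u t \<le> M" for t
      using upper[of "wrap t"] lower[of "wrap t"] wrap_in[of t] by (simp add: u_wrap')
  qed (use box s_fix \<theta>_fix sup_eq u_deriv D_ind f_int[OF ok] u_per D_per u_wrap' in \<open>auto simp: rhs_u\<close>)
qed

end

section \<open>A priori bounds\<close>

context block_problem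
begin

definition prev_end :: "nat \<Rightarrow> real" where
  "prev_end j = (if j = 0 then q (N - 1) - P else q (j - 1))"

text \<open>\<open>gap\<close> produces the dips below \<open>r / 2\<close>. The conditions
  \<open>slope_r\<close> and \<open>slope_R\<close> compare two slopes: climbing from a dip to
  height \<open>v\<close> within length \<open>\<Lambda>\<close> takes a mean slope above
  \<open>v / (2 * \<Lambda>)\<close>, while a source with multiplier at most 1 supplies at most
  \<open>C * Bt\<close>. Here \<open>\<Lambda>\<close> bounds the length of a block together with
  the gap before it. \<open>mid\<close> works the other way: with multiplier at least 1 and maximum
  \<open>\<rho>\<close>, concavity would lift \<open>u\<close> above \<open>\<rho>\<close>.\<close>

lemma pattern_solution:
  assumes rad: "0 < r" "r < \<rho>" "\<rho> < R"
    and g_pos: "\<And>x. 0 < x \<Longrightarrow> 0 < g x"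
    and \<delta>: "0 < \<delta>" "\<And>j. j < N \<Longrightarrow> p j + \<delta> \<le> q j - \<delta>" "\<And>j. j < N \<Longrightarrow> q j + \<delta> \<le> p (Suc j) - \<delta>"
    and \<Lambda>: "\<And>j. j < N \<Longrightarrow> q j - prev_end j \<le> \<Lambda>"
    and \<omega>: "0 < \<omega>" "\<And>j. j < N \<Longrightarrow> \<omega> \<le> integral {p j + \<delta>..q j - \<delta>} b"
    and Bt: "\<And>j. j < N \<Longrightarrow> integral {p j..q j} b \<le> Bt"
    and gap: "\<And>x. x \<in> {r / 2..R + 1} \<Longrightarrow> \<gamma> \<le> g x" "0 \<le> \<gamma>"
      "\<And>j. j < N \<Longrightarrow> R + 1 < \<delta> * (\<gamma> * integral {q j + \<delta>..p (Suc j) - \<delta>} c) / 2"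
    and slope_r: "\<And>x. x \<in> {0..r} \<Longrightarrow> g x \<le> Cr" "2 * \<Lambda> * (Cr * Bt) < r"
    and slope_R: "\<And>x. x \<in> {0..R} \<Longrightarrow> g x \<le> CR" "2 * \<Lambda> * (CR * Bt) < R"
    and mid: "\<And>x. x \<in> {\<rho> * (\<delta> / \<Lambda>)..\<rho>} \<Longrightarrow> \<gamma>\<rho> \<le> g x" "0 \<le> \<gamma>\<rho>" "\<rho> < \<delta> * (\<gamma>\<rho> * \<omega>) / 2"
    and st: "\<And>j. j < N \<Longrightarrow> st j \<in> {0, 1, 2 :: nat}"
  obtains u D where
    "\<And>t. (u has_real_derivative D t) (at t)"
    "indefinite_integral (\<lambda>t. - ((b t - c t) * g (u t))) D"
    "\<And>x y. (\<lambda>t. (b t - c t) * g (u t)) absolutely_integrable_on {x..y}"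
    "\<And>t. u (t + P) = u t" "\<And>t. D (t + P) = D t" "\<And>t. 0 \<le> u t"
    "\<And>j. j < N \<Longrightarrow> (st j = 0 \<longrightarrow> block_sup j u < r) \<and> (st j = 1 \<longrightarrow> r < block_sup j u \<and> block_sup j u < \<rho>)
       \<and> (st j = 2 \<longrightarrow> \<rho> < block_sup j u \<and> block_sup j u < R)"
proof -
  have N_pos: "0 < N" using p_first p_last P_pos by (cases "N = 0") auto
  define M where "M = R + 1"
  have prev_le: "prev_end j \<le> p j" if "j < N" for j
  proof (cases "j = 0")
    case True
    then show ?thesis using q_less_p[of "N - 1"] p_first p_last N_pos by (simp add: prev_end_def)
  next
    case False
    then show ?thesis using q_less_p[of "j - 1"] that by (simp add: prev_end_def less_imp_diff_less less_imp_le)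
  qed
  have \<Lambda>_block: "q j - p j \<le> \<Lambda>" if "j < N" for j using \<Lambda>[OF that] prev_le[OF that] by linarith
  have "2 * \<delta> \<le> q 0 - p 0" "q 0 - p 0 \<le> \<Lambda>" using \<delta>(2)[OF N_pos] \<Lambda>_block[OF N_pos] by linarith+
  then have \<Lambda>_pos: "0 < \<Lambda>" "\<delta> \<le> \<Lambda>" using \<delta>(1) by linarith+
  define \<kappa>0 where "\<kappa>0 = \<delta> / \<Lambda>"
  have \<kappa>0: "0 < \<kappa>0" "\<kappa>0 \<le> 1" using \<Lambda>_pos \<delta>(1) by (auto simp: \<kappa>0_def)
  obtain \<gamma>' where \<gamma>': "0 < \<gamma>'" "\<And>x. x \<in> {\<kappa>0 * r..M} \<Longrightarrow> \<gamma>' \<le> g x"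
  proof -
    have \<kappa>r: "0 < \<kappa>0 * r" using \<kappa>0 rad by simp
    have "\<kappa>0 * r \<le> 1 * r" using \<kappa>0(2) rad by (intro mult_right_mono) auto
    then have "\<kappa>0 * r \<le> M" using rad unfolding M_def by linarith
    then obtain y where y: "y \<in> {\<kappa>0 * r..M}" "\<And>x. x \<in> {\<kappa>0 * r..M} \<Longrightarrow> g y \<le> g x"
      using continuous_attains_inf[of "{\<kappa>0 * r..M}" g] continuous_on_subset[OF g_cont, of "{\<kappa>0 * r..M}"] by auto
    then show ?thesis using that[of "g y"] g_pos[of y] \<kappa>r by auto
  qed
  \<comment> \<open>With this value
    \<open>\<delta> * (Th0 * \<gamma>' * \<omega>) / 2 = R + 1\<close>, so a multiplier resting at
    its cap would lift \<open>u\<close> above every target.\<close>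
  define Th0 where "Th0 = 2 * (R + 1) / (\<delta> * \<gamma>' * \<omega>)"
  have Th0: "0 \<le> Th0" "R < \<delta> * (Th0 * \<gamma>' * \<omega>) / 2"
    using rad \<delta>(1) \<gamma>'(1) \<omega>(1) by (auto simp: Th0_def field_simps)
  \<comment> \<open>For the symbol 0 the height is frozen at \<open>r\<close>, the multiplier is
    capped at 1 and the floor is switched off, so that \<open>u\<close> may be arbitrarily small on
    such a block.\<close>
  define al where "al j = (if st j = 2 then \<rho> else r)" for j
  define be where "be j = (if st j = 0 then r else if st j = 1 then \<rho> else R)" for j
  define Th where "Th j = (if st j = 0 then 1 else Th0)" for j
  define \<kappa> where "\<kappa> j = (if st j = 0 then 0 else \<kappa>0)" for j
  \<comment> \<open>The sign is chosen so that a height resting at an end of its range satisfies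
    precisely the inequality excluded there: \<open>\<theta> \<le> 1\<close> at \<open>r\<close> and
    at \<open>R\<close>, \<open>1 \<le> \<theta>\<close> at \<open>\<rho>\<close>.\<close>
  define ep :: "nat \<Rightarrow> real" where "ep j = (if st j = 2 then - 1 else 1)" for j
  have al: "0 \<le> al j \<and> al j \<le> be j \<and> be j < M" "r \<le> al j" "be j \<le> R" if "j < N" for j
    using st[OF that] rad by (auto simp: al_def be_def M_def)
  have M_pos: "0 < M" using rad by (simp add: M_def)
  have Th_nonneg: "0 \<le> Th j" and \<kappa>_nonneg: "0 \<le> \<kappa> j" and \<kappa>_le: "\<kappa> j \<le> 1" for j
    using Th0 \<kappa>0 by (auto simp: Th_def \<kappa>_def)
  obtain s \<theta> u D where
    box: "\<And>j. j < N \<Longrightarrow> al j \<le> s j \<and> s j \<le> be j \<and> 0 \<le> \<theta> j \<and> \<theta> j \<le> Th j"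
    and s_fix: "\<And>j. j < N \<Longrightarrow> s j = real_clamp (al j) (be j) (s j + ep j * (\<theta> j - 1))"
    and \<theta>_fix: "\<And>j. j < N \<Longrightarrow> \<theta> j = real_clamp 0 (Th j) (\<theta> j + s j - block_sup j u)"
    and deriv: "\<And>t. (u has_real_derivative D t) (at t)"
    and D_ind: "indefinite_integral (\<lambda>t. - rhs \<delta> \<kappa> s \<theta> u t) D"
    and f_int: "\<And>x y. rhs \<delta> \<kappa> s \<theta> u absolutely_integrable_on {x..y}"
    and u_per: "\<And>t. u (t + P) = u t" and D_per: "\<And>t. D (t + P) = D t"
    and u_wrap: "\<And>t. u (wrap t) = u t" and u_bd: "\<And>t. 0 \<le> u t \<and> u t \<le> M"
  proof (rule fixed_point_exists[of M \<delta> al be Th \<kappa> ep, OF M_pos \<delta>(1) al(1)], goal_cases)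
    case (4 s \<theta> u D)
    show ?case by (rule that[of s \<theta> u D]; rule 4; assumption)
  qed (simp_all add: Th_nonneg \<kappa>_nonneg)
  define f where "f = rhs \<delta> \<kappa> s \<theta> u"
  define w where "w j t = max (u t) (if t \<in> {p j + \<delta>..q j - \<delta>} then \<kappa> j * s j else 0)" for j t
  have s_pos: "0 < s j" "r \<le> s j" "s j \<le> R" if "j < N" for j
    using box[OF that] al[OF that] rad by auto
  have \<kappa>s: "0 \<le> \<kappa> j * s j" "\<kappa> j * s j \<le> s j" if "j < N" for j
    using s_pos[OF that] \<kappa>_nonneg[of j] \<kappa>_le[of j] mult_right_mono[of "\<kappa> j" 1 "s j"] by auto
  have f_int': "f integrable_on {x..y}" for x y
    using f_int[of x y] set_lebesgue_integral_eq_integral(1) by (auto simp: f_def)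
  have D_diff: "D x - D y = integral {x..y} f" if "x \<le> y" for x y
    using indefinite_integral_diff[OF D_ind that] by (simp add: f_def)
  have f_cell: "f t = b t * \<theta> j * g (w j t) - c t * g (u t)" if "j < N" "t \<in> {p j..<p (Suc j)}" for j t
  proof -
    have wt: "wrap t = t" using that block_in[of j] by (intro wrap_id) auto
    show ?thesis
      using cell_coeff_eq[of j t \<theta>] inner_floor_eq[of j t \<delta> \<kappa> s] that \<delta>(1)
      by (simp add: f_def rhs_def wt w_def)
  qed
  have f_block: "AE t in lebesgue. t \<in> {p j..q j} \<longrightarrow> f t = \<theta> j * g (w j t) * b t" if "j < N" for j
    using c_block[OF that]
    by eventually_elim (use f_cell[OF that] q_less_p[OF that] in \<open>auto simp: mult_ac\<close>)
  have f_gap: "AE t in lebesgue. t \<in> {q j..p (Suc j)} \<longrightarrow> f t = - (g (u t) * c t)" if "j < N" for j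
    using b_gap[OF that]
    by eventually_elim (simp add: f_def rhs_def u_wrap)
  have block_upper: "D x - D y \<le> C * Bt"
    if "j < N" "p j \<le> x" "x \<le> y" "y \<le> q j" "0 \<le> C" "\<And>t. t \<in> {p j..q j} \<Longrightarrow> \<theta> j * g (w j t) \<le> C" for j x y C
  proof -
    have "integral {x..y} f \<le> integral {x..y} (\<lambda>t. C * b t)"
    proof (rule integral_mono_AE[OF f_int'])
      show "AE t in lebesgue. t \<in> {x..y} \<longrightarrow> f t \<le> C * b t"
        using f_block[OF that(1)] by eventually_elim (use that b_nonneg in \<open>auto intro!: mult_right_mono\<close>)
    qed (intro integrable_on_mult_right b_int)
    also have "\<dots> = C * integral {x..y} b" by simp
    also have "\<dots> \<le> C * integral {p j..q j} b"
      using that b_int b_nonneg by (intro mult_left_mono integral_subset_le) auto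
    also have "\<dots> \<le> C * Bt" using Bt[OF that(1)] that(5) by (intro mult_left_mono) auto
    finally show ?thesis using D_diff[OF that(3)] by simp
  qed
  have block_lower: "K * integral {x..y} b \<le> D x - D y"
    if "j < N" "p j \<le> x" "x \<le> y" "y \<le> q j" "\<And>t. t \<in> {x..y} \<Longrightarrow> K \<le> \<theta> j * g (w j t)" for j x y K
  proof -
    have "integral {x..y} (\<lambda>t. K * b t) \<le> integral {x..y} f"
    proof (rule integral_mono_AE[OF _ f_int'])
      show "AE t in lebesgue. t \<in> {x..y} \<longrightarrow> K * b t \<le> f t"
        using f_block[OF that(1)] by eventually_elim (use that b_nonneg in \<open>auto intro!: mult_right_mono\<close>)
    qed (intro integrable_on_mult_right b_int)
    then show ?thesis using D_diff[OF that(3)] by simp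
  qed
  have block_anti: "D y \<le> D x" if "j < N" "p j \<le> x" "x \<le> y" "y \<le> q j" for j x y
    using block_lower[OF that, of 0] box[OF that(1)] g_nonneg by simp
  have block_const: "D x \<le> D y" if "j < N" "p j \<le> x" "x \<le> y" "y \<le> q j" "\<theta> j = 0" for j x y
    using block_upper[OF that(1-4), of 0] that(5) by simp
  have gap_mono: "D x \<le> D y" if "j < N" "q j \<le> x" "x \<le> y" "y \<le> p (Suc j)" for j x y
  proof -
    have "integral {x..y} f \<le> integral {x..y} (\<lambda>_. 0)"
    proof (rule integral_mono_AE[OF f_int'])
      show "AE t in lebesgue. t \<in> {x..y} \<longrightarrow> f t \<le> 0"
        using f_gap[OF that(1)] by eventually_elim (use that c_nonneg g_nonneg in auto)
    qed auto
    then show ?thesis using D_diff[OF that(3)] by simp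
  qed
  have prev_mono: "D x \<le> D y" if "j < N" "prev_end j \<le> x" "x \<le> y" "y \<le> p j" for j x y
  proof (cases "j = 0")
    case True
    then have "D (x + P) \<le> D (y + P)"
      using that N_pos p_first p_last by (intro gap_mono[of "N - 1"]) (auto simp: prev_end_def)
    then show ?thesis by (simp add: D_per)
  next
    case False
    then show ?thesis using that gap_mono[of "j - 1" x y] by (simp add: prev_end_def less_imp_diff_less)
  qed
  have small_next: "\<exists>t\<in>{q j..p (Suc j)}. u t < r / 2" if j: "j < N" for j
  proof (rule ccontr)
    assume "\<not> ?thesis"
    then have ge: "r / 2 \<le> u t" if "t \<in> {q j..p (Suc j)}" for t using that by force
    \<comment> \<open>Without a dip, \<open>M - u\<close> is nonnegative and concave on the gap, and
      the mass of \<open>c\<close> makes it exceed \<open>M = R + 1\<close> somewhere, where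
      \<open>u\<close> would be negative.\<close>
    have "\<exists>t\<in>{q j..p (Suc j)}. \<delta> * (\<gamma> * integral {q j + \<delta>..p (Suc j) - \<delta>} c) / 2 \<le> M - u t"
    proof (rule concave_max_lower_bound[where D = "\<lambda>t. - D t"])
      show "((\<lambda>t. M - u t) has_real_derivative - D t) (at t)" for t
        using deriv by (auto intro!: derivative_eq_intros)
      show "- D t \<le> - D s" if "q j \<le> s" "s \<le> t" "t \<le> p (Suc j)" for s t
        using gap_mono[OF j that] by simp
      let ?x = "q j + \<delta>" and ?y = "p (Suc j) - \<delta>"
      have xy: "?x \<le> ?y" using \<delta>(3)[OF j] .
      have "integral {?x..?y} f \<le> integral {?x..?y} (\<lambda>t. - (\<gamma> * c t))"
      proof (rule integral_mono_AE[OF f_int'])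
        show "AE t in lebesgue. t \<in> {?x..?y} \<longrightarrow> f t \<le> - (\<gamma> * c t)"
          using f_gap[OF j]
        proof eventually_elim
          case (elim t)
          show ?case
          proof
            assume "t \<in> {?x..?y}"
            then have t: "t \<in> {q j..p (Suc j)}" using \<delta>(1) by auto
            then have "\<gamma> \<le> g (u t)" using ge[OF t] u_bd[of t] by (intro gap(1)) (auto simp: M_def)
            then show "f t \<le> - (\<gamma> * c t)" using elim t c_nonneg[of t] by (simp add: mult_right_mono)
          qed
        qed
      qed (intro integrable_neg integrable_on_mult_right c_int)
      then show "\<gamma> * integral {?x..?y} c \<le> - D ?x - - D ?y"
        using D_diff[OF xy] by simp
    qed (use u_bd \<delta> j in auto)
    then obtain t where "\<delta> * (\<gamma> * integral {q j + \<delta>..p (Suc j) - \<delta>} c) / 2 \<le> M - u t" by blast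
    then show False using gap(3)[OF j] u_bd[of t] unfolding M_def by linarith
  qed
  have small_prev: "\<exists>t\<in>{prev_end j..p j}. u t < r / 2" if j: "j < N" for j
  proof (cases "j = 0")
    case True
    obtain t where t: "t \<in> {q (N - 1)..p N}" "u t < r / 2" using small_next[of "N - 1"] N_pos by auto
    then show ?thesis
      using True p_first p_last u_per[of "t - P"] by (intro bexI[of _ "t - P"]) (auto simp: prev_end_def)
  next
    case False
    then show ?thesis using small_next[of "j - 1"] j by (simp add: prev_end_def less_imp_diff_less)
  qed
  have u_cont: "continuous_on S u" for S using deriv by (meson DERIV_continuous_on has_field_derivative_at_within)
  have sup_upper: "u t \<le> block_sup j u" if "t \<in> {p j..q j}" for j t
    using block_sup_upper[OF that, of u M] u_bd by blast
  have sup_attained: "\<exists>t\<in>{p j..q j}. u t = block_sup j u" if j: "j < N" for j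
  proof -
    obtain t where t: "t \<in> {p j..q j}" "\<And>x. x \<in> {p j..q j} \<Longrightarrow> u x \<le> u t"
      using continuous_attains_sup[OF compact_Icc _ u_cont, of "p j" "q j"] p_less_q[OF j] by force
    have "block_sup j u \<le> u t"
      unfolding block_sup_def by (rule cSUP_least) (use t p_less_q[OF j] in auto)
    then show ?thesis using sup_upper[OF t(1)] t(1) by force
  qed
  have sup_le: "block_sup j u \<le> s j" if j: "j < N" for j
  proof (rule ccontr)
    assume contra: "\<not> ?thesis"
    \<comment> \<open>A supremum above the target forces the multiplier to 0. Then \<open>u\<close>
      is convex from a dip before the block to a dip after it, and stays at most
      \<open>r / 2\<close> in between.\<close>
    then have \<theta>0: "\<theta> j = 0" using \<theta>_fix[OF j] box[OF j] by (auto simp: real_clamp_def)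
    obtain x y where x: "x \<in> {prev_end j..p j}" "u x < r / 2" and y: "y \<in> {q j..p (Suc j)}" "u y < r / 2"
      using small_prev[OF j] small_next[OF j] by blast
    have mono: "D s \<le> D t" if "x \<le> s" "s \<le> t" "t \<le> y" for s t
    proof -
      have 1: "D s \<le> D t" if "s \<le> t" "x \<le> s" "t \<le> p j" for s t using prev_mono[OF j] that x by auto
      have 2: "D s \<le> D t" if "s \<le> t" "p j \<le> s" "t \<le> q j" for s t using block_const[OF j] that \<theta>0 by auto
      have 3: "D s \<le> D t" if "s \<le> t" "q j \<le> s" "t \<le> y" for s t using gap_mono[OF j] that y by auto
      \<comment> \<open>Projecting \<open>p j\<close> and \<open>q j\<close> onto
        \<open>{s..t}\<close> splits this interval into its parts before, in and after the block,
        some possibly degenerate.\<close>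
      have "D s \<le> D (max s (min t (p j)))" using 1[of s "max s (min t (p j))"] that by (cases "s \<le> p j") auto
      also have "\<dots> \<le> D (max s (min t (q j)))"
        using 2[of "max s (min t (p j))" "max s (min t (q j))"] that p_less_q[OF j]
        by (cases "p j \<le> t \<and> s \<le> q j") (auto simp: max_def min_def)
      also have "\<dots> \<le> D t" using 3[of "max s (min t (q j))" t] that by (cases "q j \<le> t") auto
      finally show ?thesis .
    qed
    have "u t \<le> r / 2" if "t \<in> {p j..q j}" for t
      by (rule convex_le_endpoints[of x y u D]) (use deriv mono x y that in auto)
    then have "block_sup j u \<le> r / 2"
      using sup_attained[OF j] by force
    then show False using contra s_pos[OF j] rad by linarith
  qed
  \<comment> \<open>Between two dips the maximum of \<open>u\<close> must lie in the block, since
    \<open>u\<close> is convex on the gaps. There \<open>D\<close> vanishes, so going back the slope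
    is at most the source mass \<open>C * Bt\<close>, and earlier in the gap it is no
    larger.\<close>
  have slope: False
    if j: "j < N" and v: "block_sup j u = v" "s j = v" "\<theta> j \<le> 1" and C: "\<And>x. x \<in> {0..v} \<Longrightarrow> g x \<le> C"
      "2 * \<Lambda> * (C * Bt) < v" for j v C
  proof -
    have rv: "r \<le> v" using s_pos[OF j] v by simp
    obtain x y where x: "x \<in> {prev_end j..p j}" "u x < r / 2" and y: "y \<in> {q j..p (Suc j)}" "u y < r / 2"
      using small_prev[OF j] small_next[OF j] by blast
    obtain t0 where t0: "t0 \<in> {p j..q j}" "u t0 = v" using sup_attained[OF j] v by auto
    obtain t where t: "t \<in> {x..y}" "\<And>z. z \<in> {x..y} \<Longrightarrow> u z \<le> u t"
      using continuous_attains_sup[OF compact_Icc _ u_cont, of x y] x y p_less_q[OF j] by force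
    have vt: "v \<le> u t" using t(2)[of t0] t0 x y by auto
    have txy: "x < t" "t < y"
      using t(1) vt x(2) y(2) rv rad by (cases "t = x"; cases "t = y"; force)+
    have D0: "D t = 0"
    proof (rule DERIV_local_max[OF deriv])
      show "0 < min (t - x) (y - t)" using txy by simp
      show "\<forall>z. \<bar>t - z\<bar> < min (t - x) (y - t) \<longrightarrow> u z \<le> u t" using t(2) by (auto simp: abs_less_iff)
    qed
    \<comment> \<open>In the gap after the block, \<open>D t = 0\<close> and convexity would keep
      \<open>u\<close> from descending to the dip at \<open>y\<close>; the gap before the block is
      excluded symmetrically.\<close>
    have "t \<le> q j"
    proof (rule ccontr)
      assume "\<not> t \<le> q j"
      obtain \<xi> where \<xi>: "t < \<xi>" "\<xi> < y" "u y - u t = (y - t) * D \<xi>"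
        using MVT2[of t y u D] deriv txy by blast
      have "0 \<le> D \<xi>" using gap_mono[OF j, of t \<xi>] \<xi> y \<open>\<not> t \<le> q j\<close> D0 by simp
      then have "0 \<le> (y - t) * D \<xi>" using txy by simp
      then show False using \<xi>(3) y(2) vt rv rad by linarith
    qed
    moreover have "p j \<le> t"
    proof (rule ccontr)
      assume "\<not> p j \<le> t"
      obtain \<xi> where \<xi>: "x < \<xi>" "\<xi> < t" "u t - u x = (t - x) * D \<xi>"
        using MVT2[of x t u D] deriv txy by blast
      have "D \<xi> \<le> 0" using prev_mono[OF j, of \<xi> t] \<xi> x \<open>\<not> p j \<le> t\<close> D0 by simp
      then have "(t - x) * D \<xi> \<le> 0" using txy by (simp add: mult_nonneg_nonpos)
      then show False using \<xi>(3) x(2) vt rv rad by linarith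
    qed
    ultimately have tb: "t \<in> {p j..q j}" by simp
    have C0: "0 \<le> C" using C(1)[of 0] g_nonneg[of 0] rv rad by auto
    have wC: "\<theta> j * g (w j z) \<le> C" if "z \<in> {p j..q j}" for z
    proof -
      have "w j z \<in> {0..v}" using sup_upper[OF that] \<kappa>s[OF j] u_bd[of z] v rv rad by (auto simp: w_def)
      then have "g (w j z) \<le> C" by (rule C(1))
      then show ?thesis using mult_mono[of "\<theta> j" 1 "g (w j z)" C] v(3) g_nonneg C0 by simp
    qed
    obtain \<xi> where \<xi>: "x < \<xi>" "\<xi> < t" "u t - u x = (t - x) * D \<xi>"
      using MVT2[of x t u D] deriv txy by blast
    have "D \<xi> \<le> D (max \<xi> (p j))" using prev_mono[OF j, of \<xi> "p j"] \<xi> x by (auto simp: max_def)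
    also have "\<dots> \<le> C * Bt"
      using block_upper[OF j _ _ _ C0 wC, of "max \<xi> (p j)" t] tb \<xi> D0 by auto
    finally have D\<xi>: "D \<xi> \<le> C * Bt" .
    have "0 \<le> integral {p j..q j} b" by (rule integral_nonneg) (use b_int b_nonneg in auto)
    then have CB: "0 \<le> C * Bt" using C0 Bt[OF j] by simp
    have "(t - x) * D \<xi> \<le> (t - x) * (C * Bt)" using D\<xi> txy by (intro mult_left_mono) auto
    also have "\<dots> \<le> \<Lambda> * (C * Bt)" using CB tb x \<Lambda>[OF j] by (intro mult_right_mono) auto
    finally show False using \<xi>(3) vt x(2) rv C(2) by linarith
  qed
  have inner: "\<exists>t\<in>{p j..q j}. \<delta> * (K * \<omega>) / 2 \<le> u t"
    if j: "j < N" and K: "0 \<le> K" "\<And>t. t \<in> {p j + \<delta>..q j - \<delta>} \<Longrightarrow> K \<le> \<theta> j * g (w j t)" for j K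
  proof (rule concave_max_lower_bound[where D = D])
    have "K * \<omega> \<le> K * integral {p j + \<delta>..q j - \<delta>} b" using \<omega>(2)[OF j] K(1) by (rule mult_left_mono)
    also have "\<dots> \<le> D (p j + \<delta>) - D (q j - \<delta>)"
      using \<delta> j K(2) by (intro block_lower[of j]) auto
    finally show "K * \<omega> \<le> D (p j + \<delta>) - D (q j - \<delta>)" .
  qed (use deriv block_anti[OF j] u_bd \<delta> j in auto)
  have sup_eq: "block_sup j u = s j" if j: "j < N" and "st j \<noteq> 0" for j
  proof (rule ccontr)
    assume "block_sup j u \<noteq> s j"
    then have less: "block_sup j u < s j" using sup_le[OF j] by simp
    \<comment> \<open>As long as the supremum is below the target the multiplier is pushed upwards,
      hence rests at its cap. The floor keeps \<open>g\<close> at least \<open>\<gamma>'\<close> on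
      the trimmed block, so the choice of \<open>Th0\<close> applies.\<close>
    then have "\<theta> j = Th0" using \<theta>_fix[OF j] box[OF j] \<open>st j \<noteq> 0\<close> by (auto simp: real_clamp_def Th_def)
    have "\<exists>t\<in>{p j..q j}. \<delta> * (Th0 * \<gamma>' * \<omega>) / 2 \<le> u t"
    proof (rule inner[OF j])
      show "0 \<le> Th0 * \<gamma>'" using Th0 \<gamma>' by simp
      fix t assume t: "t \<in> {p j + \<delta>..q j - \<delta>}"
      have "w j t \<in> {\<kappa>0 * r..M}"
      proof -
        have "w j t = max (u t) (\<kappa>0 * s j)" using t \<open>st j \<noteq> 0\<close> by (simp add: w_def \<kappa>_def)
        moreover have "\<kappa>0 * r \<le> \<kappa>0 * s j" using s_pos[OF j] \<kappa>0 by (intro mult_left_mono) auto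
        moreover have "\<kappa>0 * s j \<le> M"
          using \<kappa>s(2)[OF j] s_pos(3)[OF j] \<open>st j \<noteq> 0\<close> by (simp add: \<kappa>_def M_def)
        ultimately show ?thesis using u_bd[of t] unfolding atLeastAtMost_iff by linarith
      qed
      then show "Th0 * \<gamma>' \<le> \<theta> j * g (w j t)"
        using \<gamma>'(2) Th0(1) \<open>\<theta> j = Th0\<close> by (auto intro!: mult_left_mono)
    qed
    then obtain t where t: "t \<in> {p j..q j}" "\<delta> * (Th0 * \<gamma>' * \<omega>) / 2 \<le> u t" by blast
    then show False using Th0(2) sup_upper[OF t(1)] less s_pos[OF j] by linarith
  qed
  have at_\<rho>: False if j: "j < N" and "st j \<noteq> 0" "s j = \<rho>" "1 \<le> \<theta> j" for j
  proof -
    have sup: "block_sup j u = \<rho>" using sup_eq[OF j] that by simp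
    have "\<exists>t\<in>{p j..q j}. \<delta> * (\<gamma>\<rho> * \<omega>) / 2 \<le> u t"
    proof (rule inner[OF j mid(2)])
      fix t assume t: "t \<in> {p j + \<delta>..q j - \<delta>}"
      then have "t \<in> {p j..q j}" using \<delta>(1) by auto
      \<comment> \<open>The lower end is the floor at target height \<open>\<rho>\<close>, so the
        estimate holds before the floor is known to be inactive.\<close>
      then have "w j t \<in> {\<rho> * (\<delta> / \<Lambda>)..\<rho>}"
        using t sup_upper[of t j] sup \<kappa>s[OF j] that
        by (auto simp: w_def \<kappa>_def \<kappa>0_def[symmetric] mult.commute)
      then have "\<gamma>\<rho> \<le> g (w j t)" by (rule mid(1))
      then show "\<gamma>\<rho> \<le> \<theta> j * g (w j t)"
        using mult_mono[of 1 "\<theta> j" \<gamma>\<rho> "g (w j t)"] \<open>1 \<le> \<theta> j\<close> mid(2) by simp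
    qed
    then obtain t where t: "t \<in> {p j..q j}" "\<delta> * (\<gamma>\<rho> * \<omega>) / 2 \<le> u t" by blast
    then show False using mid(3) sup_upper[OF t(1)] sup by linarith
  qed
  have final: "\<theta> j = 1 \<and> (st j = 0 \<longrightarrow> block_sup j u < r) \<and> (st j = 1 \<longrightarrow> r < block_sup j u \<and> block_sup j u < \<rho>)
       \<and> (st j = 2 \<longrightarrow> \<rho> < block_sup j u \<and> block_sup j u < R)" if j: "j < N" for j
  proof -
    consider "st j = 0" | "st j = 1" | "st j = 2" using st[OF j] by auto
    then show ?thesis
    proof cases
      case 1
      then have sr: "s j = r" "\<theta> j \<le> 1" using box[OF j] by (auto simp: al_def be_def Th_def)
      have "block_sup j u \<noteq> r" using slope[OF j _ sr slope_r] by blast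
      then have "block_sup j u < r" using sup_le[OF j] sr by simp
      \<comment> \<open>With the supremum strictly below \<open>r\<close> the multiplier is pushed
        upwards and can only rest at its cap, which is 1 for this symbol.\<close>
      moreover have "\<theta> j = 1"
        using \<theta>_fix[OF j] sr box[OF j] 1 \<open>block_sup j u < r\<close> by (auto simp: real_clamp_def Th_def)
      ultimately show ?thesis using 1 by simp
    next
      case 2
      have sup: "block_sup j u = s j" using sup_eq[OF j] 2 by simp
      have fx: "s j = real_clamp r \<rho> (s j + (\<theta> j - 1))" using s_fix[OF j] 2 by (simp add: al_def be_def ep_def)
      have bx: "r \<le> s j" "s j \<le> \<rho>" using box[OF j] 2 by (auto simp: al_def be_def)
      have "s j \<noteq> r"
      proof
        assume "s j = r"
        then have "\<theta> j \<le> 1" using fx rad by (auto simp: real_clamp_def max_def min_def split: if_splits)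
        then show False using slope[OF j _ \<open>s j = r\<close> _ slope_r] sup \<open>s j = r\<close> by simp
      qed
      moreover have "s j \<noteq> \<rho>"
      proof
        assume "s j = \<rho>"
        then have "1 \<le> \<theta> j" using fx rad by (auto simp: real_clamp_def max_def min_def split: if_splits)
        then show False using at_\<rho>[OF j _ \<open>s j = \<rho>\<close>] 2 by simp
      qed
      ultimately have "r < s j" "s j < \<rho>" using bx by auto
      moreover from this have "\<theta> j = 1" using fx by (auto simp: real_clamp_def max_def min_def split: if_splits)
      ultimately show ?thesis using sup 2 by simp
    next
      case 3
      have sup: "block_sup j u = s j" using sup_eq[OF j] 3 by simp
      have fx: "s j = real_clamp \<rho> R (s j + (1 - \<theta> j))" using s_fix[OF j] 3 by (simp add: al_def be_def ep_def)
      have bx: "\<rho> \<le> s j" "s j \<le> R" using box[OF j] 3 by (auto simp: al_def be_def)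
      have "s j \<noteq> R"
      proof
        assume "s j = R"
        then have "\<theta> j \<le> 1" using fx rad by (auto simp: real_clamp_def max_def min_def split: if_splits)
        then show False using slope[OF j _ \<open>s j = R\<close> _ slope_R] sup \<open>s j = R\<close> by simp
      qed
      moreover have "s j \<noteq> \<rho>"
      proof
        assume "s j = \<rho>"
        then have "1 \<le> \<theta> j" using fx rad by (auto simp: real_clamp_def max_def min_def split: if_splits)
        then show False using at_\<rho>[OF j _ \<open>s j = \<rho>\<close>] 3 by simp
      qed
      ultimately have "\<rho> < s j" "s j < R" using bx by auto
      moreover from this have "\<theta> j = 1" using fx by (auto simp: real_clamp_def max_def min_def split: if_splits)
      ultimately show ?thesis using sup 3 by simp
    qed
  qed
  have f_eq: "f t = (b t - c t) * g (u t)" for t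
  proof -
    obtain j where j: "j < N" "wrap t \<in> {p j..<p (Suc j)}" using cell_exists[OF wrap_in[of t]] .
    \<comment> \<open>Nothing circular happens here: \<open>u\<close> is concave on the block by the
      sign of the source alone, with the floor still in it.\<close>
    have "inner_floor \<delta> \<kappa> s t \<le> u (wrap t)"
    proof (cases "wrap t \<in> {p j + \<delta>..q j - \<delta>} \<and> st j \<noteq> 0")
      case True
      obtain t0 where t0: "t0 \<in> {p j..q j}" "u t0 = s j" using sup_attained[OF j(1)] sup_eq[OF j(1)] True by auto
      have "u t0 * (\<delta> / \<Lambda>) \<le> u (wrap t)"
        by (rule concave_lower_bound_inside[of "p j" "q j" u D])
          (use deriv block_anti[OF j(1)] u_bd t0 \<delta>(1) True \<Lambda>_block[OF j(1)] in auto)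
      then show ?thesis
        using inner_floor_eq[OF j \<delta>(1)] True t0 by (simp add: \<kappa>_def \<kappa>0_def mult.commute)
    next
      case False
      then show ?thesis using inner_floor_eq[OF j \<delta>(1)] u_bd by (auto simp: \<kappa>_def)
    qed
    then have "max (u (wrap t)) (inner_floor \<delta> \<kappa> s t) = u t" by (simp add: u_wrap)
    then show ?thesis
      using cell_coeff_eq[OF j, of \<theta>] final[OF j(1)] by (simp add: f_def rhs_def u_wrap algebra_simps)
  qed
  show ?thesis
  proof (rule that[of u D])
    show "indefinite_integral (\<lambda>t. - ((b t - c t) * g (u t))) D"
      using D_ind by (simp add: f_def[symmetric] f_eq[abs_def])
    show "(\<lambda>t. (b t - c t) * g (u t)) absolutely_integrable_on {x..y}" for x y
      using f_int by (simp add: f_def[symmetric] f_eq[abs_def])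
  qed (use deriv u_per D_per u_bd final in auto)
qed

end

section \<open>From the integral equation to positive solutions\<close>

text \<open>
  Near a zero of \<open>u\<close>, which is a minimum, \<open>g u \<le> u\<close> and a Gronwall-type estimate
  forces \<open>u\<close> to vanish, so the zero set is open.
\<close>

lemma nonneg_solution_positive:
  fixes u D w g :: "real \<Rightarrow> real"
  assumes deriv: "\<And>t. (u has_real_derivative D t) (at t)"
    and D: "indefinite_integral (\<lambda>t. - (w t * g (u t))) D"
    and w: "\<And>x y. w absolutely_integrable_on {x..y}"
    and nonneg: "\<And>t. 0 \<le> u t" and g_nonneg: "\<And>x. 0 \<le> x \<Longrightarrow> 0 \<le> g x"
    and x0: "0 < x0" "\<And>x. 0 \<le> x \<Longrightarrow> x < x0 \<Longrightarrow> g x \<le> x"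
    and t1: "0 < u t1"
  shows "0 < u t"
proof -
  have cont: "continuous_on S u" for S
    using deriv by (meson DERIV_continuous_on has_field_derivative_at_within)
  define Z where "Z = {t. u t = 0}"
  have "closed Z"
    unfolding Z_def by (rule closed_Collect_eq) (auto intro: cont continuous_on_const)
  moreover have "open Z"
    unfolding open_dist
  proof
    fix t0 assume "t0 \<in> Z"
    then have u0: "u t0 = 0" by (simp add: Z_def)
    have D0: "D t0 = 0"
      by (rule DERIV_local_min[OF deriv zero_less_one]) (simp add: u0 nonneg)
    obtain e where e: "0 < e" "\<And>t. dist t t0 < e \<Longrightarrow> u t < x0"
    proof -
      have "isCont u t0" using deriv by (rule DERIV_isCont)
      then obtain e where "e > 0" "\<And>t. dist t t0 < e \<Longrightarrow> dist (u t) (u t0) < x0"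
        using x0(1) by (metis continuous_at_eps_delta)
      then show ?thesis using that[of e] u0 nonneg by (auto simp: dist_real_def)
    qed
    have abs_w: "(\<lambda>t. \<bar>w t\<bar>) integrable_on {x..y}" for x y
      using w[of x y] by (auto simp: absolutely_integrable_on_def)
    define K where "K = integral {t0 - 1..t0 + 1} (\<lambda>t. \<bar>w t\<bar>)"
    have K: "0 \<le> K" unfolding K_def by (rule integral_nonneg) (auto intro: abs_w)
    \<comment> \<open>The first entry gives \<open>\<eta> * K < 1\<close>, which closes the estimate
      \<open>u s \<le> \<eta> * K * u s\<close> for the maximum on \<open>J\<close>; the others keep
      \<open>J\<close> inside the interval defining \<open>K\<close> and \<open>u\<close> below
      \<open>x0\<close> on \<open>J\<close>.\<close>
    define \<eta> where "\<eta> = min (1 / (2 * (K + 1))) (min 1 (e / 2))"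
    have \<eta>: "0 < \<eta>" "\<eta> \<le> 1" "\<eta> < e" "\<eta> * K < 1"
    proof -
      show "0 < \<eta>" "\<eta> \<le> 1" "\<eta> < e" using K e by (auto simp: \<eta>_def)
      have "\<eta> * K \<le> 1 / (2 * (K + 1)) * K" using K by (intro mult_right_mono) (auto simp: \<eta>_def)
      also have "\<dots> < 1" using K by (simp add: field_simps)
      finally show "\<eta> * K < 1" .
    qed
    define J where "J = {t0 - \<eta>..t0 + \<eta>}"
    obtain s where s: "s \<in> J" "\<And>x. x \<in> J \<Longrightarrow> u x \<le> u s"
      using continuous_attains_sup[OF compact_Icc _ cont, of "t0 - \<eta>" "t0 + \<eta>"] \<eta> unfolding J_def by force
    have bound: "\<bar>integral {x..y} (\<lambda>t. - (w t * g (u t)))\<bar> \<le> u s * K"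
      if "x \<in> J" "y \<in> J" "x \<le> y" for x y
    proof -
      have "norm (integral {x..y} (\<lambda>t. - (w t * g (u t)))) \<le> integral {x..y} (\<lambda>t. u s * \<bar>w t\<bar>)"
      proof (rule integral_norm_bound_integral)
        fix t assume "t \<in> {x..y}"
        then have tJ: "t \<in> J" using that by (auto simp: J_def)
        then have "u t < x0" using \<eta> by (intro e(2)) (auto simp: J_def dist_real_def)
        then have "g (u t) \<le> u s" using x0(2)[of "u t"] nonneg[of t] s(2)[OF tJ] by linarith
        then show "norm (- (w t * g (u t))) \<le> u s * \<bar>w t\<bar>"
          using g_nonneg[OF nonneg[of t]] mult_right_mono[of "g (u t)" "u s" "\<bar>w t\<bar>"]
          by (simp add: abs_mult mult.commute[of "\<bar>w t\<bar>"])
      qed (auto intro: indefinite_integral_integrable[OF D] integrable_on_mult_right abs_w)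
      also have "\<dots> = u s * integral {x..y} (\<lambda>t. \<bar>w t\<bar>)" by simp
      also have "\<dots> \<le> u s * K"
        unfolding K_def using that \<eta> nonneg
        by (intro mult_left_mono integral_subset_le abs_w) (auto simp: J_def)
      finally show ?thesis by simp
    qed
    have t0J: "t0 \<in> J" using \<eta> by (simp add: J_def)
    have D_bound: "\<bar>D x\<bar> \<le> u s * K" if "x \<in> J" for x
    proof (cases "t0 \<le> x")
      case True
      then show ?thesis using bound[OF t0J that True] indefinite_integral_diff[OF D True] D0 by simp
    next
      case False
      then have "x \<le> t0" by simp
      then show ?thesis using bound[OF that t0J] indefinite_integral_diff[OF D \<open>x \<le> t0\<close>] D0 by simp
    qed
    have "\<exists>\<xi>\<in>J. u s = (s - t0) * D \<xi>"
    proof -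
      consider "s = t0" | "t0 < s" | "s < t0" by linarith
      then show ?thesis
      proof cases
        case 1
        then show ?thesis using t0J u0 by auto
      next
        case 2
        obtain \<xi> where "t0 < \<xi>" "\<xi> < s" "u s - u t0 = (s - t0) * D \<xi>"
          using MVT2[of t0 s u D] deriv 2 by blast
        then show ?thesis using s(1) t0J u0 by (intro bexI[of _ \<xi>]) (auto simp: J_def)
      next
        case 3
        obtain \<xi> where "s < \<xi>" "\<xi> < t0" "u t0 - u s = (t0 - s) * D \<xi>"
          using MVT2[of s t0 u D] deriv 3 by blast
        then show ?thesis using s(1) t0J u0 by (intro bexI[of _ \<xi>]) (auto simp: J_def algebra_simps)
      qed
    qed
    then obtain \<xi> where \<xi>: "\<xi> \<in> J" "u s = (s - t0) * D \<xi>" by blast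
    have "u s \<le> \<bar>s - t0\<bar> * \<bar>D \<xi>\<bar>" using \<xi>(2) by (metis abs_ge_self abs_mult)
    also have "\<dots> \<le> \<eta> * (u s * K)"
      using s(1) D_bound[OF \<xi>(1)] \<eta> by (intro mult_mono) (auto simp: J_def)
    finally have "u s * (1 - \<eta> * K) \<le> 0" by (simp add: algebra_simps)
    then have "u s \<le> 0" using \<eta>(4) by (simp add: mult_le_0_iff)
    then have "u x = 0" if "x \<in> J" for x using s(2)[OF that] nonneg[of x] by simp
    then show "\<exists>e>0. \<forall>y. dist y t0 < e \<longrightarrow> y \<in> Z"
      using \<eta>(1) by (intro exI[of _ \<eta>]) (auto simp: Z_def J_def dist_real_def abs_less_iff)
  qed
  ultimately have "Z = {} \<or> Z = UNIV" using clopen by blast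
  moreover have "t1 \<notin> Z" using t1 by (simp add: Z_def)
  ultimately have "Z = {}" by blast
  then have "u t \<noteq> 0" by (auto simp: Z_def)
  then show ?thesis using nonneg[of t] by simp
qed

lemma caratheodory_solutionI:
  assumes deriv: "\<And>t. (u has_real_derivative D t) (at t)"
    and D: "indefinite_integral (\<lambda>t. - (w t * g (u t))) D"
    and int: "\<And>x y. (\<lambda>t. w t * g (u t)) absolutely_integrable_on {x..y}"
  shows "caratheodory_solution w g u"
proof -
  have d: "deriv u = D" using deriv by (auto intro: DERIV_imp_deriv)
  have "(\<lambda>t. - (w t * g (u t))) absolutely_integrable_on {x..y}" for x y
    using int[of x y] by (simp add: absolutely_integrable_on_def integrable_neg_iff)
  then have ac: "locally_abs_continuous D"
    by (rule locally_abs_continuous_indefinite_integral[OF D])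
  have "AE t in lebesgue. D differentiable (at t) \<and> deriv D t + w t * g (u t) = 0"
    using indefinite_integral_AE_derivative[OF D]
    by eventually_elim (auto simp: real_differentiable_def dest: DERIV_imp_deriv)
  then show ?thesis
    unfolding caratheodory_solution_def d
    using ac continuous_indefinite_integral[OF D] deriv by (auto simp: real_differentiable_def)
qed

lemma AE_shift_interval:
  fixes a :: "real \<Rightarrow> 'b"
  assumes ae: "AE t in lebesgue. t \<in> {x..y} \<longrightarrow> Q (a t)" and per: "\<And>t. a (t + c) = a t"
  shows "AE t in lebesgue. t \<in> {x + c..y + c} \<longrightarrow> Q (a t)"
proof -
  obtain E where E: "E \<in> null_sets lebesgue" "{t. \<not> (t \<in> {x..y} \<longrightarrow> Q (a t))} \<subseteq> E"
    using ae by (auto simp: eventually_ae_filter)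
  then have "negligible ((+) c ` E)" by (intro negligible_translation) (simp add: negligible_iff_null_sets)
  moreover have "{t. \<not> (t \<in> {x + c..y + c} \<longrightarrow> Q (a t))} \<subseteq> (+) c ` E"
  proof
    fix t assume "t \<in> {t. \<not> (t \<in> {x + c..y + c} \<longrightarrow> Q (a t))}"
    then have "t - c \<in> E" using E(2) per[of "t - c"] by auto
    then show "t \<in> (+) c ` E" by (intro image_eqI[of _ _ "t - c"]) auto
  qed
  ultimately show ?thesis
    by (intro AE_I'[of "(+) c ` E"]) (auto simp: negligible_iff_null_sets)
qed

text \<open>A nonnegative function that is not almost everywhere zero has positive integral, and by
  continuity of its primitive a slight trimming at both ends keeps it positive. The trimmed margins
  serve as the collars in the concavity estimate.\<close>

lemma integral_pos_inside:
  fixes w :: "real \<Rightarrow> real"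
  assumes xy: "x < y" and int: "\<And>x y. w integrable_on {x..y}" and nonneg: "\<And>t. 0 \<le> w t"
    and nz: "\<not> (AE t in lebesgue. t \<in> {x..y} \<longrightarrow> w t = 0)"
  shows "\<exists>\<delta>>0. x + \<delta> \<le> y - \<delta> \<and> 0 < integral {x + \<delta>..y - \<delta>} w"
proof -
  have abs: "w absolutely_integrable_on {x..y}"
    using int nonneg by (intro nonnegative_absolutely_integrable_1) auto
  have "integral {x..y} w \<noteq> 0"
  proof
    assume "integral {x..y} w = 0"
    then have "(LINT t|lebesgue. indicat_real {x..y} t *\<^sub>R w t) = 0"
      using set_lebesgue_integral_eq_integral(2)[OF abs] by (simp add: set_lebesgue_integral_def)
    moreover have "integrable lebesgue (\<lambda>t. indicat_real {x..y} t *\<^sub>R w t)"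
      using abs by (simp add: set_integrable_def)
    ultimately have "AE t in lebesgue. indicat_real {x..y} t *\<^sub>R w t = 0"
      by (subst integral_nonneg_eq_0_iff_AE[symmetric]) (auto simp: nonneg)
    then have "AE t in lebesgue. t \<in> {x..y} \<longrightarrow> w t = 0" by (rule eventually_mono) (auto simp: indicator_def split: if_splits)
    then show False using nz by blast
  qed
  moreover have "0 \<le> integral {x..y} w" using int nonneg by (intro integral_nonneg) auto
  ultimately have pos: "0 < integral {x..y} w" by simp
  obtain F where F: "indefinite_integral w F" using indefinite_integral_exists[OF int] by metis
  have "continuous_on UNIV F" by (rule continuous_indefinite_integral[OF F])
  then have Fc: "isCont F t" for t by (simp add: continuous_on_eq_continuous_at)
  have "((\<lambda>d. F (y - d) - F (x + d)) \<longlongrightarrow> F (y - 0) - F (x + 0)) (at 0)"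
  proof (rule tendsto_diff)
    show "((\<lambda>d. F (y - d)) \<longlongrightarrow> F (y - 0)) (at 0)"
      by (rule isCont_tendsto_compose[OF Fc]) (intro tendsto_intros)
    show "((\<lambda>d. F (x + d)) \<longlongrightarrow> F (x + 0)) (at 0)"
      by (rule isCont_tendsto_compose[OF Fc]) (intro tendsto_intros)
  qed
  then have "((\<lambda>d. F (y - d) - F (x + d)) \<longlongrightarrow> F (y - 0) - F (x + 0)) (at_right 0)"
    by (rule tendsto_within_subset) simp
  then have "\<forall>\<^sub>F d in at_right 0. 0 < F (y - d) - F (x + d)"
    using pos indefinite_integral_diff[OF F, of x y] xy by (intro order_tendstoD(1)) auto
  moreover have "\<forall>\<^sub>F d in at_right 0. d < (y - x) / 2" "\<forall>\<^sub>F d::real in at_right 0. 0 < d"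
    using xy by (auto simp: eventually_at_right_field intro!: exI[of _ "(y - x) / 2"])
  ultimately have "\<forall>\<^sub>F d in at_right 0. 0 < F (y - d) - F (x + d) \<and> d < (y - x) / 2 \<and> 0 < d"
    by eventually_elim auto
  then obtain d where "0 < F (y - d) - F (x + d)" "d < (y - x) / 2" "0 < d"
    using eventually_happens trivial_limit_at_right_real by blast
  then show ?thesis
    using indefinite_integral_diff[OF F, of "x + d" "y - d"] by (intro exI[of _ d]) (auto simp: field_simps)
qed

lemma max_on_eq_SUP:
  assumes "continuous_on {x..y} u" "x \<le> y"
  shows "max_on {x..y} u = (SUP t\<in>{x..y}. u t)" "max_on {x..y} u \<in> u ` {x..y}"
proof -
  obtain t where t: "t \<in> {x..y}" "\<And>z. z \<in> {x..y} \<Longrightarrow> u z \<le> u t"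
    using continuous_attains_sup[OF compact_Icc _ assms(1)] assms(2) by force
  have eq: "max_on {x..y} u = u t"
    unfolding max_on_def by (rule Greatest_equality) (use t in auto)
  moreover have "(SUP t\<in>{x..y}. u t) = u t"
    by (rule cSup_eq_maximum) (use t in auto)
  ultimately show "max_on {x..y} u = (SUP t\<in>{x..y}. u t)" by simp
  show "max_on {x..y} u \<in> u ` {x..y}" using eq t by auto
qed

section \<open>Application to the indefinite weight\<close>

text \<open>Minima over the finite family. Every \<open>d\<close> up to \<open>\<delta>\<close> is
  allowed, since less trimming only increases the integrals; this lets the blocks and the gaps share
  one width afterwards.\<close>

lemma integral_uniform_inside:
  fixes w :: "real \<Rightarrow> real" and x y :: "'i \<Rightarrow> real"
  assumes "finite I" and xy: "\<And>i. i \<in> I \<Longrightarrow> x i < y i"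
    and int: "\<And>x y. w integrable_on {x..y}" and nonneg: "\<And>t. 0 \<le> w t"
    and nz: "\<And>i. i \<in> I \<Longrightarrow> \<not> (AE t in lebesgue. t \<in> {x i..y i} \<longrightarrow> w t = 0)"
  obtains \<delta> \<omega> where "0 < \<delta>" "0 < \<omega>"
    "\<And>i d. i \<in> I \<Longrightarrow> 0 < d \<Longrightarrow> d \<le> \<delta> \<Longrightarrow> x i + d \<le> y i - d \<and> \<omega> \<le> integral {x i + d..y i - d} w"
proof -
  have "\<forall>i\<in>I. \<exists>\<delta>>0. x i + \<delta> \<le> y i - \<delta> \<and> 0 < integral {x i + \<delta>..y i - \<delta>} w"
    using integral_pos_inside[OF xy int nonneg nz] by blast
  then obtain d where d: "\<And>i. i \<in> I \<Longrightarrow> 0 < d i \<and> x i + d i \<le> y i - d i \<and> 0 < integral {x i + d i..y i - d i} w"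
    by metis
  define \<delta> where "\<delta> = Min (insert 1 (d ` I))"
  define \<omega> where "\<omega> = Min (insert 1 ((\<lambda>i. integral {x i + d i..y i - d i} w) ` I))"
  show ?thesis
  proof (rule that[of \<delta> \<omega>])
    show "0 < \<delta>" "0 < \<omega>" using d \<open>finite I\<close> by (auto simp: \<delta>_def \<omega>_def)
    fix i e assume i: "i \<in> I" and e: "0 < e" "e \<le> \<delta>"
    have "\<delta> \<le> d i" unfolding \<delta>_def using i \<open>finite I\<close> by (intro Min_le) auto
    then have "e \<le> d i" using e by simp
    have "\<omega> \<le> integral {x i + d i..y i - d i} w"
      unfolding \<omega>_def using i \<open>finite I\<close> by (intro Min_le) auto
    also have "\<dots> \<le> integral {x i + e..y i - e} w"
      using \<open>e \<le> d i\<close> int nonneg by (intro integral_subset_le) auto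
    finally show "x i + e \<le> y i - e \<and> \<omega> \<le> integral {x i + e..y i - e} w"
      using d[OF i] \<open>e \<le> d i\<close> by linarith
  qed
qed

locale indefinite_weight =
  fixes g a :: "real \<Rightarrow> real" and T :: real and m :: nat and \<sigma> \<tau> :: "nat \<Rightarrow> real"
  assumes g_cont: "continuous_on {0..} g"
    and g_zero: "g 0 = 0"
    and g_pos: "\<And>s. 0 < s \<Longrightarrow> 0 < g s"
    and g_lim_zero: "((\<lambda>s. g s / s) \<longlongrightarrow> 0) (at_right 0)"
    and g_lim_infinity: "((\<lambda>s. g s / s) \<longlongrightarrow> 0) at_top"
    and a_loc_int: "locally_integrable a"
    and T_pos: "0 < T" and a_per: "a (t + T) = a t"
    and m_pos: "1 \<le> m"
    and points: "\<And>i. i \<in> {1..m} \<Longrightarrow> \<sigma> i < \<tau> i \<and> \<tau> i < \<sigma> (i + 1)"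
    and points_period: "\<sigma> (m + 1) - \<sigma> 1 = T"
    and a_pos: "\<And>i. i \<in> {1..m} \<Longrightarrow> succ_zero_on {\<sigma> i..\<tau> i} a"
    and a_neg: "\<And>i. i \<in> {1..m} \<Longrightarrow> prec_zero_on {\<tau> i..\<sigma> (i + 1)} a"
begin

definition ap :: "real \<Rightarrow> real" where "ap t = pos_part (a t)"
definition an :: "real \<Rightarrow> real" where "an t = neg_part (a t)"

lemma ap_nonneg: "0 \<le> ap t" and an_nonneg: "0 \<le> an t"
  by (auto simp: ap_def an_def pos_part_def neg_part_def)

lemma a_abs_int: "a absolutely_integrable_on {x..y}"
  using a_loc_int by (simp add: locally_integrable_def)

lemma ap_int: "ap integrable_on {x..y}"
proof -
  have "(\<lambda>t. max (a t) 0) absolutely_integrable_on {x..y}"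
    using a_abs_int by (intro absolutely_integrable_max_1) auto
  then show ?thesis unfolding ap_def[abs_def] pos_part_def by (rule set_lebesgue_integral_eq_integral(1))
qed

lemma an_int: "an integrable_on {x..y}"
proof -
  have "(\<lambda>t. - a t) absolutely_integrable_on {x..y}"
    using a_abs_int[of x y] by (simp add: absolutely_integrable_on_def integrable_neg_iff)
  then have "(\<lambda>t. max (- a t) 0) absolutely_integrable_on {x..y}"
    by (intro absolutely_integrable_max_1) auto
  then show ?thesis unfolding an_def[abs_def] neg_part_def by (rule set_lebesgue_integral_eq_integral(1))
qed

lemma a_shift: "a (t + real n * T) = a t"
proof (induction n arbitrary: t)
  case (Suc n)
  have "a (t + real (Suc n) * T) = a ((t + real n * T) + T)" by (simp add: algebra_simps)
  then show ?case using a_per Suc by simp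
qed simp

lemma an_zero: "i \<in> {1..m} \<Longrightarrow> AE t in lebesgue. t \<in> {\<sigma> i..\<tau> i} \<longrightarrow> an t = 0"
  using a_pos[of i] unfolding succ_zero_on_def
  by (auto elim!: eventually_mono simp: an_def neg_part_def)

lemma ap_zero: "i \<in> {1..m} \<Longrightarrow> AE t in lebesgue. t \<in> {\<tau> i..\<sigma> (i + 1)} \<longrightarrow> ap t = 0"
  using a_neg[of i] unfolding prec_zero_on_def succ_zero_on_def
  by (auto elim!: eventually_mono simp: ap_def pos_part_def)

lemma ap_nonzero:
  assumes "i \<in> {1..m}"
  shows "\<not> (AE t in lebesgue. t \<in> {\<sigma> i..\<tau> i} \<longrightarrow> ap t = 0)"
proof
  assume ae: "AE t in lebesgue. t \<in> {\<sigma> i..\<tau> i} \<longrightarrow> ap t = 0"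
  have ae': "AE t in lebesgue. t \<in> {\<sigma> i..\<tau> i} \<longrightarrow> 0 \<le> a t"
    and nz: "\<not> (AE t in lebesgue. t \<in> {\<sigma> i..\<tau> i} \<longrightarrow> a t = 0)"
    using a_pos[OF assms] by (auto simp: succ_zero_on_def)
  have "AE t in lebesgue. t \<in> {\<sigma> i..\<tau> i} \<longrightarrow> a t = 0"
    using ae ae' by eventually_elim (auto simp: ap_def pos_part_def)
  then show False using nz by blast
qed

lemma an_nonzero:
  assumes "i \<in> {1..m}"
  shows "\<not> (AE t in lebesgue. t \<in> {\<tau> i..\<sigma> (i + 1)} \<longrightarrow> an t = 0)"
proof
  assume ae: "AE t in lebesgue. t \<in> {\<tau> i..\<sigma> (i + 1)} \<longrightarrow> an t = 0"
  have ae': "AE t in lebesgue. t \<in> {\<tau> i..\<sigma> (i + 1)} \<longrightarrow> 0 \<le> - a t"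
    and nz: "\<not> (AE t in lebesgue. t \<in> {\<tau> i..\<sigma> (i + 1)} \<longrightarrow> - a t = 0)"
    using a_neg[OF assms] by (auto simp: prec_zero_on_def succ_zero_on_def)
  have "AE t in lebesgue. t \<in> {\<tau> i..\<sigma> (i + 1)} \<longrightarrow> - a t = 0"
    using ae ae' by eventually_elim (auto simp: an_def neg_part_def)
  then show False using nz by blast
qed

text \<open>One width and one mass bound for all intervals of a single period. Periodicity carries
  them to \<open>k\<close> periods, so whatever is built from them is the same for all
  \<open>k\<close>.\<close>

definition geometry :: "real \<Rightarrow> real \<Rightarrow> bool" where
  "geometry \<delta> \<omega> \<longleftrightarrow> 0 < \<delta> \<and> 0 < \<omega> \<and> (\<forall>i\<in>{1..m}.
     \<sigma> i + \<delta> \<le> \<tau> i - \<delta> \<and> \<omega> \<le> integral {\<sigma> i + \<delta>..\<tau> i - \<delta>} ap \<and>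
     \<tau> i + \<delta> \<le> \<sigma> (i + 1) - \<delta> \<and> \<omega> \<le> integral {\<tau> i + \<delta>..\<sigma> (i + 1) - \<delta>} an)"

lemma geometry_exists: "\<exists>\<delta> \<omega>. geometry \<delta> \<omega>"
proof -
  obtain \<delta>1 \<omega>1 where 1: "0 < \<delta>1" "0 < \<omega>1" "\<And>i d. i \<in> {1..m} \<Longrightarrow> 0 < d \<Longrightarrow> d \<le> \<delta>1 \<Longrightarrow>
      \<sigma> i + d \<le> \<tau> i - d \<and> \<omega>1 \<le> integral {\<sigma> i + d..\<tau> i - d} ap"
    by (rule integral_uniform_inside[of "{1..m}" \<sigma> \<tau> ap])
      (use points ap_int ap_nonneg ap_nonzero in auto)
  obtain \<delta>2 \<omega>2 where 2: "0 < \<delta>2" "0 < \<omega>2" "\<And>i d. i \<in> {1..m} \<Longrightarrow> 0 < d \<Longrightarrow> d \<le> \<delta>2 \<Longrightarrow>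
      \<tau> i + d \<le> \<sigma> (i + 1) - d \<and> \<omega>2 \<le> integral {\<tau> i + d..\<sigma> (i + 1) - d} an"
    by (rule integral_uniform_inside[of "{1..m}" \<tau> "\<lambda>i. \<sigma> (i + 1)" an])
      (use points an_int an_nonneg an_nonzero in auto)
  have "geometry (min \<delta>1 \<delta>2) (min \<omega>1 \<omega>2)"
    unfolding geometry_def using 1(1,2) 2(1,2) 1(3)[of _ "min \<delta>1 \<delta>2"] 2(3)[of _ "min \<delta>1 \<delta>2"]
    by (auto simp: min_le_iff_disj)
  then show ?thesis by blast
qed

section \<open>Unrolling the intervals of one period over \<open>k\<close> periods\<close>

lemma sigma_mono: "1 \<le> i \<Longrightarrow> i \<le> j \<Longrightarrow> j \<le> m + 1 \<Longrightarrow> \<sigma> i \<le> \<sigma> j"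
proof (induction j)
  case (Suc j)
  then show ?case using points[of j] by (cases "i = Suc j") (auto intro: order.trans)
qed simp

lemma tau_bounds: "i \<in> {1..m} \<Longrightarrow> \<sigma> 1 \<le> \<sigma> i \<and> \<sigma> (i + 1) \<le> \<sigma> 1 + T \<and> \<tau> 1 \<le> \<tau> i"
  using sigma_mono[of 1 i] sigma_mono[of "i + 1" "m + 1"] points_period points[of i] points[of 1]
    sigma_mono[of 2 i] by (cases "i = 1") (auto simp: numeral_2_eq_2)

text \<open>A zero-based flattening: block \<open>j\<close> is the interval with index
  \<open>i = j mod m + 1\<close> in period \<open>l = j div m\<close>, so its number is one less
  than the string index \<open>i + l * m\<close>.\<close>

definition block_start :: "nat \<Rightarrow> real" where "block_start j = \<sigma> (j mod m + 1) + real (j div m) * T"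
definition block_end :: "nat \<Rightarrow> real" where "block_end j = \<tau> (j mod m + 1) + real (j div m) * T"

text \<open>Across a period boundary the next block starts at \<open>\<sigma> (m + 1)\<close>, which
  equals \<open>\<sigma> 1 + T\<close>; in this form no case distinction is left.\<close>

lemma block_start_Suc: "block_start (Suc j) = \<sigma> (j mod m + 2) + real (j div m) * T"
proof (cases "Suc (j mod m) = m")
  case True
  then have "block_start (Suc j) = \<sigma> 1 + T + real (j div m) * T"
    by (simp add: block_start_def mod_Suc div_Suc algebra_simps)
  then show ?thesis using points_period True by (metis Suc_eq_plus1 add.commute add_2_eq_Suc' add_diff_cancel_left' diff_add_cancel)
next
  case False
  then show ?thesis by (simp add: block_start_def mod_Suc div_Suc)
qed

lemma mod_in: "j mod m + 1 \<in> {1..m}"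
  using m_pos mod_less_divisor[of m j] by (simp add: Suc_le_eq)

abbreviation "g0 \<equiv> \<lambda>x. g (max 0 x)"

text \<open>The block-dependent quantities are replaced by those of one period: \<open>T\<close> for
  the length of a gap with the following block, and the integral of \<open>ap\<close> over a period
  for the mass of a block. Thus the numerical hypotheses mention neither a block nor
  \<open>k\<close>.\<close>

lemma realise_pattern:
  fixes S :: "nat \<Rightarrow> nat" and k :: nat
  assumes geo: "geometry \<delta> \<omega>" and lam: "0 < lam" and mu: "0 < mu" and k: "1 \<le> k"
    and rad: "0 < r" "r < \<rho>" "\<rho> < R"
    and gap: "\<And>x. x \<in> {r / 2..R + 1} \<Longrightarrow> \<gamma> \<le> g x" "0 < \<gamma>" "R + 1 < \<delta> * (\<gamma> * (mu * \<omega>)) / 2"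
    and slope_r: "\<And>x. x \<in> {0..r} \<Longrightarrow> g x \<le> Cr" "2 * T * (Cr * (lam * integral {\<sigma> 1..\<sigma> 1 + T} ap)) < r"
    and slope_R: "\<And>x. x \<in> {0..R} \<Longrightarrow> g x \<le> CR" "2 * T * (CR * (lam * integral {\<sigma> 1..\<sigma> 1 + T} ap)) < R"
    and mid: "\<And>x. x \<in> {\<rho> * (\<delta> / T)..\<rho>} \<Longrightarrow> \<gamma>\<rho> \<le> g x" "0 < \<gamma>\<rho>" "\<rho> < \<delta> * (\<gamma>\<rho> * (lam * \<omega>)) / 2"
    and S: "S \<in> {1..k * m} \<rightarrow> {0, 1, 2}" "\<exists>j\<in>{1..k * m}. S j \<noteq> 0"
  shows "\<exists>u. positive_periodic_solution (weight a lam mu) g (of_nat k * T) u \<and>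
      (\<forall>i\<in>{1..m}. \<forall>l\<in>{0..k - 1}.
         let M = max_on (shifted_interval T (\<sigma> i) (\<tau> i) (int l)) u; j = i + l * m
         in (S j = 0 \<longrightarrow> M < r) \<and> (S j = 1 \<longrightarrow> r < M \<and> M < \<rho>) \<and> (S j = 2 \<longrightarrow> \<rho> < M \<and> M < R))"
proof -
  have geo': "0 < \<delta>" "0 < \<omega>"
    "\<And>i. i \<in> {1..m} \<Longrightarrow> \<sigma> i + \<delta> \<le> \<tau> i - \<delta> \<and> \<omega> \<le> integral {\<sigma> i + \<delta>..\<tau> i - \<delta>} ap"
    "\<And>i. i \<in> {1..m} \<Longrightarrow> \<tau> i + \<delta> \<le> \<sigma> (i + 1) - \<delta> \<and> \<omega> \<le> integral {\<tau> i + \<delta>..\<sigma> (i + 1) - \<delta>} an"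
    using geo by (auto simp: geometry_def)
  have shift_int: "integral {x + real n * T..y + real n * T} (\<lambda>t. F (a t)) = integral {x..y} (\<lambda>t. F (a t))"
    for x y n and F :: "real \<Rightarrow> real"
  proof -
    have "(\<lambda>t. F (a t)) \<circ> (+) (real n * T) = (\<lambda>t. F (a t))"
      using a_shift by (auto simp: add.commute)
    then show ?thesis using integral_shift_Icc_real[of x y "\<lambda>t. F (a t)" "real n * T"] by simp
  qed
  have ap_shift: "integral {x + real n * T..y + real n * T} ap = integral {x..y} ap"
    and an_shift: "integral {x + real n * T..y + real n * T} an = integral {x..y} an" for x y n
    unfolding ap_def[abs_def] an_def[abs_def] by (rule shift_int)+
  have g0_cont: "continuous_on UNIV g0"
    by (rule continuous_on_compose2[OF g_cont]) (auto intro!: continuous_intros)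
  have g_nonneg: "0 \<le> g x" if "0 \<le> x" for x using g_pos[of x] g_zero that by (cases "x = 0") auto
  interpret B: block_problem g0 "\<lambda>t. lam * ap t" "\<lambda>t. mu * an t" "\<sigma> 1" "real k * T" "k * m" block_start block_end
  proof
    fix j x y t
    show "continuous_on UNIV g0" by (rule g0_cont)
    show "0 \<le> g0 x" by (rule g_nonneg) simp
    show "g0 x = 0" if "x \<le> 0" using that g_zero by (simp add: max_def)
    show "0 < real k * T" using k T_pos by simp
    show "0 \<le> lam * ap t" "0 \<le> mu * an t" using lam mu ap_nonneg an_nonneg by auto
    show "lam * ap (t + real k * T) = lam * ap t" "mu * an (t + real k * T) = mu * an t"
      by (simp_all add: ap_def an_def a_shift)
    show "(\<lambda>t. lam * ap t) integrable_on {x..y}" "(\<lambda>t. mu * an t) integrable_on {x..y}"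
      by (intro integrable_on_mult_right ap_int an_int)+
    show "block_start 0 = \<sigma> 1" by (simp add: block_start_def)
    show "block_start (k * m) = \<sigma> 1 + real k * T" using m_pos by (simp add: block_start_def)
    show "block_start j < block_end j" using points[OF mod_in] by (simp add: block_start_def block_end_def)
    show "block_end j < block_start (Suc j)"
      unfolding block_start_Suc using points[OF mod_in] by (simp add: block_end_def)
    have "AE t in lebesgue. t \<in> {\<tau> (j mod m + 1) + real (j div m) * T..\<sigma> (j mod m + 1 + 1) + real (j div m) * T} \<longrightarrow> ap t = 0"
      using ap_zero[OF mod_in] unfolding ap_def by (rule AE_shift_interval[where Q = "\<lambda>x. pos_part x = 0"]) (rule a_shift)
    then show "AE t in lebesgue. t \<in> {block_end j..block_start (Suc j)} \<longrightarrow> lam * ap t = 0"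
      unfolding block_start_Suc block_end_def by (rule eventually_mono) auto
    have "AE t in lebesgue. t \<in> {\<sigma> (j mod m + 1) + real (j div m) * T..\<tau> (j mod m + 1) + real (j div m) * T} \<longrightarrow> an t = 0"
      using an_zero[OF mod_in] unfolding an_def by (rule AE_shift_interval[where Q = "\<lambda>x. neg_part x = 0"]) (rule a_shift)
    then show "AE t in lebesgue. t \<in> {block_start j..block_end j} \<longrightarrow> mu * an t = 0"
      unfolding block_start_def block_end_def by (rule eventually_mono) auto
  qed
  \<comment> \<open>The ends of consecutive blocks are at most one period apart, with equality when
    \<open>m = 1\<close>.\<close>
  have prev: "block_end j - B.prev_end j \<le> T" for j
  proof (cases "j = 0")
    case True
    have "(k * m - 1) mod m = m - 1" "(k * m - 1) div m = k - 1"
    proof -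
      have eq: "k * m - 1 = (m - 1) + (k - 1) * m" using k m_pos by (cases k) auto
      show "(k * m - 1) mod m = m - 1"
        unfolding eq mod_mult_self1 using m_pos by simp
      have "m \<noteq> 0" using m_pos by simp
      show "(k * m - 1) div m = k - 1"
        unfolding eq div_mult_self1[OF \<open>m \<noteq> 0\<close>] using m_pos by simp
    qed
    then have "block_end (k * m - 1) = \<tau> m + (real k - 1) * T" using m_pos k by (simp add: block_end_def of_nat_diff)
    then have "B.prev_end j = \<tau> m - T" using True by (simp add: B.prev_end_def left_diff_distrib)
    moreover have "block_end j = \<tau> 1" using True by (simp add: block_end_def)
    ultimately show ?thesis using tau_bounds[of m] m_pos by simp
  next
    case False
    then obtain i where i: "j = Suc i" by (cases j) auto
    have pe: "B.prev_end j = \<tau> (i mod m + 1) + real (i div m) * T" using i by (simp add: B.prev_end_def block_end_def)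
    show ?thesis
    proof (cases "Suc (i mod m) = m")
      case True
      then have "block_end j = \<tau> 1 + (real (i div m) + 1) * T" using i by (simp add: block_end_def mod_Suc div_Suc)
      then show ?thesis using pe tau_bounds[OF mod_in[of i]] by (simp add: algebra_simps)
    next
      case False
      then have be: "block_end j = \<tau> (i mod m + 2) + real (i div m) * T" using i by (simp add: block_end_def mod_Suc div_Suc)
      have i2: "i mod m + 2 \<in> {1..m}" using False mod_in[of i] by auto
      show ?thesis
        using pe be tau_bounds[OF mod_in[of i]] tau_bounds[OF i2] points[OF mod_in[of i]] points[OF i2] by linarith
    qed
  qed
  have block_int: "integral {block_start j + \<delta>..block_end j - \<delta>} ap = integral {\<sigma> (j mod m + 1) + \<delta>..\<tau> (j mod m + 1) - \<delta>} ap"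
    and gap_int: "integral {block_end j + \<delta>..block_start (Suc j) - \<delta>} an = integral {\<tau> (j mod m + 1) + \<delta>..\<sigma> (j mod m + 1 + 1) - \<delta>} an"
    and full_int: "integral {block_start j..block_end j} ap = integral {\<sigma> (j mod m + 1)..\<tau> (j mod m + 1)} ap" for j
    unfolding block_start_Suc
    using ap_shift[of "\<sigma> (j mod m + 1) + \<delta>" "j div m" "\<tau> (j mod m + 1) - \<delta>"]
      an_shift[of "\<tau> (j mod m + 1) + \<delta>" "j div m" "\<sigma> (j mod m + 1 + 1) - \<delta>"]
      ap_shift[of "\<sigma> (j mod m + 1)" "j div m" "\<tau> (j mod m + 1)"]
    by (simp_all add: block_start_def block_end_def algebra_simps)
  have inside: "block_start j + \<delta> \<le> block_end j - \<delta>" "block_end j + \<delta> \<le> block_start (Suc j) - \<delta>"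
    "lam * \<omega> \<le> integral {block_start j + \<delta>..block_end j - \<delta>} (\<lambda>t. lam * ap t)" for j
    unfolding block_start_Suc
    using geo'(3)[OF mod_in[of j]] geo'(4)[OF mod_in[of j]] lam block_int[of j]
    by (simp_all add: block_start_def block_end_def)
  obtain u D where
    deriv: "\<And>t. (u has_real_derivative D t) (at t)"
    and D: "indefinite_integral (\<lambda>t. - ((lam * ap t - mu * an t) * g0 (u t))) D"
    and int: "\<And>x y. (\<lambda>t. (lam * ap t - mu * an t) * g0 (u t)) absolutely_integrable_on {x..y}"
    and per: "\<And>t. u (t + real k * T) = u t" and nonneg: "\<And>t. 0 \<le> u t"
    and pattern: "\<And>j. j < k * m \<Longrightarrow> (S (j + 1) = 0 \<longrightarrow> B.block_sup j u < r)
       \<and> (S (j + 1) = 1 \<longrightarrow> r < B.block_sup j u \<and> B.block_sup j u < \<rho>)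
       \<and> (S (j + 1) = 2 \<longrightarrow> \<rho> < B.block_sup j u \<and> B.block_sup j u < R)"
  proof (rule B.pattern_solution[where r = r and \<rho> = \<rho> and R = R and \<delta> = \<delta> and \<Lambda> = T
        and \<omega> = "lam * \<omega>" and Bt = "lam * integral {\<sigma> 1..\<sigma> 1 + T} ap" and \<gamma> = \<gamma> and Cr = Cr and CR = CR
        and \<gamma>\<rho> = \<gamma>\<rho> and st = "\<lambda>j. S (j + 1)"], goal_cases)
    case (11 j)
    then show ?case
      using ap_int ap_nonneg tau_bounds[OF mod_in[of j]] points[OF mod_in[of j]] lam full_int[of j]
      by (auto intro!: integral_subset_le)
  next
    case (14 j)
    have "\<gamma> * (mu * \<omega>) \<le> \<gamma> * (mu * integral {block_end j + \<delta>..block_start (Suc j) - \<delta>} an)"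
      using geo'(4)[OF mod_in[of j]] gap(2) mu gap_int[of j] by (intro mult_left_mono) auto
    then have "\<delta> * (\<gamma> * (mu * \<omega>)) \<le> \<delta> * (\<gamma> * (mu * integral {block_end j + \<delta>..block_start (Suc j) - \<delta>} an))"
      using geo'(1) by (rule mult_left_mono[OF _ less_imp_le])
    then show ?case using gap(3) by simp
  next
    case (22 j)
    then show ?case using S(1) by (auto simp: Pi_iff)
  next
    case (23 u D)
    show ?case by (rule that[of u D]; rule 23; assumption)
  qed (use rad g_pos geo' lam gap slope_r slope_R mid prev inside in auto)
  have g0_u: "g0 (u t) = g (u t)" for t using nonneg by simp
  have weight: "weight a lam mu t = lam * ap t - mu * an t" for t by (simp add: weight_def ap_def an_def)
  have "caratheodory_solution (weight a lam mu) g u"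
    using D int unfolding g0_u weight[symmetric] by (intro caratheodory_solutionI[OF deriv])
  moreover have "periodic (real k * T) u" using per by (simp add: periodic_def)
  moreover have "0 < u t" for t
  proof -
    \<comment> \<open>A nonzero symbol gives a block on which the supremum exceeds \<open>r\<close>;
      this excludes the trivial solution and starts the positivity argument.\<close>
    obtain j where j: "j \<in> {1..k * m}" "S j \<noteq> 0" using S(2) by blast
    then have "S j = 1 \<or> S j = 2" using funcset_mem[OF S(1) j(1)] by auto
    moreover have jk: "j - 1 < k * m" "j - 1 + 1 = j" using j(1) unfolding atLeastAtMost_iff by linarith+
    ultimately have sup: "0 < B.block_sup (j - 1) u" using pattern[OF jk(1)] rad unfolding jk(2) by auto
    have "\<exists>t. 0 < u t"
    proof (rule ccontr)
      assume "\<nexists>t. 0 < u t"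
      then have "B.block_sup (j - 1) u \<le> 0"
        unfolding B.block_sup_def using B.p_less_q[OF jk(1)]
        by (intro cSUP_least) (auto simp: not_less)
      then show False using sup by simp
    qed
    then obtain t1 where t1: "0 < u t1" ..
    have "\<forall>\<^sub>F s in at_right 0. g s / s < 1" using g_lim_zero by (rule order_tendstoD) simp
    then obtain x0 where x0: "0 < x0" "\<And>s. 0 < s \<Longrightarrow> s < x0 \<Longrightarrow> g s / s < 1"
      by (auto simp: eventually_at_right_field)
    have small: "g s \<le> s" if "0 \<le> s" "s < x0" for s
      using x0(2)[of s] that g_zero by (cases "s = 0") (auto simp: field_simps)
    have w_int: "(\<lambda>t. lam * ap t - mu * an t) absolutely_integrable_on {x..y}" for x y
    proof (rule set_integral_diff)
      show "(\<lambda>t. lam * ap t) absolutely_integrable_on {x..y}" "(\<lambda>t. mu * an t) absolutely_integrable_on {x..y}"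
        using lam mu ap_nonneg an_nonneg
        by (auto intro!: nonnegative_absolutely_integrable_1 integrable_on_mult_right ap_int an_int)
    qed
    show ?thesis
      by (rule nonneg_solution_positive[OF deriv _ w_int nonneg g_nonneg x0(1) small t1])
        (use D in \<open>simp_all add: g0_u\<close>)
  qed
  ultimately have "positive_periodic_solution (weight a lam mu) g (real k * T) u"
    by (simp add: positive_periodic_solution_def)
  moreover have "let M = max_on (shifted_interval T (\<sigma> i) (\<tau> i) (int l)) u; j = i + l * m
         in (S j = 0 \<longrightarrow> M < r) \<and> (S j = 1 \<longrightarrow> r < M \<and> M < \<rho>) \<and> (S j = 2 \<longrightarrow> \<rho> < M \<and> M < R)"
    if i: "i \<in> {1..m}" and l: "l \<in> {0..k - 1}" for i l
  proof -
    define j where "j = (i - 1) + l * m"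
    have m0: "m \<noteq> 0" using m_pos by simp
    have jm: "j mod m = i - 1" "j div m = l"
      unfolding j_def mod_mult_self1 div_mult_self1[OF m0] using i by auto
    have "j < m + l * m" using i by (auto simp: j_def)
    also have "\<dots> = Suc l * m" by simp
    also have "\<dots> \<le> k * m" using l k by (intro mult_right_mono) auto
    finally have jk: "j < k * m" .
    have eq: "shifted_interval T (\<sigma> i) (\<tau> i) (int l) = {block_start j..block_end j}"
      using i by (simp add: shifted_interval_def block_start_def block_end_def jm)
    have "max_on {block_start j..block_end j} u = B.block_sup j u"
      unfolding B.block_sup_def using deriv B.p_less_q[OF jk]
      by (intro max_on_eq_SUP) (auto intro: DERIV_continuous_on has_field_derivative_at_within)
    moreover have "i + l * m = j + 1" using i by (simp add: j_def)
    ultimately show ?thesis using pattern[OF jk] by (simp add: Let_def eq)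
  qed
  ultimately show ?thesis by blast
qed

end

section \<open>Choice of the constants\<close>

context indefinite_weight
begin

lemma g_bounded_below:
  assumes "0 < x"
  obtains \<gamma> where "0 < \<gamma>" "\<And>z. z \<in> {x..y} \<Longrightarrow> \<gamma> \<le> g z"
proof (cases "x \<le> y")
  case True
  have "continuous_on {x..y} g" using assms by (intro continuous_on_subset[OF g_cont]) auto
  then obtain w where "w \<in> {x..y}" "\<And>z. z \<in> {x..y} \<Longrightarrow> g w \<le> g z"
    using continuous_attains_inf[of "{x..y}" g] True by auto
  then show ?thesis using that[of "g w"] g_pos[of w] assms by auto
qed (use that[of 1] in auto)

lemma g_small_near_zero:
  assumes "0 < \<eta>" "0 < \<rho>"
  obtains r where "0 < r" "r < \<rho>" "\<And>x. x \<in> {0..r} \<Longrightarrow> g x \<le> \<eta> * r"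
proof -
  have "\<forall>\<^sub>F s in at_right 0. g s / s < \<eta>" using g_lim_zero assms(1) by (rule order_tendstoD)
  then obtain x0 where x0: "0 < x0" "\<And>s. 0 < s \<Longrightarrow> s < x0 \<Longrightarrow> g s / s < \<eta>"
    by (auto simp: eventually_at_right_field)
  define r where "r = min x0 \<rho> / 2"
  have r: "0 < r" "r < \<rho>" "r < x0" using x0(1) assms(2) by (auto simp: r_def)
  have "g x \<le> \<eta> * r" if "x \<in> {0..r}" for x
  proof (cases "x = 0")
    case True
    then show ?thesis using g_zero assms(1) r by simp
  next
    case False
    then have "g x \<le> \<eta> * x" using x0(2)[of x] that r by (simp add: field_simps)
    also have "\<dots> \<le> \<eta> * r" using that assms(1) by simp
    finally show ?thesis .
  qed
  then show ?thesis using that r by blast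
qed

text \<open>The bound is required on all of \<open>{0..R}\<close> and not only near
  \<open>R\<close>, because \<open>u\<close> passes through small values too. Taking
  \<open>R\<close> at least the maximum of \<open>g\<close> on the compact initial part divided by
  \<open>\<eta>\<close> absorbs that part.\<close>

lemma g_small_near_infinity:
  assumes "0 < \<eta>" "0 < \<rho>"
  obtains R where "\<rho> < R" "\<And>x. x \<in> {0..R} \<Longrightarrow> g x \<le> \<eta> * R"
proof -
  have "\<forall>\<^sub>F s in at_top. g s / s < \<eta>" using g_lim_infinity assms(1) by (rule order_tendstoD)
  then obtain X where X: "\<And>s. X \<le> s \<Longrightarrow> g s / s < \<eta>" by (auto simp: eventually_at_top_linorder)
  define X' where "X' = max X 1"
  have "continuous_on {0..X'} g" by (intro continuous_on_subset[OF g_cont]) auto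
  moreover have "{0..X'} \<noteq> {}" by (simp add: X'_def)
  ultimately obtain w where w: "\<And>z. z \<in> {0..X'} \<Longrightarrow> g z \<le> g w"
    using continuous_attains_sup[OF compact_Icc] by metis
  define R where "R = max (\<rho> + 1) (g w / \<eta>)"
  have "g w / \<eta> \<le> R" by (simp add: R_def)
  then have gw: "g w \<le> \<eta> * R" using assms(1) by (simp add: field_simps)
  have "g x \<le> \<eta> * R" if "x \<in> {0..R}" for x
  proof (cases "x \<le> X'")
    case True
    then have "g x \<le> g w" using w that by auto
    then show ?thesis using gw by simp
  next
    case False
    then have "X \<le> x" "0 < x" by (auto simp: X'_def)
    then have "g x \<le> \<eta> * x" using X[of x] by (simp add: field_simps)
    also have "\<dots> \<le> \<eta> * R" using that assms(1) by simp
    finally show ?thesis .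
  qed
  then show ?thesis using that[of R] by (simp add: R_def)
qed

section \<open>Order of the quantifiers and number of solutions\<close>

definition follows_pattern where
  "follows_pattern r \<rho> R k S u \<longleftrightarrow> (\<forall>i\<in>{1..m}. \<forall>l\<in>{0..k - 1}.
     let M = max_on (shifted_interval T (\<sigma> i) (\<tau> i) (int l)) u; j = i + l * m
     in (S j = (0::nat) \<longrightarrow> M < r) \<and> (S j = 1 \<longrightarrow> r < M \<and> M < \<rho>) \<and> (S j = 2 \<longrightarrow> \<rho> < M \<and> M < R))"

definition all_patterns where
  "all_patterns r \<rho> R lam mu k \<longleftrightarrow> (\<forall>S :: nat \<Rightarrow> nat.
     S \<in> {1..k * m} \<rightarrow> {0, 1, 2} \<longrightarrow> (\<exists>j\<in>{1..k * m}. S j \<noteq> 0) \<longrightarrow>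
     (\<exists>u. positive_periodic_solution (weight a lam mu) g (of_nat k * T) u \<and> follows_pattern r \<rho> R k S u))"

lemma all_patterns_realised:
  assumes \<rho>: "0 < \<rho>"
  shows "\<exists>lam0>0. \<forall>lam>lam0. \<exists>r R. 0 < r \<and> r < \<rho> \<and> \<rho> < R \<and>
        (\<exists>mu0>0. \<forall>mu>mu0. \<forall>k::nat. 2 \<le> k \<longrightarrow>
          all_patterns r \<rho> R lam mu k)"
proof -
  obtain \<delta> \<omega> where geo: "geometry \<delta> \<omega>" using geometry_exists by blast
  then have \<delta>: "0 < \<delta>" and \<omega>: "0 < \<omega>" by (auto simp: geometry_def)
  define I where "I = integral {\<sigma> 1..\<sigma> 1 + T} ap"
  have I: "0 \<le> I" unfolding I_def by (rule integral_nonneg[OF ap_int]) (rule ap_nonneg)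
  have "0 < \<rho> * (\<delta> / T)" using \<rho> \<delta> T_pos by simp
  then obtain \<gamma>\<rho> where \<gamma>\<rho>: "0 < \<gamma>\<rho>" "\<And>x. x \<in> {\<rho> * (\<delta> / T)..\<rho>} \<Longrightarrow> \<gamma>\<rho> \<le> g x"
    using g_bounded_below by blast
  \<comment> \<open>The value of \<open>lam\<close> for which the condition \<open>mid\<close> at
    height \<open>\<rho>\<close> becomes an equality.\<close>
  define lam0 where "lam0 = 2 * \<rho> / (\<delta> * \<gamma>\<rho> * \<omega>)"
  have lam0: "0 < lam0" using \<rho> \<delta> \<gamma>\<rho> \<omega> by (simp add: lam0_def)
  have main: "\<exists>r R. 0 < r \<and> r < \<rho> \<and> \<rho> < R \<and>
        (\<exists>mu0>0. \<forall>mu>mu0. \<forall>k::nat. 2 \<le> k \<longrightarrow>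
          all_patterns r \<rho> R lam mu k)" if lam: "lam0 < lam" for lam
  proof -
    have lam_pos: "0 < lam" using lam lam0 by simp
    have mid: "\<rho> < \<delta> * (\<gamma>\<rho> * (lam * \<omega>)) / 2"
      using lam \<delta> \<gamma>\<rho> \<omega> by (simp add: lam0_def field_simps)
    define B where "B = 2 * T * (lam * I)"
    have B: "0 \<le> B" using T_pos lam_pos I by (simp add: B_def)
    \<comment> \<open>With \<open>g \<le> \<eta> * x\<close> up to height \<open>x\<close>, the
      slope condition at that height reads \<open>\<eta> * B * x < x\<close>. It depends on
      \<open>lam\<close>, hence so do \<open>r\<close> and \<open>R\<close>.\<close>
    define \<eta> where "\<eta> = 1 / (B + 1)"
    have \<eta>: "0 < \<eta>" "\<eta> * B < 1" using B by (auto simp: \<eta>_def field_simps)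
    obtain r where r: "0 < r" "r < \<rho>" "\<And>x. x \<in> {0..r} \<Longrightarrow> g x \<le> \<eta> * r"
      using g_small_near_zero[OF \<eta>(1) \<rho>] by blast
    obtain R where R: "\<rho> < R" "\<And>x. x \<in> {0..R} \<Longrightarrow> g x \<le> \<eta> * R"
      using g_small_near_infinity[OF \<eta>(1) \<rho>] by blast
    have slope: "2 * T * (\<eta> * x * (lam * I)) < x" if "0 < x" for x
      using mult_strict_right_mono[OF \<eta>(2) that] by (simp add: B_def mult_ac)
    have "0 < r / 2" using r by simp
    then obtain \<gamma> where \<gamma>: "0 < \<gamma>" "\<And>x. x \<in> {r / 2..R + 1} \<Longrightarrow> \<gamma> \<le> g x"
      using g_bounded_below by blast
    \<comment> \<open>The value of \<open>mu\<close> for which the gap condition becomes an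
      equality. It needs \<open>r\<close> and \<open>R\<close> through \<open>\<gamma>\<close>, so
      it comes last.\<close>
    define mu0 where "mu0 = 2 * (R + 1) / (\<delta> * \<gamma> * \<omega>)"
    have mu0: "0 < mu0" using \<rho> R \<delta> \<gamma> \<omega> by (simp add: mu0_def)
    have "all_patterns r \<rho> R lam mu k" if mu: "mu0 < mu" and k: "2 \<le> k" for mu k
      unfolding all_patterns_def follows_pattern_def
    proof (intro allI impI)
      fix S :: "nat \<Rightarrow> nat"
      assume S: "S \<in> {1..k * m} \<rightarrow> {0, 1, 2}" "\<exists>j\<in>{1..k * m}. S j \<noteq> 0"
      show "\<exists>u. positive_periodic_solution (weight a lam mu) g (of_nat k * T) u \<and>
          (\<forall>i\<in>{1..m}. \<forall>l\<in>{0..k - 1}.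
             let M = max_on (shifted_interval T (\<sigma> i) (\<tau> i) (int l)) u; j = i + l * m
             in (S j = 0 \<longrightarrow> M < r) \<and> (S j = 1 \<longrightarrow> r < M \<and> M < \<rho>) \<and> (S j = 2 \<longrightarrow> \<rho> < M \<and> M < R))"
      proof (rule realise_pattern[OF geo lam_pos _ _ r(1,2) R(1) \<gamma>(2,1) _ r(3) _ R(2) _ \<gamma>\<rho>(2,1) mid S])
      show "0 < mu" using mu mu0 by simp
      show "1 \<le> k" using k by simp
      show "R + 1 < \<delta> * (\<gamma> * (mu * \<omega>)) / 2"
        using mu \<delta> \<gamma> \<omega> by (simp add: mu0_def field_simps)
      qed (use slope[unfolded I_def] r R \<rho> in auto)
    qed
    then show ?thesis using r(1,2) R(1) mu0 by blast
  qed
  show ?thesis using lam0 main by blast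
qed

text \<open>The three ranges allowed for a maximum are disjoint, so a solution determines its
  string. This turns the number of strings into a number of solutions.\<close>

lemma follows_pattern_unique:
  assumes u: "follows_pattern r \<rho> R k S u" "follows_pattern r \<rho> R k S' u" and "r < \<rho>"
    and S: "S \<in> {1..k * m} \<rightarrow> {0, 1, 2}" "S' \<in> {1..k * m} \<rightarrow> {0, 1, 2}" and j: "j \<in> {1..k * m}"
  shows "S j = S' j"
proof -
  define i where "i = (j - 1) mod m + 1"
  define l where "l = (j - 1) div m"
  have ij: "i + l * m = j" using j by (simp add: i_def l_def)
  have "j - 1 < k * m" using j unfolding atLeastAtMost_iff by linarith
  then have "l < k" by (simp add: l_def less_mult_imp_div_less)
  then have l: "l \<in> {0..k - 1}" by auto
  have i: "i \<in> {1..m}" unfolding i_def by (rule mod_in)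
  define M where "M = max_on (shifted_interval T (\<sigma> i) (\<tau> i) (int l)) u"
  have 1: "(S j = 0 \<longrightarrow> M < r) \<and> (S j = 1 \<longrightarrow> r < M \<and> M < \<rho>) \<and> (S j = 2 \<longrightarrow> \<rho> < M \<and> M < R)"
    using u(1) i l unfolding follows_pattern_def Let_def M_def by (metis ij)
  have 2: "(S' j = 0 \<longrightarrow> M < r) \<and> (S' j = 1 \<longrightarrow> r < M \<and> M < \<rho>) \<and> (S' j = 2 \<longrightarrow> \<rho> < M \<and> M < R)"
    using u(2) i l unfolding follows_pattern_def Let_def M_def by (metis ij)
  have "S j \<in> {0, 1, 2}" "S' j \<in> {0, 1, 2}" using S j by (auto dest: funcset_mem)
  then show ?thesis using 1 2 \<open>r < \<rho>\<close> by auto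
qed

lemma many_solutions:
  assumes "r < \<rho>" and all: "all_patterns r \<rho> R lam mu k"
  shows "\<exists>U. finite U \<and> card U = 3 ^ (k * m) - 1 \<and>
     (\<forall>u\<in>U. positive_periodic_solution (weight a lam mu) g (of_nat k * T) u)"
proof -
  let ?Q = "positive_periodic_solution (weight a lam mu) g (of_nat k * T)"
  \<comment> \<open>Strings are taken as extensional functions, so that agreement on the index set
    means equality and the count is exact; \<open>z\<close> is the zero string.\<close>
  define A :: "(nat \<Rightarrow> nat) set" where "A = {1..k * m} \<rightarrow>\<^sub>E {0, 1, 2}"
  define z :: "nat \<Rightarrow> nat" where "z = (\<lambda>j\<in>{1..k * m}. 0)"
  have finA: "finite A" unfolding A_def by (intro finite_PiE) auto
  have "card A = 3 ^ (k * m)" unfolding A_def by (simp add: card_PiE numeral_3_eq_3)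
  moreover have "z \<in> A" by (auto simp: A_def z_def)
  ultimately have card: "card (A - {z}) = 3 ^ (k * m) - 1" by (simp add: card_Diff_singleton)
  have A_fun: "S \<in> {1..k * m} \<rightarrow> {0, 1, 2}" if "S \<in> A" for S using that by (auto simp: A_def PiE_def)
  have A_eq: "S = S'" if "S \<in> A" "S' \<in> A" "\<And>j. j \<in> {1..k * m} \<Longrightarrow> S j = S' j" for S S'
    using that unfolding A_def by (intro PiE_ext[of S]) auto
  have "\<forall>S\<in>A - {z}. \<exists>u. ?Q u \<and> follows_pattern r \<rho> R k S u"
  proof
    fix S assume S: "S \<in> A - {z}"
    have "\<exists>j\<in>{1..k * m}. S j \<noteq> 0"
    proof (rule ccontr)
      assume "\<not> ?thesis"
      then have "S = z" using S \<open>z \<in> A\<close> by (intro A_eq) (auto simp: z_def)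
      then show False using S by simp
    qed
    then show "\<exists>u. ?Q u \<and> follows_pattern r \<rho> R k S u" using all A_fun S unfolding all_patterns_def by blast
  qed
  then obtain f where f: "\<And>S. S \<in> A - {z} \<Longrightarrow> ?Q (f S) \<and> follows_pattern r \<rho> R k S (f S)"
    by metis
  have "inj_on f (A - {z})"
  proof (rule inj_onI)
    fix S S' assume SS: "S \<in> A - {z}" "S' \<in> A - {z}" and eq: "f S = f S'"
    show "S = S'"
    proof (rule A_eq)
      fix j assume "j \<in> {1..k * m}"
      then show "S j = S' j"
        using follows_pattern_unique[of r \<rho> R k S "f S" S' j] f[OF SS(1)] f[OF SS(2)] eq \<open>r < \<rho>\<close> A_fun SS by auto
    qed (use SS in auto)
  qed
  then have "card (f ` (A - {z})) = 3 ^ (k * m) - 1" using card by (simp add: card_image)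
  then show ?thesis using finA f by (intro exI[of _ "f ` (A - {z})"]) auto
qed

end

theorem theorem6p1:
  fixes g a :: "real \<Rightarrow> real" and T :: real and m :: nat and \<sigma> \<tau> :: "nat \<Rightarrow> real"
  assumes g_cont: "continuous_on {0..} g"
    and g_zero: "g 0 = 0"
    and g_pos: "\<And>s. 0 < s \<Longrightarrow> 0 < g s"
    and g_lim_zero: "((\<lambda>s. g s / s) \<longlongrightarrow> 0) (at_right 0)"
    and g_lim_infinity: "((\<lambda>s. g s / s) \<longlongrightarrow> 0) at_top"
    and a_loc_int: "locally_integrable a"
    and a_period: "minimal_period T a"
    and m_pos: "1 \<le> m"
    and points: "\<And>i. i \<in> {1..m} \<Longrightarrow> \<sigma> i < \<tau> i \<and> \<tau> i < \<sigma> (i + 1)"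
    and points_period: "\<sigma> (m + 1) - \<sigma> 1 = T"
    and a_pos: "\<And>i. i \<in> {1..m} \<Longrightarrow> succ_zero_on {\<sigma> i..\<tau> i} a"
    and a_neg: "\<And>i. i \<in> {1..m} \<Longrightarrow> prec_zero_on {\<tau> i..\<sigma> (i + 1)} a"
  shows
    "(\<exists>lam0>0. \<forall>lam>lam0. \<exists>mu0>0. \<forall>mu>mu0. \<forall>k::nat. 2 \<le> k \<longrightarrow>
        (\<exists>U. finite U \<and> card U = 3 ^ (k * m) - 1 \<and>
             (\<forall>u\<in>U. positive_periodic_solution (weight a lam mu) g (of_nat k * T) u)))
     \<and>
     (\<forall>\<rho>>0. \<exists>lam0>0. \<forall>lam>lam0. \<exists>r R. 0 < r \<and> r < \<rho> \<and> \<rho> < R \<and>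
        (\<exists>mu0>0. \<forall>mu>mu0. \<forall>k::nat. 2 \<le> k \<longrightarrow>
          (\<forall>S :: nat \<Rightarrow> nat.
             S \<in> {1..k * m} \<rightarrow> {0, 1, 2} \<longrightarrow> (\<exists>j\<in>{1..k * m}. S j \<noteq> 0) \<longrightarrow>
             (\<exists>u. positive_periodic_solution (weight a lam mu) g (of_nat k * T) u \<and>
                (\<forall>i\<in>{1..m}. \<forall>l\<in>{0..k - 1}.
                   let M = max_on (shifted_interval T (\<sigma> i) (\<tau> i) (int l)) u; j = i + l * m
                   in (S j = 0 \<longrightarrow> M < r) \<and>
                      (S j = 1 \<longrightarrow> r < M \<and> M < \<rho>) \<and>
                      (S j = 2 \<longrightarrow> \<rho> < M \<and> M < R))))))"
proof -
  have T: "0 < T" "\<And>t. a (t + T) = a t"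
    using a_period by (auto simp: minimal_period_def periodic_def)
  interpret indefinite_weight g a T m \<sigma> \<tau>
    by (rule indefinite_weight.intro)
      (fact g_cont g_zero g_pos g_lim_zero g_lim_infinity a_loc_int T m_pos points points_period a_pos a_neg)+
  \<comment> \<open>The count mentions no \<open>\<rho>\<close>; any fixed value serves, here
    1.\<close>
  obtain lam0 where lam0: "0 < lam0" "\<And>lam. lam0 < lam \<Longrightarrow> \<exists>r R. 0 < r \<and> r < 1 \<and> 1 < R \<and>
        (\<exists>mu0>0. \<forall>mu>mu0. \<forall>k::nat. 2 \<le> k \<longrightarrow> all_patterns r 1 R lam mu k)"
    using all_patterns_realised[OF zero_less_one] by blast
  have "\<exists>mu0>0. \<forall>mu>mu0. \<forall>k::nat. 2 \<le> k \<longrightarrow>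
        (\<exists>U. finite U \<and> card U = 3 ^ (k * m) - 1 \<and>
             (\<forall>u\<in>U. positive_periodic_solution (weight a lam mu) g (of_nat k * T) u))"
    if lam: "lam0 < lam" for lam
    using lam0(2)[OF lam] many_solutions[of _ 1 _ lam] by meson
  then have count: "\<exists>lam0>0. \<forall>lam>lam0. \<exists>mu0>0. \<forall>mu>mu0. \<forall>k::nat. 2 \<le> k \<longrightarrow>
        (\<exists>U. finite U \<and> card U = 3 ^ (k * m) - 1 \<and>
             (\<forall>u\<in>U. positive_periodic_solution (weight a lam mu) g (of_nat k * T) u))"
    using lam0(1) by blast
  show ?thesis
    by (rule conjI, rule count, intro allI impI)
      (rule all_patterns_realised[unfolded all_patterns_def follows_pattern_def])
qed

end
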